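(* Let $\mathcal{C}=\mathrm{Vect}_\Gamma\oplus\mathrm{Vect}_{\Gamma/2\Gamma}$ be the $\mathbb{Z}_2$-crossed ribbon fusion category described in the context, attached to a discriminant form $(\Gamma,Q)$ and data $(\sigma,\omega,\bar\delta,\varepsilon,q,\alpha,\beta)$. Then the equivariantisation $\mathcal{C}/\!/\mathbb{Z}_2$ has a nondegenerate braiding, and hence is a modular tensor category.
   Context: All categories are $\mathbb{C}$-linear. **Input data.** A discriminant form $(\Gamma,Q)$ is a finite abelian group $\Gamma$ (written additively) with a nondegenerate quadratic form $Q\colon\Gamma\to\mathbb{C}^\times$: $Q(na)=Q(a)^{n^2}$ for $n\in\mathbb{Z}$, and $B_Q(a,b)=Q(a+b)Q(a)^{-1}Q(b)^{-1}$ is bimultiplicative and nondegenerate. Fix functions $\sigma\colon\Gamma^2\to\mathbb{C}^\times$, $\omega\colon\Gamma^3\to\{\pm1\}$ with: $\sigma(a,a)=Q(a)$; $\sigma(a,0)=\sigma(0,a)=1$; $\sigma(a,b)=\sigma(b,a)$; $\omega(a,b,c)=\sigma(a,b+c)\sigma(a,b)^{-1}\sigma(a,c)^{-1}$; and for fixed $b,c$ the map $\omega(\cdot,b,c)\colon\Gamma\to\{\pm1\}$ is a group homomorphism (so it factors through $\Gamma/2\Gamma$, and we allow the first argument of $\omega$ to lie in $\Gamma/2\Gamma$). For $x\in\Gamma$, $\bar x$ denotes its class in $\Gamma/2\Gamma$. Fix $\bar\delta\in\Gamma/2\Gamma$ and $q\colon\Gamma\to\mathbb{C}^\times$ with $q(a)^2=Q(a)$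 and $q(a+b)q(a)^{-1}q(b)^{-1}=\sigma(a,b)\,\omega(a+b,a,b)\,\omega(\bar\delta,a,b)$ for all $a,b\in\Gamma$. Fix $\varepsilon\in\{\pm1\}$, a square root $\alpha$ of $\varepsilon\,G_{\bar\delta}(\Gamma,q^{-1})$, where $G_{\bar\delta}(\Gamma,q^{-1})=|2\Gamma|^{-1/2}\sum_{a\in\bar\delta}q(a)^{-1}$, and $\beta\in\{\alpha^{-1},-\alpha^{-1}\}$. **The category $\mathcal{C}=\mathcal{C}_1\oplus\mathcal{C}_g$** (with $G=\langle g\rangle\cong\mathbb{Z}_2$). It is semisimple, with simple objects $\mathbb{C}_a$ ($a\in\Gamma$) in $\mathcal{C}_1$ and $\mathsf{X}^{\bar x}$ ($\bar x\in\Gamma/2\Gamma$) in $\mathcal{C}_g$. Tensor product: $\mathbb{C}_a\otimes\mathbb{C}_b=\mathbb{C}_{a+b}$, $\mathbb{C}_a\otimes\mathsf{X}^{\bar x}=\mathsf{X}^{\bar a+\bar x}=\mathsf{X}^{\bar x}\otimes\mathbb{C}_a$, $\mathsf{X}^{\bar x}\otimes\mathsf{X}^{\bar y}=\bigoplus_{t\in\bar\delta+\bar x+\bar y}\mathbb{C}_t$. Associator $(A\otimes B)\otimes C\to A\otimes(B\otimes C)$ (with $e_t$ the basis vector of the summand $\mathbb{C}_t$ of a product of two $\mathsf{X}$'s): - $(\mathbb{C}_a,\mathbb{C}_b,\mathbb{C}_c)$: $\omega(a,b,c)$; - $(\mathsf{X}^{\bar x},\mathbb{C}_a,\mathbb{C}_b)$: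 $\omega(\bar x+\bar\delta,a,b)$; - $(\mathbb{C}_a,\mathsf{X}^{\bar x},\mathbb{C}_b)$: $\sigma(a,b)$; - $(\mathbb{C}_a,\mathbb{C}_b,\mathsf{X}^{\bar x})$: $\omega(\bar a+\bar b+\bar x,a,b)$; - $(\mathbb{C}_a,\mathsf{X}^{\bar x},\mathsf{X}^{\bar y})$: $e_{a+t}\mapsto\omega(\bar a+\bar x,a,t)\,e_a\otimes e_t$; - $(\mathsf{X}^{\bar x},\mathsf{X}^{\bar y},\mathbb{C}_a)$: $e_t\otimes e_a\mapsto\omega(\bar x,t,a)\,e_{t+a}$; - $(\mathsf{X}^{\bar x},\mathbb{C}_a,\mathsf{X}^{\bar y})$: $e_t\mapsto\sigma(a,t)\,e_t$; - $(\mathsf{X}^{\bar x},\mathsf{X}^{\bar y},\mathsf{X}^{\bar z})$: the map $\bigoplus_{t\in\bar\delta+\bar x+\bar y}\mathsf{X}^{\bar t+\bar z}\to\bigoplus_{r\in\bar\delta+\bar y+\bar z}\mathsf{X}^{\bar x+\bar r}$ whose component from the $t$-summand to the $r$-summand is $\varepsilon|2\Gamma|^{-1/2}\sigma(t,r)^{-1}$. $\mathbb{Z}_2$-action: $g_*\mathbb{C}_a=\mathbb{C}_{-a}$, $g_*\mathsf{X}^{\bar x}=\mathsf{X}^{\bar x}$, strict composition ($g_*g_*=\mathrm{id}$), tensor structure $\tau^g\colon g_*(A\otimes B)\to g_*A\otimes g_*B$: $\omega(a,b,-b)$ on $(\mathbb{C}_a,\mathbb{C}_b)$; $\omega(\bar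 a+\bar x,a,-a)$ on $(\mathbb{C}_a,\mathsf{X}^{\bar x})$; $\omega(\bar x+\bar\delta,a,-a)$ on $(\mathsf{X}^{\bar x},\mathbb{C}_a)$; $\omega(\bar x,t,-t)$ on the summand $t$ of $(\mathsf{X}^{\bar x},\mathsf{X}^{\bar y})$. $\mathbb{Z}_2$-braiding $c_{A,B}\colon A\otimes B\to h_*(B)\otimes A$ for $A\in\mathcal{C}_h$: $\sigma(a,b)$ on $\mathbb{C}_a\otimes\mathbb{C}_b$; $q(a)^{-1}$ on $\mathbb{C}_a\otimes\mathsf{X}^{\bar x}$; $q(a)^{-1}\omega(\bar x+\bar a,a,-a)$ on $\mathsf{X}^{\bar x}\otimes\mathbb{C}_a\to\mathbb{C}_{-a}\otimes\mathsf{X}^{\bar x}$; $\alpha q(t)$ on the summand $\mathbb{C}_t$ of $\mathsf{X}^{\bar x}\otimes\mathsf{X}^{\bar y}\to\mathsf{X}^{\bar y}\otimes\mathsf{X}^{\bar x}$. $\mathbb{Z}_2$-ribbon twist $\theta_A\colon A\to h_*A$ for $A\in\mathcal{C}_h$: $\theta_{\mathbb{C}_a}=\sigma(a,a)$, $\theta_{\mathsf{X}^{\bar x}}=\beta$. These data define a braided $\mathbb{Z}_2$-crossed fusion category with a $\mathbb{Z}_2$-ribbon structure (this may be taken as given). **Equivariantisation.** Objects of $\mathcal{C}/\!/\mathbb{Z}_2$ are pairs $(X,\varphi)$ with $X\in\mathcal{C}$ and an isomorphism $\varphi=\varphi_g\colon g_*X\to X$ with $\varphi_g\circ g_*(\varphi_g)=\mathrm{id}_X$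 (and $\varphi_1=\mathrm{id}$); morphisms are those commuting with $\varphi$; $(X,\varphi)\otimes(Y,\varphi')=(X\otimes Y,(\varphi_g\otimes\varphi'_g)\circ\tau^g_{X,Y})$. Its braiding is, on the component $X_h\in\mathcal{C}_h$ of $X$, $(\varphi'_h\otimes\mathrm{id})\circ c_{X_h,Y}\colon X_h\otimes Y\to h_*(Y)\otimes X_h\to Y\otimes X_h$, and its ribbon twist on $(X,\varphi)$ is $\bigoplus_h\varphi_h\circ\theta_{X_h}$. A modular tensor category is a ribbon fusion category with nondegenerate braiding. *)

theory Defs
  imports Complex_Main
begin

section \<open>Linear, monoidal, braided, ribbon and modular categories\<close>

text \<open>
  A category is given by a class of objects and a family of Hom sets. The Hom sets need not be
  disjoint, and composition, addition and tensor product of morphisms are given by operations on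
  the whole type of morphisms that are only constrained on the Hom sets.
  The composite of f followed by g is \<open>comp C g f\<close>.
\<close>

record ('o, 'm) mon_cat =
  Obj :: "'o set"
  Hom :: "'o \<Rightarrow> 'o \<Rightarrow> 'm set"
  idm :: "'o \<Rightarrow> 'm"
  comp :: "'m \<Rightarrow> 'm \<Rightarrow> 'm"
  zero :: "'m"
  add :: "'m \<Rightarrow> 'm \<Rightarrow> 'm"
  smult :: "complex \<Rightarrow> 'm \<Rightarrow> 'm"
  tobj :: "'o \<Rightarrow> 'o \<Rightarrow> 'o"
  tmor :: "'m \<Rightarrow> 'm \<Rightarrow> 'm"
  unit :: "'o"
  assoc :: "'o \<Rightarrow> 'o \<Rightarrow> 'o \<Rightarrow> 'm"
  lunit :: "'o \<Rightarrow> 'm"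
  runit :: "'o \<Rightarrow> 'm"

record ('o, 'm) ribbon_cat = "('o, 'm) mon_cat" +
  braid :: "'o \<Rightarrow> 'o \<Rightarrow> 'm"
  twist :: "'o \<Rightarrow> 'm"

definition inverse_mor :: "('o, 'm, 'x) mon_cat_scheme \<Rightarrow> 'o \<Rightarrow> 'o \<Rightarrow> 'm \<Rightarrow> 'm \<Rightarrow> bool" where
  "inverse_mor C A B f f' \<longleftrightarrow>
     f' \<in> Hom C B A \<and> comp C f' f = idm C A \<and> comp C f f' = idm C B"

definition is_iso :: "('o, 'm, 'x) mon_cat_scheme \<Rightarrow> 'o \<Rightarrow> 'o \<Rightarrow> 'm \<Rightarrow> bool" where
  "is_iso C A B f \<longleftrightarrow> f \<in> Hom C A B \<and> (\<exists>f'. inverse_mor C A B f f')"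

definition inv_mor :: "('o, 'm, 'x) mon_cat_scheme \<Rightarrow> 'o \<Rightarrow> 'o \<Rightarrow> 'm \<Rightarrow> 'm" where
  "inv_mor C A B f = (THE f'. inverse_mor C A B f f')"

definition assoc_inv :: "('o, 'm, 'x) mon_cat_scheme \<Rightarrow> 'o \<Rightarrow> 'o \<Rightarrow> 'o \<Rightarrow> 'm" where
  "assoc_inv C A B D =
     inv_mor C (tobj C (tobj C A B) D) (tobj C A (tobj C B D)) (assoc C A B D)"

locale linear_category =
  fixes C :: "('o, 'm, 'x) mon_cat_scheme"
  assumes id_in: "A \<in> Obj C \<Longrightarrow> idm C A \<in> Hom C A A"
    and comp_in: "\<lbrakk>A \<in> Obj C; B \<in> Obj C; D \<in> Obj C; f \<in> Hom C A B; g \<in> Hom C B D\<rbrakk>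
        \<Longrightarrow> comp C g f \<in> Hom C A D"
    and comp_id: "\<lbrakk>A \<in> Obj C; B \<in> Obj C; f \<in> Hom C A B\<rbrakk>
        \<Longrightarrow> comp C f (idm C A) = f \<and> comp C (idm C B) f = f"
    and comp_assoc: "\<lbrakk>A \<in> Obj C; B \<in> Obj C; D \<in> Obj C; E \<in> Obj C;
          f \<in> Hom C A B; g \<in> Hom C B D; h \<in> Hom C D E\<rbrakk>
        \<Longrightarrow> comp C h (comp C g f) = comp C (comp C h g) f"
    and zero_in: "\<lbrakk>A \<in> Obj C; B \<in> Obj C\<rbrakk> \<Longrightarrow> zero C \<in> Hom C A B"
    and add_in: "\<lbrakk>A \<in> Obj C; B \<in> Obj C; f \<in> Hom C A B; g \<in> Hom C A B\<rbrakk>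
        \<Longrightarrow> add C f g \<in> Hom C A B"
    and smult_in: "\<lbrakk>A \<in> Obj C; B \<in> Obj C; f \<in> Hom C A B\<rbrakk> \<Longrightarrow> smult C k f \<in> Hom C A B"
    and add_assoc: "\<lbrakk>A \<in> Obj C; B \<in> Obj C; f \<in> Hom C A B; g \<in> Hom C A B; h \<in> Hom C A B\<rbrakk>
        \<Longrightarrow> add C (add C f g) h = add C f (add C g h)"
    and add_comm: "\<lbrakk>A \<in> Obj C; B \<in> Obj C; f \<in> Hom C A B; g \<in> Hom C A B\<rbrakk>
        \<Longrightarrow> add C f g = add C g f"
    and add_zero: "\<lbrakk>A \<in> Obj C; B \<in> Obj C; f \<in> Hom C A B\<rbrakk> \<Longrightarrow> add C (zero C) f = f"
    and add_neg: "\<lbrakk>A \<in> Obj C; B \<in> Obj C; f \<in> Hom C A B\<rbrakk>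
        \<Longrightarrow> add C f (smult C (-1) f) = zero C"
    and smult_one: "\<lbrakk>A \<in> Obj C; B \<in> Obj C; f \<in> Hom C A B\<rbrakk> \<Longrightarrow> smult C 1 f = f"
    and smult_smult: "\<lbrakk>A \<in> Obj C; B \<in> Obj C; f \<in> Hom C A B\<rbrakk>
        \<Longrightarrow> smult C k (smult C l f) = smult C (k * l) f"
    and smult_add_left: "\<lbrakk>A \<in> Obj C; B \<in> Obj C; f \<in> Hom C A B\<rbrakk>
        \<Longrightarrow> smult C (k + l) f = add C (smult C k f) (smult C l f)"
    and smult_add_right: "\<lbrakk>A \<in> Obj C; B \<in> Obj C; f \<in> Hom C A B; g \<in> Hom C A B\<rbrakk>
        \<Longrightarrow> smult C k (add C f g) = add C (smult C k f) (smult C k g)"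
    and comp_add_left: "\<lbrakk>A \<in> Obj C; B \<in> Obj C; D \<in> Obj C;
          f \<in> Hom C A B; g \<in> Hom C B D; g' \<in> Hom C B D\<rbrakk>
        \<Longrightarrow> comp C (add C g g') f = add C (comp C g f) (comp C g' f)"
    and comp_add_right: "\<lbrakk>A \<in> Obj C; B \<in> Obj C; D \<in> Obj C;
          f \<in> Hom C A B; f' \<in> Hom C A B; g \<in> Hom C B D\<rbrakk>
        \<Longrightarrow> comp C g (add C f f') = add C (comp C g f) (comp C g f')"
    and comp_smult: "\<lbrakk>A \<in> Obj C; B \<in> Obj C; D \<in> Obj C; f \<in> Hom C A B; g \<in> Hom C B D\<rbrakk>
        \<Longrightarrow> comp C (smult C k g) f = smult C k (comp C g f) \<and>
            comp C g (smult C k f) = smult C k (comp C g f)"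

locale monoidal_category = linear_category C
  for C :: "('o, 'm, 'x) mon_cat_scheme" +
  assumes unit_in: "unit C \<in> Obj C"
    and tobj_in: "\<lbrakk>A \<in> Obj C; B \<in> Obj C\<rbrakk> \<Longrightarrow> tobj C A B \<in> Obj C"
    and tmor_in: "\<lbrakk>A \<in> Obj C; A' \<in> Obj C; B \<in> Obj C; B' \<in> Obj C;
          f \<in> Hom C A A'; g \<in> Hom C B B'\<rbrakk> \<Longrightarrow> tmor C f g \<in> Hom C (tobj C A B) (tobj C A' B')"
    and tmor_id: "\<lbrakk>A \<in> Obj C; B \<in> Obj C\<rbrakk>
        \<Longrightarrow> tmor C (idm C A) (idm C B) = idm C (tobj C A B)"
    and tmor_comp: "\<lbrakk>A \<in> Obj C; A' \<in> Obj C; A'' \<in> Obj C; B \<in> Obj C; B' \<in> Obj C; B'' \<in> Obj C;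
          f \<in> Hom C A A'; f' \<in> Hom C A' A''; g \<in> Hom C B B'; g' \<in> Hom C B' B''\<rbrakk>
        \<Longrightarrow> tmor C (comp C f' f) (comp C g' g) = comp C (tmor C f' g') (tmor C f g)"
    and tmor_add_left: "\<lbrakk>A \<in> Obj C; A' \<in> Obj C; B \<in> Obj C; B' \<in> Obj C;
          f \<in> Hom C A A'; f' \<in> Hom C A A'; g \<in> Hom C B B'\<rbrakk>
        \<Longrightarrow> tmor C (add C f f') g = add C (tmor C f g) (tmor C f' g)"
    and tmor_add_right: "\<lbrakk>A \<in> Obj C; A' \<in> Obj C; B \<in> Obj C; B' \<in> Obj C;
          f \<in> Hom C A A'; g \<in> Hom C B B'; g' \<in> Hom C B B'\<rbrakk>
        \<Longrightarrow> tmor C f (add C g g') = add C (tmor C f g) (tmor C f g')"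
    and tmor_smult: "\<lbrakk>A \<in> Obj C; A' \<in> Obj C; B \<in> Obj C; B' \<in> Obj C;
          f \<in> Hom C A A'; g \<in> Hom C B B'\<rbrakk>
        \<Longrightarrow> tmor C (smult C k f) g = smult C k (tmor C f g) \<and>
            tmor C f (smult C k g) = smult C k (tmor C f g)"
    and assoc_iso: "\<lbrakk>A \<in> Obj C; B \<in> Obj C; D \<in> Obj C\<rbrakk>
        \<Longrightarrow> is_iso C (tobj C (tobj C A B) D) (tobj C A (tobj C B D)) (assoc C A B D)"
    and assoc_natural: "\<lbrakk>A \<in> Obj C; A' \<in> Obj C; B \<in> Obj C; B' \<in> Obj C; D \<in> Obj C; D' \<in> Obj C;
          f \<in> Hom C A A'; g \<in> Hom C B B'; h \<in> Hom C D D'\<rbrakk>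
        \<Longrightarrow> comp C (assoc C A' B' D') (tmor C (tmor C f g) h) =
            comp C (tmor C f (tmor C g h)) (assoc C A B D)"
    and lunit_iso: "A \<in> Obj C \<Longrightarrow> is_iso C (tobj C (unit C) A) A (lunit C A)"
    and lunit_natural: "\<lbrakk>A \<in> Obj C; A' \<in> Obj C; f \<in> Hom C A A'\<rbrakk>
        \<Longrightarrow> comp C (lunit C A') (tmor C (idm C (unit C)) f) = comp C f (lunit C A)"
    and runit_iso: "A \<in> Obj C \<Longrightarrow> is_iso C (tobj C A (unit C)) A (runit C A)"
    and runit_natural: "\<lbrakk>A \<in> Obj C; A' \<in> Obj C; f \<in> Hom C A A'\<rbrakk>
        \<Longrightarrow> comp C (runit C A') (tmor C f (idm C (unit C))) = comp C f (runit C A)"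
    and triangle: "\<lbrakk>A \<in> Obj C; B \<in> Obj C\<rbrakk>
        \<Longrightarrow> comp C (tmor C (idm C A) (lunit C B)) (assoc C A (unit C) B) =
            tmor C (runit C A) (idm C B)"
    and pentagon: "\<lbrakk>A \<in> Obj C; B \<in> Obj C; D \<in> Obj C; E \<in> Obj C\<rbrakk>
        \<Longrightarrow> comp C (assoc C A B (tobj C D E)) (assoc C (tobj C A B) D E) =
            comp C (tmor C (idm C A) (assoc C B D E))
              (comp C (assoc C A (tobj C B D) E) (tmor C (assoc C A B D) (idm C E)))"

text \<open>
  \<open>is_dual C A A' ev coev\<close>: A' is a left dual of A (equivalently, A is a right dual of A').
\<close>

definition is_dual :: "('o, 'm, 'x) mon_cat_scheme \<Rightarrow> 'o \<Rightarrow> 'o \<Rightarrow> 'm \<Rightarrow> 'm \<Rightarrow> bool" where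
  "is_dual C A A' ev coev \<longleftrightarrow>
     ev \<in> Hom C (tobj C A' A) (unit C) \<and> coev \<in> Hom C (unit C) (tobj C A A') \<and>
     comp C (runit C A) (comp C (tmor C (idm C A) ev)
       (comp C (assoc C A A' A) (tmor C coev (idm C A)))) = lunit C A \<and>
     comp C (lunit C A') (comp C (tmor C ev (idm C A'))
       (comp C (assoc_inv C A' A A') (tmor C (idm C A') coev))) = runit C A'"

definition is_rigid :: "('o, 'm, 'x) mon_cat_scheme \<Rightarrow> bool" where
  "is_rigid C \<longleftrightarrow> (\<forall>A\<in>Obj C.
     (\<exists>A'\<in>Obj C. \<exists>ev coev. is_dual C A A' ev coev) \<and>
     (\<exists>A'\<in>Obj C. \<exists>ev coev. is_dual C A' A ev coev))"

definition msum :: "('o, 'm, 'x) mon_cat_scheme \<Rightarrow> 'm list \<Rightarrow> 'm" where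
  "msum C fs = foldr (add C) fs (zero C)"

definition is_direct_sum :: "('o, 'm, 'x) mon_cat_scheme \<Rightarrow> 'o \<Rightarrow> 'o list \<Rightarrow> bool" where
  "is_direct_sum C X As \<longleftrightarrow> (\<exists>inc pr.
     (\<forall>i<length As. inc i \<in> Hom C (As ! i) X \<and> pr i \<in> Hom C X (As ! i)) \<and>
     (\<forall>i<length As. \<forall>j<length As.
        comp C (pr i) (inc j) = (if i = j then idm C (As ! i) else zero C)) \<and>
     msum C (map (\<lambda>i. comp C (inc i) (pr i)) [0..<length As]) = idm C X)"

definition is_simple :: "('o, 'm, 'x) mon_cat_scheme \<Rightarrow> 'o \<Rightarrow> bool" where
  "is_simple C A \<longleftrightarrow> A \<in> Obj C \<and> idm C A \<noteq> zero C \<and> Hom C A A = {smult C k (idm C A) | k. True}"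

text \<open>
  Fusion categories over the complex numbers as in Turaev--Virelizier: additive, with a finite set
  of simple objects (End = scalars) that contains the unit and has no non-zero morphisms between
  distinct members, such that every object is a finite direct sum of these; and rigid.
\<close>

locale fusion_category = monoidal_category C
  for C :: "('o, 'm, 'x) mon_cat_scheme" +
  assumes direct_sums: "set As \<subseteq> Obj C \<Longrightarrow> \<exists>X\<in>Obj C. is_direct_sum C X As"
    and semisimple: "\<exists>S. finite S \<and> unit C \<in> S \<and> (\<forall>A\<in>S. is_simple C A) \<and>
          (\<forall>A\<in>S. \<forall>B\<in>S. A \<noteq> B \<longrightarrow> Hom C A B = {zero C}) \<and>
          (\<forall>X\<in>Obj C. \<exists>As. set As \<subseteq> S \<and> is_direct_sum C X As)"
    and rigid: "is_rigid C"

text \<open>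
  The last axiom says that the twist of a dual is the dual of the twist, the dual of f being the
  morphism f' with \<open>ev \<circ> (f' \<otimes> id) = ev \<circ> (id \<otimes> f)\<close>.
\<close>

locale ribbon_fusion_category = fusion_category C
  for C :: "('o, 'm, 'x) ribbon_cat_scheme" +
  assumes braid_iso: "\<lbrakk>A \<in> Obj C; B \<in> Obj C\<rbrakk>
        \<Longrightarrow> is_iso C (tobj C A B) (tobj C B A) (braid C A B)"
    and braid_natural: "\<lbrakk>A \<in> Obj C; A' \<in> Obj C; B \<in> Obj C; B' \<in> Obj C;
          f \<in> Hom C A A'; g \<in> Hom C B B'\<rbrakk>
        \<Longrightarrow> comp C (braid C A' B') (tmor C f g) = comp C (tmor C g f) (braid C A B)"
    and hexagon1: "\<lbrakk>A \<in> Obj C; B \<in> Obj C; D \<in> Obj C\<rbrakk>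
        \<Longrightarrow> comp C (assoc C B D A) (comp C (braid C A (tobj C B D)) (assoc C A B D)) =
            comp C (tmor C (idm C B) (braid C A D))
              (comp C (assoc C B A D) (tmor C (braid C A B) (idm C D)))"
    and hexagon2: "\<lbrakk>A \<in> Obj C; B \<in> Obj C; D \<in> Obj C\<rbrakk>
        \<Longrightarrow> comp C (assoc_inv C D A B) (comp C (braid C (tobj C A B) D) (assoc_inv C A B D)) =
            comp C (tmor C (braid C A D) (idm C B))
              (comp C (assoc_inv C A D B) (tmor C (idm C A) (braid C B D)))"
    and twist_iso: "A \<in> Obj C \<Longrightarrow> is_iso C A A (twist C A)"
    and twist_natural: "\<lbrakk>A \<in> Obj C; A' \<in> Obj C; f \<in> Hom C A A'\<rbrakk>
        \<Longrightarrow> comp C (twist C A') f = comp C f (twist C A)"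
    and twist_tensor: "\<lbrakk>A \<in> Obj C; B \<in> Obj C\<rbrakk>
        \<Longrightarrow> twist C (tobj C A B) =
            comp C (braid C B A) (comp C (braid C A B) (tmor C (twist C A) (twist C B)))"
    and twist_dual: "\<lbrakk>A \<in> Obj C; A' \<in> Obj C; is_dual C A A' ev coev\<rbrakk>
        \<Longrightarrow> comp C ev (tmor C (twist C A') (idm C A)) = comp C ev (tmor C (idm C A') (twist C A))"

text \<open>Non-degeneracy: the Mueger centre is trivial.\<close>

definition is_transparent :: "('o, 'm, 'x) ribbon_cat_scheme \<Rightarrow> 'o \<Rightarrow> bool" where
  "is_transparent C A \<longleftrightarrow>
     (\<forall>B\<in>Obj C. comp C (braid C B A) (braid C A B) = idm C (tobj C A B))"

definition nondegenerate_braiding :: "('o, 'm, 'x) ribbon_cat_scheme \<Rightarrow> bool" where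
  "nondegenerate_braiding C \<longleftrightarrow>
     (\<forall>A\<in>Obj C. is_transparent C A \<longrightarrow> (\<exists>n. is_direct_sum C A (replicate n (unit C))))"

definition modular_tensor_category :: "('o, 'm, 'x) ribbon_cat_scheme \<Rightarrow> bool" where
  "modular_tensor_category C \<longleftrightarrow> ribbon_fusion_category C \<and> nondegenerate_braiding C"


section \<open>Equivariantisation of a category with Z2-crossed braiding and twist\<close>

datatype Z2 = Z2_1 | Z2_g

text \<open>
  \<open>part C h X\<close> is the component of degree h of X, with inclusion \<open>part_in C h X\<close> and projection
  \<open>part_pr C h X\<close>. The action of h on objects and morphisms is \<open>act_obj C h\<close> and \<open>act_mor C h\<close>; it
  is strictly multiplicative in h and strictly unital (g fixes the unit object). The tensor
  structure of the action of g is \<open>act_tens C A B\<close>, from g(A B) to (g A)(g B). The crossed braiding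
  \<open>xbraid C A B\<close>, from A B to (h B) A, and the twist \<open>xtwist C A\<close>, from A to h A, are used for A
  homogeneous of degree h.
\<close>

record ('o, 'm) crossed_cat = "('o, 'm) mon_cat" +
  part :: "Z2 \<Rightarrow> 'o \<Rightarrow> 'o"
  part_in :: "Z2 \<Rightarrow> 'o \<Rightarrow> 'm"
  part_pr :: "Z2 \<Rightarrow> 'o \<Rightarrow> 'm"
  act_obj :: "Z2 \<Rightarrow> 'o \<Rightarrow> 'o"
  act_mor :: "Z2 \<Rightarrow> 'm \<Rightarrow> 'm"
  act_tens :: "'o \<Rightarrow> 'o \<Rightarrow> 'm"
  xbraid :: "'o \<Rightarrow> 'o \<Rightarrow> 'm"
  xtwist :: "'o \<Rightarrow> 'm"

fun eqv_mor :: "('o, 'm, 'x) crossed_cat_scheme \<Rightarrow> Z2 \<Rightarrow> 'o \<times> 'm \<Rightarrow> 'm" where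
  "eqv_mor C Z2_1 (X, \<phi>) = idm C X"
| "eqv_mor C Z2_g (X, \<phi>) = \<phi>"

definition equivariantisation ::
  "('o, 'm, 'x) crossed_cat_scheme \<Rightarrow> ('o \<times> 'm, 'm) ribbon_cat" where
  "equivariantisation C = \<lparr>
     Obj = {(X, \<phi>). X \<in> Obj C \<and> is_iso C (act_obj C Z2_g X) X \<phi> \<and>
                    comp C \<phi> (act_mor C Z2_g \<phi>) = idm C X},
     Hom = (\<lambda>(X, \<phi>) (Y, \<psi>). {f \<in> Hom C X Y. comp C f \<phi> = comp C \<psi> (act_mor C Z2_g f)}),
     idm = (\<lambda>(X, \<phi>). idm C X),
     comp = comp C,
     zero = zero C,
     add = add C,
     smult = smult C,
     tobj = (\<lambda>(X, \<phi>) (Y, \<psi>). (tobj C X Y, comp C (tmor C \<phi> \<psi>) (act_tens C X Y))),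
     tmor = tmor C,
     unit = (unit C, idm C (unit C)),
     assoc = (\<lambda>(X, _) (Y, _) (Z, _). assoc C X Y Z),
     lunit = (\<lambda>(X, _). lunit C X),
     runit = (\<lambda>(X, _). runit C X),
     braid = (\<lambda>(X, \<phi>) (Y, \<psi>). msum C (map (\<lambda>h.
        comp C (tmor C (idm C Y) (part_in C h X))
          (comp C (tmor C (eqv_mor C h (Y, \<psi>)) (idm C (part C h X)))
            (comp C (xbraid C (part C h X) Y) (tmor C (part_pr C h X) (idm C Y)))))
        [Z2_1, Z2_g])),
     twist = (\<lambda>(X, \<phi>). msum C (map (\<lambda>h.
        comp C (eqv_mor C h (X, \<phi>))
          (comp C (act_mor C h (part_in C h X))
            (comp C (xtwist C (part C h X)) (part_pr C h X))))
        [Z2_1, Z2_g])) \<rparr>"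


section \<open>Discriminant forms and the input data\<close>

definition int_mult :: "int \<Rightarrow> 'a::ab_group_add \<Rightarrow> 'a" where
  "int_mult n a =
     (if n \<ge> 0 then (((+) a) ^^ nat n) 0 else - ((((+) a) ^^ nat (- n)) 0))"

definition bilin :: "('a::ab_group_add \<Rightarrow> complex) \<Rightarrow> 'a \<Rightarrow> 'a \<Rightarrow> complex" where
  "bilin Q a b = Q (a + b) * inverse (Q a) * inverse (Q b)"

locale discriminant_form =
  fixes Q :: "'a::{finite, ab_group_add} \<Rightarrow> complex"
  assumes Q_nonzero: "Q a \<noteq> 0"
    and Q_quadratic: "Q (int_mult n a) = Q a powi (n\<^sup>2)"
    and B_mult_left: "bilin Q (a + a') b = bilin Q a b * bilin Q a' b"
    and B_mult_right: "bilin Q a (b + b') = bilin Q a b * bilin Q a b'"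
    and B_nondegenerate: "(\<And>b. bilin Q a b = 1) \<Longrightarrow> a = 0"

text \<open>The type \<open>'a mod2\<close> is the quotient group of \<open>'a\<close> by the subgroup of all a + a.\<close>

quotient_type (overloaded) 'a mod2 = "'a::ab_group_add" / "\<lambda>x y. \<exists>z. x - y = z + z"
proof (rule equivpI)
  show "reflp (\<lambda>x y::'a. \<exists>z. x - y = z + z)"
    by (rule reflpI) (auto intro: exI[of _ 0])
  show "symp (\<lambda>x y::'a. \<exists>z. x - y = z + z)"
  proof (rule sympI)
    fix x y :: 'a assume "\<exists>z. x - y = z + z"
    then obtain z where "x - y = z + z" ..
    then have "y - x = (- z) + (- z)"
      using minus_diff_eq[of x y] by simp
    then show "\<exists>z. y - x = z + z" ..
  qed
  show "transp (\<lambda>x y::'a. \<exists>z. x - y = z + z)"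
  proof (rule transpI)
    fix x y w :: 'a assume "\<exists>z. x - y = z + z" "\<exists>z. y - w = z + z"
    then obtain z z' where "x - y = z + z" "y - w = z' + z'" by blast
    moreover have "x - w = (x - y) + (y - w)"
      by simp
    ultimately have "x - w = (z + z') + (z + z')"
      by (simp only: add.assoc add.commute add.left_commute)
    then show "\<exists>z. x - w = z + z" ..
  qed
qed

instantiation mod2 :: (ab_group_add) ab_group_add
begin

lift_definition zero_mod2 :: "'a mod2" is "0" .

lift_definition plus_mod2 :: "'a mod2 \<Rightarrow> 'a mod2 \<Rightarrow> 'a mod2" is "(+)"
proof -
  fix a a' b b' :: 'a
  assume "\<exists>z. a - a' = z + z" "\<exists>z. b - b' = z + z"
  then obtain z z' where "a - a' = z + z" "b - b' = z' + z'" by blast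
  moreover have "(a + b) - (a' + b') = (a - a') + (b - b')"
    by simp
  ultimately have "(a + b) - (a' + b') = (z + z') + (z + z')"
    by (simp only: add.assoc add.commute add.left_commute)
  then show "\<exists>z. (a + b) - (a' + b') = z + z" ..
qed

lift_definition uminus_mod2 :: "'a mod2 \<Rightarrow> 'a mod2" is "uminus"
proof -
  fix a a' :: 'a
  assume "\<exists>z. a - a' = z + z"
  then obtain z where "a - a' = z + z" ..
  then have "(- a) - (- a') = (- z) + (- z)"
    using minus_diff_eq[of a a'] by (simp add: algebra_simps)
  then show "\<exists>z. (- a) - (- a') = z + z" ..
qed

definition minus_mod2 :: "'a mod2 \<Rightarrow> 'a mod2 \<Rightarrow> 'a mod2" where
  "minus_mod2 a b = a + (- b)"

instance
proof
  fix a b c :: "'a mod2"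
  show "a + b + c = a + (b + c)"
    by transfer (auto intro!: exI[of _ 0] simp: algebra_simps)
  show "a + b = b + a"
    by transfer (auto intro!: exI[of _ 0] simp: algebra_simps)
  show "0 + a = a"
    by transfer (auto intro!: exI[of _ 0])
  show "- a + a = 0"
    by transfer (auto intro!: exI[of _ 0])
  show "a - b = a + (- b)"
    by (rule minus_mod2_def)
qed

end

abbreviation cls :: "'a::ab_group_add \<Rightarrow> 'a mod2" where
  "cls \<equiv> abs_mod2"

text \<open>
  The function \<open>\<omega>\<close> with first argument in the quotient; independent of the chosen representative
  whenever \<open>\<omega>\<close> takes values in \<open>{1, -1}\<close> and is a homomorphism in its first argument.
\<close>

definition om_bar ::
  "('a::ab_group_add \<Rightarrow> 'a \<Rightarrow> 'a \<Rightarrow> complex) \<Rightarrow> 'a mod2 \<Rightarrow> 'a \<Rightarrow> 'a \<Rightarrow> complex" where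
  "om_bar \<omega> x a b = \<omega> (rep_mod2 x) a b"

text \<open>\<open>inv_sqrt_double\<close> is the cardinality of the subgroup of all a + a, to the power -1/2.\<close>

definition inv_sqrt_double :: "'a::{finite, ab_group_add} itself \<Rightarrow> complex" where
  "inv_sqrt_double _ = complex_of_real (1 / sqrt (real (card (range (\<lambda>a::'a. a + a)))))"

definition gauss_sum :: "'a mod2 \<Rightarrow> ('a::{finite, ab_group_add} \<Rightarrow> complex) \<Rightarrow> complex" where
  "gauss_sum \<delta> f = inv_sqrt_double TYPE('a) * (\<Sum>a\<in>{a. cls a = \<delta>}. f a)"

locale crossed_data = discriminant_form Q
  for Q :: "'a::{finite, ab_group_add} \<Rightarrow> complex" +
  fixes \<sigma> :: "'a \<Rightarrow> 'a \<Rightarrow> complex"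
    and \<omega> :: "'a \<Rightarrow> 'a \<Rightarrow> 'a \<Rightarrow> complex"
    and \<delta> :: "'a mod2"
    and \<epsilon> :: complex
    and q :: "'a \<Rightarrow> complex"
    and \<alpha> \<beta> :: complex
  assumes \<sigma>_nonzero: "\<sigma> a b \<noteq> 0"
    and \<sigma>_diag: "\<sigma> a a = Q a"
    and \<sigma>_zero: "\<sigma> a 0 = 1" "\<sigma> 0 a = 1"
    and \<sigma>_sym: "\<sigma> a b = \<sigma> b a"
    and \<omega>_sign: "\<omega> a b c \<in> {1, -1}"
    and \<omega>_\<sigma>: "\<omega> a b c = \<sigma> a (b + c) * inverse (\<sigma> a b) * inverse (\<sigma> a c)"
    and \<omega>_hom: "\<omega> (a + a') b c = \<omega> a b c * \<omega> a' b c"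
    and q_nonzero: "q a \<noteq> 0"
    and q_square: "(q a)\<^sup>2 = Q a"
    and q_\<sigma>: "q (a + b) * inverse (q a) * inverse (q b) = \<sigma> a b * \<omega> (a + b) a b * om_bar \<omega> \<delta> a b"
    and \<epsilon>_sign: "\<epsilon> \<in> {1, -1}"
    and \<alpha>_square: "\<alpha>\<^sup>2 = \<epsilon> * gauss_sum \<delta> (\<lambda>a. inverse (q a))"
    and \<beta>_choice: "\<beta> \<in> {inverse \<alpha>, - inverse \<alpha>}"


section \<open>The Z2-crossed category\<close>

text \<open>\<open>Vec a\<close> and \<open>Tw x\<close> are the simple objects written \<open>\<C>\<^sub>a\<close> and \<open>X\<close> with upper index x.\<close>

datatype ('a, 'x) label = Vec 'a | Tw 'x

type_synonym 'a simple = "('a, 'a mod2) label"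

text \<open>
  The semisimple category with these simple objects is realised as follows. An object is a finite
  set of basis vectors, each of which carries a label saying to which simple object it belongs: the
  object is the direct sum of the labels of its elements. Morphisms are complex matrices without
  entries between basis vectors of different labels; \<open>M u s\<close> is the coefficient of the target basis
  vector u in the image of the source basis vector s. To have enough names for basis vectors, these
  are taken to be trees. \<open>Leaf n s\<close> is the n-th spare copy of s, and \<open>Node a b s\<close> is
  the summand s in the tensor product of the basis vectors a and b.
\<close>

datatype 's basis_tree = Leaf nat 's | Node "'s basis_tree" "'s basis_tree" 's

type_synonym 'a tree = "'a simple basis_tree"

type_synonym 'a mat = "'a tree \<Rightarrow> 'a tree \<Rightarrow> complex"

fun lab :: "'s basis_tree \<Rightarrow> 's" where
  "lab (Leaf n s) = s"
| "lab (Node a b s) = s"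

fun degree :: "('a, 'x) label \<Rightarrow> Z2" where
  "degree (Vec a) = Z2_1"
| "degree (Tw x) = Z2_g"

fun fus :: "'a::ab_group_add mod2 \<Rightarrow> 'a simple \<Rightarrow> 'a simple \<Rightarrow> 'a simple set" where
  "fus \<delta> (Vec a) (Vec b) = {Vec (a + b)}"
| "fus \<delta> (Vec a) (Tw x) = {Tw (cls a + x)}"
| "fus \<delta> (Tw x) (Vec a) = {Tw (cls a + x)}"
| "fus \<delta> (Tw x) (Tw y) = {Vec t | t. cls t = \<delta> + x + y}"

definition mat_hom :: "'a tree set \<Rightarrow> 'a tree set \<Rightarrow> 'a mat set" where
  "mat_hom A B = {M. \<forall>u s. M u s \<noteq> 0 \<longrightarrow> u \<in> B \<and> s \<in> A \<and> lab u = lab s}"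

definition mat_id :: "'a tree set \<Rightarrow> 'a mat" where
  "mat_id A = (\<lambda>u s. if u = s \<and> s \<in> A then 1 else 0)"

definition mat_mult :: "'a mat \<Rightarrow> 'a mat \<Rightarrow> 'a mat" where
  "mat_mult N M = (\<lambda>u s. \<Sum>t | M t s \<noteq> 0. N u t * M t s)"

definition tens :: "'a::ab_group_add mod2 \<Rightarrow> 'a tree set \<Rightarrow> 'a tree set \<Rightarrow> 'a tree set" where
  "tens \<delta> A B = {Node a b s | a b s. a \<in> A \<and> b \<in> B \<and> s \<in> fus \<delta> (lab a) (lab b)}"

definition mat_tens :: "'a::ab_group_add mod2 \<Rightarrow> 'a mat \<Rightarrow> 'a mat \<Rightarrow> 'a mat" where
  "mat_tens \<delta> M N = (\<lambda>u s. case (u, s) of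
     (Node a' b' d', Node a b d) \<Rightarrow>
       if d' = d \<and> d \<in> fus \<delta> (lab a) (lab b) then M a' a * N b' b else 0
   | _ \<Rightarrow> 0)"

definition unit_obj :: "'a::ab_group_add tree set" where
  "unit_obj = {Leaf 0 (Vec 0)}"

definition mat_lunit :: "'a::ab_group_add tree set \<Rightarrow> 'a mat" where
  "mat_lunit A = (\<lambda>u s. if u \<in> A \<and> s = Node (Leaf 0 (Vec 0)) u (lab u) then 1 else 0)"

definition mat_runit :: "'a::ab_group_add tree set \<Rightarrow> 'a mat" where
  "mat_runit A = (\<lambda>u s. if u \<in> A \<and> s = Node u (Leaf 0 (Vec 0)) (lab u) then 1 else 0)"

text \<open>
  The associator of x, y, z. The arguments e, f, d are the labels of the summands in
  \<open>x \<otimes> y\<close>, in \<open>y \<otimes> z\<close> and in the triple product; only admissible ones matter.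
\<close>

fun assoc_sym :: "('a::{finite, ab_group_add} \<Rightarrow> 'a \<Rightarrow> complex) \<Rightarrow> ('a \<Rightarrow> 'a \<Rightarrow> 'a \<Rightarrow> complex) \<Rightarrow>
    'a mod2 \<Rightarrow> complex \<Rightarrow> 'a simple \<Rightarrow> 'a simple \<Rightarrow> 'a simple \<Rightarrow>
    'a simple \<Rightarrow> 'a simple \<Rightarrow> 'a simple \<Rightarrow> complex" where
  "assoc_sym \<sigma> \<omega> \<delta> \<epsilon> (Vec a) (Vec b) (Vec c) e f d = \<omega> a b c"
| "assoc_sym \<sigma> \<omega> \<delta> \<epsilon> (Tw x) (Vec a) (Vec b) e f d = om_bar \<omega> (x + \<delta>) a b"
| "assoc_sym \<sigma> \<omega> \<delta> \<epsilon> (Vec a) (Tw x) (Vec b) e f d = \<sigma> a b"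
| "assoc_sym \<sigma> \<omega> \<delta> \<epsilon> (Vec a) (Vec b) (Tw x) e f d = om_bar \<omega> (cls a + cls b + x) a b"
| "assoc_sym \<sigma> \<omega> \<delta> \<epsilon> (Vec a) (Tw x) (Tw y) e (Vec t) d = om_bar \<omega> (cls a + x) a t"
| "assoc_sym \<sigma> \<omega> \<delta> \<epsilon> (Tw x) (Tw y) (Vec a) (Vec t) f d = om_bar \<omega> x t a"
| "assoc_sym \<sigma> \<omega> \<delta> \<epsilon> (Tw x) (Vec a) (Tw y) e f (Vec t) = \<sigma> a t"
| "assoc_sym \<sigma> \<omega> \<delta> \<epsilon> (Tw x) (Tw y) (Tw z) (Vec t) (Vec r) d =
     \<epsilon> * inv_sqrt_double TYPE('a) * inverse (\<sigma> t r)"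

definition mat_assoc :: "('a::{finite, ab_group_add} \<Rightarrow> 'a \<Rightarrow> complex) \<Rightarrow>
    ('a \<Rightarrow> 'a \<Rightarrow> 'a \<Rightarrow> complex) \<Rightarrow> 'a mod2 \<Rightarrow> complex \<Rightarrow>
    'a tree set \<Rightarrow> 'a tree set \<Rightarrow> 'a tree set \<Rightarrow> 'a mat" where
  "mat_assoc \<sigma> \<omega> \<delta> \<epsilon> A B C = (\<lambda>u s.
     if s \<in> tens \<delta> (tens \<delta> A B) C \<and> u \<in> tens \<delta> A (tens \<delta> B C) then
       (case (s, u) of
          (Node (Node a b e) c d, Node a' (Node b' c' f) d') \<Rightarrow>
            if a' = a \<and> b' = b \<and> c' = c \<and> d' = d
            then assoc_sym \<sigma> \<omega> \<delta> \<epsilon> (lab a) (lab b) (lab c) e f d else 0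
        | _ \<Rightarrow> 0)
     else 0)"

fun g_simple :: "'a::ab_group_add simple \<Rightarrow> 'a simple" where
  "g_simple (Vec a) = Vec (- a)"
| "g_simple (Tw x) = Tw x"

text \<open>
  The action of g on basis vectors. With this choice \<open>g(A B)\<close> and \<open>(g A)(g B)\<close> are the same set,
  so that the tensor structure is a diagonal matrix.
\<close>

fun g_tree :: "'a::ab_group_add tree \<Rightarrow> 'a tree" where
  "g_tree (Leaf n s) = Leaf n (g_simple s)"
| "g_tree (Node a b s) = Node (g_tree a) (g_tree b) (g_simple s)"

fun h_tree :: "Z2 \<Rightarrow> 'a::ab_group_add tree \<Rightarrow> 'a tree" where
  "h_tree Z2_1 t = t"
| "h_tree Z2_g t = g_tree t"

definition h_mat :: "Z2 \<Rightarrow> 'a::ab_group_add mat \<Rightarrow> 'a mat" where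
  "h_mat h M = (\<lambda>u s. M (h_tree h u) (h_tree h s))"

text \<open>The tensor structure on \<open>x \<otimes> y\<close> at the summand s of \<open>x \<otimes> y\<close> (not of its image under g).\<close>

fun tau_sym :: "('a::ab_group_add \<Rightarrow> 'a \<Rightarrow> 'a \<Rightarrow> complex) \<Rightarrow> 'a mod2 \<Rightarrow>
    'a simple \<Rightarrow> 'a simple \<Rightarrow> 'a simple \<Rightarrow> complex" where
  "tau_sym \<omega> \<delta> (Vec a) (Vec b) s = \<omega> a b (- b)"
| "tau_sym \<omega> \<delta> (Vec a) (Tw x) s = om_bar \<omega> (cls a + x) a (- a)"
| "tau_sym \<omega> \<delta> (Tw x) (Vec a) s = om_bar \<omega> (x + \<delta>) a (- a)"
| "tau_sym \<omega> \<delta> (Tw x) (Tw y) (Vec t) = om_bar \<omega> x t (- t)"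

definition mat_tau :: "('a::ab_group_add \<Rightarrow> 'a \<Rightarrow> 'a \<Rightarrow> complex) \<Rightarrow> 'a mod2 \<Rightarrow>
    'a tree set \<Rightarrow> 'a tree set \<Rightarrow> 'a mat" where
  "mat_tau \<omega> \<delta> A B = (\<lambda>u v.
     if u = v \<and> g_tree v \<in> tens \<delta> A B then
       (case g_tree v of Node a b s \<Rightarrow> tau_sym \<omega> \<delta> (lab a) (lab b) s | _ \<Rightarrow> 0)
     else 0)"

fun braid_sym :: "('a::ab_group_add \<Rightarrow> 'a \<Rightarrow> complex) \<Rightarrow> ('a \<Rightarrow> 'a \<Rightarrow> 'a \<Rightarrow> complex) \<Rightarrow>
    ('a \<Rightarrow> complex) \<Rightarrow> complex \<Rightarrow> 'a simple \<Rightarrow> 'a simple \<Rightarrow> 'a simple \<Rightarrow> complex" where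
  "braid_sym \<sigma> \<omega> q \<alpha> (Vec a) (Vec b) s = \<sigma> a b"
| "braid_sym \<sigma> \<omega> q \<alpha> (Vec a) (Tw x) s = inverse (q a)"
| "braid_sym \<sigma> \<omega> q \<alpha> (Tw x) (Vec a) s = inverse (q a) * om_bar \<omega> (x + cls a) a (- a)"
| "braid_sym \<sigma> \<omega> q \<alpha> (Tw x) (Tw y) (Vec t) = \<alpha> * q t"

definition mat_xbraid :: "('a::ab_group_add \<Rightarrow> 'a \<Rightarrow> complex) \<Rightarrow> ('a \<Rightarrow> 'a \<Rightarrow> 'a \<Rightarrow> complex) \<Rightarrow>
    'a mod2 \<Rightarrow> ('a \<Rightarrow> complex) \<Rightarrow> complex \<Rightarrow> 'a tree set \<Rightarrow> 'a tree set \<Rightarrow> 'a mat" where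
  "mat_xbraid \<sigma> \<omega> \<delta> q \<alpha> A B = (\<lambda>u v.
     if v \<in> tens \<delta> A B then
       (case v of
          Node a b s \<Rightarrow>
            if u = Node (h_tree (degree (lab a)) b) a s
            then braid_sym \<sigma> \<omega> q \<alpha> (lab a) (lab b) s else 0
        | _ \<Rightarrow> 0)
     else 0)"

fun twist_sym :: "('a \<Rightarrow> 'a \<Rightarrow> complex) \<Rightarrow> complex \<Rightarrow> 'a simple \<Rightarrow> complex" where
  "twist_sym \<sigma> \<beta> (Vec a) = \<sigma> a a"
| "twist_sym \<sigma> \<beta> (Tw x) = \<beta>"

definition mat_xtwist ::
  "('a::ab_group_add \<Rightarrow> 'a \<Rightarrow> complex) \<Rightarrow> complex \<Rightarrow> 'a tree set \<Rightarrow> 'a mat" where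
  "mat_xtwist \<sigma> \<beta> A = (\<lambda>u v.
     if v \<in> A \<and> u = h_tree (degree (lab v)) v then twist_sym \<sigma> \<beta> (lab v) else 0)"

definition part_obj :: "Z2 \<Rightarrow> 'a tree set \<Rightarrow> 'a tree set" where
  "part_obj h A = {t \<in> A. degree (lab t) = h}"

definition crossed_category :: "('a::{finite, ab_group_add} \<Rightarrow> 'a \<Rightarrow> complex) \<Rightarrow>
    ('a \<Rightarrow> 'a \<Rightarrow> 'a \<Rightarrow> complex) \<Rightarrow> 'a mod2 \<Rightarrow> complex \<Rightarrow> ('a \<Rightarrow> complex) \<Rightarrow>
    complex \<Rightarrow> complex \<Rightarrow> ('a tree set, 'a mat) crossed_cat" where
  "crossed_category \<sigma> \<omega> \<delta> \<epsilon> q \<alpha> \<beta> = \<lparr>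
     Obj = {A. finite A},
     Hom = mat_hom,
     idm = mat_id,
     comp = mat_mult,
     zero = (\<lambda>u s. 0),
     add = (\<lambda>M N u s. M u s + N u s),
     smult = (\<lambda>k M u s. k * M u s),
     tobj = tens \<delta>,
     tmor = mat_tens \<delta>,
     unit = unit_obj,
     assoc = mat_assoc \<sigma> \<omega> \<delta> \<epsilon>,
     lunit = mat_lunit,
     runit = mat_runit,
     part = part_obj,
     part_in = (\<lambda>h A. mat_id (part_obj h A)),
     part_pr = (\<lambda>h A. mat_id (part_obj h A)),
     act_obj = (\<lambda>h A. h_tree h ` A),
     act_mor = h_mat,
     act_tens = mat_tau \<omega> \<delta>,
     xbraid = mat_xbraid \<sigma> \<omega> \<delta> q \<alpha>,
     xtwist = mat_xtwist \<sigma> \<beta> \<rparr>"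

end

theory Submission
  imports Defs
begin

text \<open>
  An equivariant object amounts to a finite set of labelled basis vectors with an involutive matrix
  commuting with the labels up to g, and morphisms are matrices commuting with these involutions.
  As the fusion rules are multiplicity free, every axiom of a ribbon fusion category then reduces
  to an identity between the symbols F, R and \<open>\<tau>\<close> attached to labels. These follow from the cocycle
  rules for \<open>\<sigma>\<close>, \<open>\<omega>\<close> and q; when three twisted labels are involved, they also use
  character orthogonality or completing the square in the Gauss sum.
  Semisimplicity is obtained by splitting off simple summands of idempotents.

  The braiding is non-degenerate because a transparent object is tested against three
  kinds of objects: the unit with g acting by -1 excludes twisted labels, the object
  \<open>\<C>\<^sub>b \<oplus> \<C>\<^sub>-\<^sub>b\<close> excludes labels other than 0 as \<open>B\<^sub>Q\<close> is
  non-degenerate, and an object with twisted label forces the action of g to be trivial.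
\<close>

section \<open>Coherence of the associator, braiding and twist symbols\<close>

text \<open>The constants are dictated by the all-twisted cases. Re-bracketing leaves at most one
  admissible intermediate label unless all three factors are twisted; there the associator is a
  finite Fourier matrix between two classes modulo doubles, and |2\<Gamma>|^(-1/2) normalises it so
  that inverting \<open>\<sigma>\<close> in its entries gives the entries of the inverse. In the
  hexagon for three twisted labels, completing the square turns the sum into
  \<open>gauss_sum\<close>, which is why \<alpha> squared has to be \<epsilon> times that sum. The
  twist on a product of two twisted objects then asks that \<beta> squared be inverse to \<alpha>
  squared.

  Two obstacles shape the matrix part. Matrices are functions on an infinite type of trees, so
  products are only well behaved under a finiteness condition on columns. And every structure
  morphism must be natural and also equivariant. For unitors, braiding and twist both come from one
  statement about matrices that shift labels by h: h = 1 gives naturality, and h = g, applied to the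
  matrices by which g acts, gives equivariance.\<close>

lemma mod2_add_self [simp]: "(x::'a::ab_group_add mod2) + x = 0"
proof transfer
  fix x :: 'a
  show "\<exists>z. x + x - 0 = z + z"
    by (rule exI[of _ x]) simp
qed

lemma mod2_add_self_left [simp]: "(x::'a::ab_group_add mod2) + (x + y) = y"
  by (metis add.assoc add_0 mod2_add_self)

lemma mod2_uminus [simp]: "- (x::'a::ab_group_add mod2) = x"
  by (metis add.inverse_unique mod2_add_self)

lemma cls_add: "cls (a + b) = cls a + cls b"
  by (simp add: plus_mod2.abs_eq)

lemma cls_uminus: "cls (- a) = cls a"
  by (metis mod2_uminus uminus_mod2.abs_eq)

lemma cls_zero: "cls 0 = 0"
  by (simp add: zero_mod2_def)

lemma cls_diff: "cls (a - b) = cls a + cls b"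
  by (metis add_uminus_conv_diff cls_add cls_uminus)

lemma cls_eq_iff: "cls a = cls b \<longleftrightarrow> (\<exists>z. a = b + (z + z))"
  by (metis add_diff_cancel_left' diff_add_cancel mod2.abs_eq_iff add.commute)

lemma cls_rep: "cls (rep_mod2 x) = x"
  by (rule Quotient3_abs_rep[OF Quotient3_mod2])

lemma cls_surj: obtains a where "x = cls a"
  by (metis cls_rep)

instance mod2 :: ("{finite, ab_group_add}") finite
proof
  have "(UNIV::'a mod2 set) = range cls"
    by (metis cls_rep surj_def)
  then show "finite (UNIV::'a mod2 set)"
    by (metis finite finite_imageI)
qed

lemma UNIV_label: "(UNIV::('a, 'x) label set) = range Vec \<union> range Tw"
proof -
  have "x \<in> range Vec \<union> range Tw" for x :: "('a, 'x) label"
    by (cases x) auto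
  then show ?thesis
    by blast
qed

instance label :: (finite, finite) finite
  by intro_classes (simp add: UNIV_label)

text \<open>Used whenever fusion leaves a single admissible intermediate label in a sum over all
  labels.\<close>

lemma sum_unique:
  fixes f :: "'b::finite \<Rightarrow> 'c::comm_monoid_add"
  assumes "\<And>x. x \<noteq> x0 \<Longrightarrow> f x = 0"
  shows "sum f UNIV = f x0"
  using assms sum.mono_neutral_right[of UNIV "{x0}" f] by auto

definition h_simple :: "Z2 \<Rightarrow> 'a::ab_group_add simple \<Rightarrow> 'a simple" where
  "h_simple h l = (case h of Z2_1 \<Rightarrow> l | Z2_g \<Rightarrow> g_simple l)"

lemma h_simple_simps [simp]: "h_simple Z2_1 l = l" "h_simple Z2_g l = g_simple l"
  by (simp_all add: h_simple_def)

lemma g_simple_g_simple [simp]: "g_simple (g_simple l) = l"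
  by (cases l) auto

lemma degree_g_simple [simp]: "degree (g_simple l) = degree l"
  by (cases l) auto

lemma degree_h_simple [simp]: "degree (h_simple h l) = degree l"
  by (cases h) auto

lemma g_simple_fus [simp]: "g_simple s \<in> fus \<delta> (g_simple a) (g_simple b) \<longleftrightarrow> s \<in> fus \<delta> a b"
proof -
  have "- z = - x - y \<longleftrightarrow> z = x + y" for x y z :: 'a
    using neg_equal_iff_equal[of z "x + y"] by simp
  then show ?thesis
    by (cases a; cases b; cases s) (auto simp: cls_uminus)
qed

text \<open>The crossed braiding from A B to (h B) A keeps the summand. This is possible because b
  and -b have the same class modulo doubles and g fixes twisted labels.\<close>

lemma fus_h_simple: "fus \<delta> (h_simple (degree a) b) a = fus \<delta> a b"
  by (cases a; cases b) (auto simp: add_ac cls_uminus)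

context crossed_data
begin

abbreviation W where "W \<equiv> om_bar \<omega>"

section \<open>Cocycle rules for \<sigma> and \<omega>\<close>

lemma \<omega>_square: "\<omega> a b c * \<omega> a b c = 1"
  using \<omega>_sign[of a b c] by auto

lemma \<omega>_zero1: "\<omega> 0 b c = 1"
  by (metis \<omega>_hom \<omega>_square add_0 mult_cancel_right2 zero_neq_one mult_zero_left)

text \<open>Two representatives of a class differ by a double z + z, and a homomorphism to signs
  kills doubles.\<close>

lemma \<omega>_cls: "\<omega> a b c = W (cls a) b c"
proof -
  have "cls a = cls (rep_mod2 (cls a))"
    by (simp add: cls_rep)
  then obtain z where "a = rep_mod2 (cls a) + (z + z)"
    using cls_eq_iff by blast
  then have "\<omega> a b c = \<omega> (rep_mod2 (cls a)) b c * (\<omega> z b c * \<omega> z b c)"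
    by (metis \<omega>_hom)
  then show ?thesis
    by (simp add: \<omega>_square om_bar_def)
qed

lemma W_add: "W (x + y) b c = W x b c * W y b c"
  by (metis \<omega>_cls \<omega>_hom cls_add cls_surj)

lemma W_square: "W x b c * W x b c = 1"
  by (simp add: om_bar_def \<omega>_square)

lemma W_square_left: "W x b c * (W x b c * z) = z"
  by (metis W_square mult.assoc mult_1)

lemma W_nonzero: "W x b c \<noteq> 0"
  by (metis W_square mult_zero_left zero_neq_one)

lemma inverse_W: "inverse (W x b c) = W x b c"
  by (metis W_square inverse_unique)

lemma W_0: "W 0 b c = 1"
  by (metis \<omega>_cls \<omega>_zero1 cls_zero)

lemma W_0_mid: "W x 0 c = 1"
  by (simp add: om_bar_def \<omega>_\<sigma> \<sigma>_zero \<sigma>_nonzero)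

lemma W_0_right: "W x b 0 = 1"
  by (simp add: om_bar_def \<omega>_\<sigma> \<sigma>_zero \<sigma>_nonzero)

lemma W_sym: "W x b c = W x c b"
  by (simp add: om_bar_def \<omega>_\<sigma> add.commute mult.commute)

text \<open>For fixed x the sign \<open>W x\<close> is the coboundary of \<sigma>(x, -), hence a
  2-cocycle; since it squares to 1, every factor may be moved to the other side unchanged.\<close>

lemma W_cocycle: "W x b (c + d) = W x b c * W x (b + c) d * W x c d"
proof -
  have "W x b (c + d) * W x c d = W x b c * W x (b + c) d"
    by (simp add: om_bar_def \<omega>_\<sigma> \<sigma>_nonzero field_simps)
  then show ?thesis
    by (metis W_square mult.assoc mult.right_neutral)
qed

lemma \<sigma>_add: "\<sigma> a (b + c) = \<sigma> a b * \<sigma> a c * W (cls a) b c"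
proof -
  have "W (cls a) b c = \<sigma> a (b + c) / (\<sigma> a b * \<sigma> a c)"
    by (simp add: \<omega>_cls[symmetric] \<omega>_\<sigma> divide_inverse)
  then show ?thesis
    using \<sigma>_nonzero[of a b] \<sigma>_nonzero[of a c] by simp
qed

lemma \<sigma>_add_left: "\<sigma> (b + c) a = \<sigma> b a * \<sigma> c a * W (cls a) b c"
  using \<sigma>_add[of a b c] by (simp only: \<sigma>_sym[of a])

lemma \<sigma>_uminus: "\<sigma> a (- b) = inverse (\<sigma> a b) * W (cls a) b (- b)"
proof -
  have "\<sigma> a b * (\<sigma> a (- b) * W (cls a) b (- b)) = \<sigma> a (b + - b)"
    by (simp only: \<sigma>_add mult.assoc)
  then have "\<sigma> a b * (\<sigma> a (- b) * W (cls a) b (- b)) = 1"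
    by (simp add: \<sigma>_zero)
  then have "inverse (\<sigma> a b) = \<sigma> a (- b) * W (cls a) b (- b)"
    by (metis inverse_unique)
  then show ?thesis
    by (simp add: mult.assoc W_square)
qed

lemma \<sigma>_uminus_left: "\<sigma> (- b) a = inverse (\<sigma> b a) * W (cls a) b (- b)"
  using \<sigma>_uminus[of a b] by (simp only: \<sigma>_sym[of a])

lemmas W_simps = W_add W_square W_square_left inverse_W W_0 W_0_mid W_0_right cls_add cls_uminus
  cls_zero cls_diff \<omega>_cls

text \<open>The associator symbol, extended by 0 to inadmissible labels so that sums may run over
  the whole finite type of labels.\<close>

definition F where
  "F a b c e f d = (if e \<in> fus \<delta> a b \<and> d \<in> fus \<delta> e c \<and> f \<in> fus \<delta> b c \<and> d \<in> fus \<delta> a f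
     then assoc_sym \<sigma> \<omega> \<delta> \<epsilon> a b c e f d else 0)"

text \<open>The symbol of the inverse associator. The factors \<epsilon> and \<omega> are their own
  inverses, so only \<sigma> has to be inverted; in the all-twisted block this is the usual passage
  from a Fourier matrix to its inverse.\<close>

definition Fi where
  "Fi a b c e f d = (if e \<in> fus \<delta> a b \<and> d \<in> fus \<delta> e c \<and> f \<in> fus \<delta> b c \<and> d \<in> fus \<delta> a f
     then assoc_sym (\<lambda>a b. inverse (\<sigma> a b)) \<omega> \<delta> \<epsilon> a b c e f d else 0)"

abbreviation R where "R \<equiv> braid_sym \<sigma> \<omega> q \<alpha>"
abbreviation \<tau> where "\<tau> \<equiv> tau_sym \<omega> \<delta>"

definition \<tau>h where "\<tau>h h a b s = (case h of Z2_1 \<Rightarrow> 1 | Z2_g \<Rightarrow> \<tau> a b s)"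

section \<open>Symbol identities with a single intermediate label\<close>

lemma W_neg_self: "W x (- b) b = W x b (- b)"
  by (rule W_sym)

text \<open>Obtained by expanding \<sigma>(x, -(b + c)) in two ways: as a sum of two negatives, and
  as the negative of a sum.\<close>

lemma W_neg_neg: "W x (- b) (- c) = W x b c * W x b (- b) * W x c (- c) * W x (b + c) (- b - c)"
proof -
  have "W x (- b) (- c) * \<sigma> (rep_mod2 x) (- b) * \<sigma> (rep_mod2 x) (- c) = \<sigma> (rep_mod2 x) (- (b + c))"
    using \<sigma>_add[of "rep_mod2 x" "- b" "- c"] by (simp add: cls_rep mult_ac)
  then have "W x (- b) (- c) * (inverse (\<sigma> (rep_mod2 x) b) * W x b (- b))
      * (inverse (\<sigma> (rep_mod2 x) c) * W x c (- c))
      = inverse (\<sigma> (rep_mod2 x) b * \<sigma> (rep_mod2 x) c * W x b c) * W x (b + c) (- (b + c))"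
    by (simp only: \<sigma>_uminus cls_rep \<sigma>_add)
  then have "inverse (\<sigma> (rep_mod2 x) b * \<sigma> (rep_mod2 x) c) * (W x (- b) (- c) * W x b (- b) * W x c (- c))
      = inverse (\<sigma> (rep_mod2 x) b * \<sigma> (rep_mod2 x) c) * (W x b c * W x (b + c) (- (b + c)))"
    by (simp only: inverse_mult_distrib inverse_W mult_ac)
  then have "W x (- b) (- c) * W x b (- b) * W x c (- c) = W x b c * W x (b + c) (- b - c)"
    by (simp add: \<sigma>_nonzero)
  then have "W x (- b) (- c) * W x b (- b) * W x c (- c) * (W x b (- b) * W x c (- c)) =
      W x b c * W x (b + c) (- b - c) * (W x b (- b) * W x c (- c))"
    by (rule arg_cong)
  then show ?thesis
    by (simp add: W_square W_square_left mult_ac)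
qed

lemma \<sigma>_neg_neg: "\<sigma> (- a) (- b) = \<sigma> a b * W (cls b) a (- a) * W (cls a) b (- b)"
  by (simp add: \<sigma>_uminus \<sigma>_uminus_left inverse_W cls_uminus mult_ac)

lemma \<tau>_square:
  assumes "s \<in> fus \<delta> a b"
  shows "\<tau> (g_simple a) (g_simple b) (g_simple s) * \<tau> a b s = 1"
  using assms 
  by (cases a; cases b) (auto simp: W_simps mult_ac W_neg_self)

lemmas sgn_simps = W_simps W_nonzero W_neg_self W_neg_neg \<sigma>_neg_neg \<sigma>_nonzero

text \<open>The tensor structure of g is compatible with the associator. This is the symbol form of
  the equivariance of the associator.\<close>

lemma F_g:
  assumes "e \<in> fus \<delta> a b" "k \<in> fus \<delta> e c" "f \<in> fus \<delta> b c" "k \<in> fus \<delta> a f"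
  shows "\<tau> a b e * \<tau> e c k * F (g_simple a) (g_simple b) (g_simple c) (g_simple e) (g_simple f) (g_simple k) =
         F a b c e f k * \<tau> a f k * \<tau> b c f"
proof -
  have adm: "F (g_simple a) (g_simple b) (g_simple c) (g_simple e) (g_simple f) (g_simple k) =
       assoc_sym \<sigma> \<omega> \<delta> \<epsilon> (g_simple a) (g_simple b) (g_simple c) (g_simple e) (g_simple f) (g_simple k)"
    "F a b c e f k = assoc_sym \<sigma> \<omega> \<delta> \<epsilon> a b c e f k"
    using assms by (simp_all add: F_def)
  show ?thesis
    unfolding adm using assms
    apply (cases a; cases b; cases c; simp add: cls_add cls_uminus add_ac; (elim exE conjE)?; simp add: cls_add cls_uminus add_ac)
    apply (simp_all add: sgn_simps mult_ac add_ac)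
    apply (simp add: minus_diff_commute)
    done
qed

text \<open>The cocycle identity solved for its other composite factor, so that chosen instances can
  be used as rewrite rules.\<close>

lemma W_cocycle3: "W x w (u + v) = W x u v * W x v w * W x u (v + w)"
  using W_cocycle[of x u v w]
  by (simp add: W_sym[of x w] W_square W_square_left mult_ac)

text \<open>The pentagon in the cases where x is the only admissible label on its longer side. With
  four twisted labels x ranges over a whole class, which needs a character sum; that case is left to
  \<open>pentagon_sym\<close>.\<close>

lemma pentagon1:
  assumes "e \<in> fus \<delta> a b" "f \<in> fus \<delta> e c" "k \<in> fus \<delta> f d"
    "p \<in> fus \<delta> c d" "r \<in> fus \<delta> b p" "k \<in> fus \<delta> a r"
    and "x \<in> fus \<delta> b c" "f \<in> fus \<delta> a x" "r \<in> fus \<delta> x d"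
    and "\<not> (degree a = Z2_g \<and> degree b = Z2_g \<and> degree c = Z2_g \<and> degree d = Z2_g)"
  shows "F e c d f p k * F a b p e r k = F a b c e x f * F a x d f r k * F b c d x p r"
proof -
  let ?A = "assoc_sym \<sigma> \<omega> \<delta> \<epsilon>"
  have "?A e c d f p k * ?A a b p e r k = ?A a b c e x f * ?A a x d f r k * ?A b c d x p r"
    using assms
  apply (cases a; cases b; cases c; cases d; simp add: cls_add cls_uminus add_ac; (elim exE conjE)?;
        simp add: cls_add cls_uminus add_ac)
    apply (simp_all add: sgn_simps \<sigma>_add \<sigma>_add_left mult_ac add_ac W_sym \<sigma>_sym)
\<comment> \<open>Each remaining case is an identity between products of signs \<open>W\<close>. It
  follows from one or two instances of the cocycle identity, which are chosen by hand.\<close>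
subgoal for u v w z by (simp add: W_cocycle3[of _ z v w] W_cocycle3[of _ w v z] W_square W_square_left mult_ac W_sym add_ac W_nonzero)
prefer 3
subgoal for u x y w t ta v by (simp add: W_cocycle3[of _ v u w] W_cocycle3[of _ w u v] W_square W_square_left mult_ac W_sym add_ac W_nonzero)
prefer 3
subgoal for x u v w by (simp add: W_cocycle3[of _ w u v] W_cocycle3[of _ v u w] W_square W_square_left mult_ac W_sym add_ac W_nonzero)
prefer 3
subgoal for x y u v w by (simp add: W_cocycle3[of _ w u v] W_cocycle3[of _ v u w] W_square W_square_left mult_ac W_sym add_ac W_nonzero)
subgoal for u v w z by (simp add: W_cocycle3[of _ w u v] W_square W_square_left mult_ac W_sym add_ac W_nonzero)
subgoal for u v x y t w r by (simp add: W_cocycle3[of _ w u v] W_square W_square_left mult_ac W_sym add_ac W_nonzero)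
done
  moreover have "k \<in> fus \<delta> e p"
    using assms by (cases a; cases b; cases c; cases d; auto simp: cls_add add_ac)
  ultimately show ?thesis
    using assms by (simp add: F_def)
qed

lemma h_simple_fus [simp]: "h_simple h s \<in> fus \<delta> (h_simple h a) (h_simple h b) \<longleftrightarrow> s \<in> fus \<delta> a b"
  by (cases h) auto

lemma q_add: "q (a + b) = q a * q b * \<sigma> a b * W (cls a + cls b + \<delta>) a b"
proof -
  have "q (a + b) / (q a * q b) = \<sigma> a b * W (cls a + cls b + \<delta>) a b"
    using q_\<sigma>[of a b] by (simp add: W_add \<omega>_cls cls_add divide_inverse mult_ac)
  then show ?thesis
    using q_nonzero[of a] q_nonzero[of b] by (simp add: field_simps)
qed

lemma q_0: "q 0 = 1"
  using q_add[of 0 0] q_nonzero[of 0] by (simp add: \<sigma>_zero W_0_mid)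

lemma \<sigma>_self: "\<sigma> a a = q a * q a"
  by (simp add: \<sigma>_diag q_square[symmetric] power2_eq_square)

text \<open>q is even only up to a sign. The sign is found by expanding 1 = q (a + - a) and using
  that \<sigma> a a is the square of q a.\<close>

lemma q_uminus: "q (- a) = q a * W (cls a + \<delta>) a (- a)"
proof -
  have "1 = q (a + - a)"
    by (simp add: q_0)
  also have "\<dots> = q a * q (- a) * (inverse (q a * q a) * W (cls a) a (- a)) * W \<delta> a (- a)"
    unfolding q_add by (simp add: cls_uminus \<sigma>_uminus \<sigma>_self)
  also have "\<dots> = q (- a) * (inverse (q a) * W (cls a + \<delta>) a (- a))"
    using q_nonzero[of a] by (simp add: W_add field_simps)
  finally have "q (- a) = inverse (inverse (q a) * W (cls a + \<delta>) a (- a))"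
    by (metis inverse_unique mult.commute)
  then show ?thesis
    by (simp add: inverse_W)
qed

text \<open>The factor \<open>\<tau>h\<close> enters because moving a past the product of b and d
  first yields h applied to the whole product, which the tensor structure then splits into h b and h
  d.\<close>

lemma hex1_1:
  assumes "e \<in> fus \<delta> a b" "k \<in> fus \<delta> e d" "f \<in> fus \<delta> b d" "k \<in> fus \<delta> a f"
    "p \<in> fus \<delta> (h_simple (degree a) d) a" "k \<in> fus \<delta> (h_simple (degree a) b) p"
    and "\<not> (degree a = Z2_g \<and> degree b = Z2_g \<and> degree d = Z2_g)"
  shows "F a b d e f k * R a f k * \<tau>h (degree a) b d f *
      F (h_simple (degree a) b) (h_simple (degree a) d) a (h_simple (degree a) f) p k
    = R a b e * F (h_simple (degree a) b) a d e p k * R a d p"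
proof -
  let ?A = "assoc_sym \<sigma> \<omega> \<delta> \<epsilon>"
  have "?A a b d e f k * R a f k * \<tau>h (degree a) b d f *
      ?A (h_simple (degree a) b) (h_simple (degree a) d) a (h_simple (degree a) f) p k
    = R a b e * ?A (h_simple (degree a) b) a d e p k * R a d p"
    using assms
    apply (cases a; cases b; cases d; simp add: cls_add cls_uminus add_ac \<tau>h_def; (elim exE conjE)?;
        simp add: cls_add cls_uminus add_ac)
    apply (simp_all add: sgn_simps \<sigma>_add \<sigma>_add_left mult_ac add_ac W_sym \<sigma>_sym)
    apply (simp_all add: \<sigma>_uminus \<sigma>_self q_add q_uminus \<sigma>_add \<sigma>_add_left sgn_simps mult_ac add_ac W_sym 
       diff_conv_add_uminus del: add_uminus_conv_diff)
    apply (simp_all add: field_simps q_nonzero \<sigma>_nonzero \<sigma>_sym)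
    done
  then show ?thesis
    using assms by (simp add: F_def fus_h_simple)
qed

lemma h_simple_mult:
  "e \<in> fus \<delta> a b \<Longrightarrow> h_simple (degree a) (h_simple (degree b) d) = h_simple (degree e) d"
  by (cases a; cases b) auto

text \<open>No tensor structure occurs here: moving d past b and then past a applies two actions in
  succession, and these compose strictly.\<close>

lemma hex2_1:
  assumes "f \<in> fus \<delta> b d" "k \<in> fus \<delta> a f" "e \<in> fus \<delta> a b" "k \<in> fus \<delta> e d"
    "p \<in> fus \<delta> (h_simple (degree a) (h_simple (degree b) d)) a" "k \<in> fus \<delta> p b"
    and "\<not> (degree a = Z2_g \<and> degree b = Z2_g \<and> degree d = Z2_g)"
  shows "Fi a b d e f k * R e d k * Fi (h_simple (degree a) (h_simple (degree b) d)) a b p e k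
    = R b d f * Fi a (h_simple (degree b) d) b p f k * R a (h_simple (degree b) d) p"
proof -
  let ?A = "assoc_sym (\<lambda>a b. inverse (\<sigma> a b)) \<omega> \<delta> \<epsilon>"
  have "?A a b d e f k * R e d k * ?A (h_simple (degree a) (h_simple (degree b) d)) a b p e k
    = R b d f * ?A a (h_simple (degree b) d) b p f k * R a (h_simple (degree b) d) p"
    using assms
    apply (cases a; cases b; cases d; simp add: cls_add cls_uminus cls_diff add_ac; (elim exE conjE)?;
        simp add: cls_add cls_uminus cls_diff add_ac)
    apply (simp_all add: \<sigma>_uminus \<sigma>_self q_add q_uminus \<sigma>_add \<sigma>_add_left sgn_simps mult_ac add_ac W_sym 
       diff_conv_add_uminus del: add_uminus_conv_diff)
    apply (simp_all add: \<sigma>_uminus_left W_neg_self inverse_W cls_uminus)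
    apply (simp_all add: field_simps q_nonzero \<sigma>_nonzero \<sigma>_sym \<sigma>_self W_square W_square_left)
    apply (simp add: W_simps mult_ac)
    done
  then show ?thesis
    using assms fus_h_simple[of \<delta> b d] fus_h_simple[of \<delta> a "h_simple (degree b) d"]
      fus_h_simple[of \<delta> e d] h_simple_mult[of e a b d]
    by (simp add: Fi_def)
qed

text \<open>The braiding is compatible with g, which makes it equivariant. For a Vec label and a
  twisted label, the sign by which q fails to be even is exactly the ratio of the two tensor
  structure signs.\<close>

lemma R_g:
  assumes "s \<in> fus \<delta> a b"
  shows "\<tau> (g_simple a) (g_simple b) (g_simple s) * R a b s =
    R (g_simple a) (g_simple b) (g_simple s) * \<tau> (h_simple (degree a) (g_simple b)) (g_simple a) (g_simple s)"
  using assms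
  by (cases a; cases b)
    (auto simp add: sgn_simps \<sigma>_add \<sigma>_add_left mult_ac add_ac W_sym \<sigma>_sym q_uminus)

text \<open>A product with a twisted label on exactly one side has one summand, so the other
  bracketing determines f. Only a Vec label times two twisted ones leaves f in a class, and there
  the value of k pins it down.\<close>

lemma fus_right:
  assumes "\<not> (degree a = Z2_g \<and> degree b = Z2_g \<and> degree c = Z2_g)"
    "e \<in> fus \<delta> a b" "k \<in> fus \<delta> e c"
  obtains f where "f \<in> fus \<delta> b c" "k \<in> fus \<delta> a f" 
    "\<And>f'. f' \<in> fus \<delta> b c \<Longrightarrow> k \<in> fus \<delta> a f' \<Longrightarrow> f' = f"
proof -
  have "\<exists>f. f \<in> fus \<delta> b c \<and> k \<in> fus \<delta> a f \<and> (\<forall>f'. f' \<in> fus \<delta> b c \<longrightarrow> k \<in> fus \<delta> a f' \<longrightarrow> f' = f)"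
    using assms
    apply (cases a; cases b; cases c; simp add: cls_add cls_uminus add_ac; (elim exE conjE)?;
        simp add: cls_add cls_uminus add_ac)
    apply (rename_tac x y z t)
    \<comment> \<open>The remaining case has a = \<open>Vec x\<close>, b and c twisted and k =
      \<open>Vec t\<close>, so f must solve x + f = t.\<close>
    apply (rule_tac x="Vec (t - x)" in exI)
    apply (auto simp: cls_diff add_ac)
    done
  then show thesis using that by blast
qed

lemma fus_left:
  assumes "\<not> (degree a = Z2_g \<and> degree b = Z2_g \<and> degree c = Z2_g)"
    "f \<in> fus \<delta> b c" "k \<in> fus \<delta> a f"
  obtains e where "e \<in> fus \<delta> a b" "k \<in> fus \<delta> e c" 
    "\<And>e'. e' \<in> fus \<delta> a b \<Longrightarrow> k \<in> fus \<delta> e' c \<Longrightarrow> e' = e"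
proof -
  have "\<exists>e. e \<in> fus \<delta> a b \<and> k \<in> fus \<delta> e c \<and> (\<forall>e'. e' \<in> fus \<delta> a b \<longrightarrow> k \<in> fus \<delta> e' c \<longrightarrow> e' = e)"
    using assms
    apply (cases a; cases b; cases c; simp add: cls_add cls_uminus add_ac; (elim exE conjE)?;
        simp add: cls_add cls_uminus add_ac)
    apply (rename_tac y z x t)
    apply (rule_tac x="Vec (t - x)" in exI)
    apply (auto simp: cls_diff add_ac)
    done
  then show thesis using that by blast
qed

section \<open>Class sizes, character sums and the Gauss sum\<close>

lemma card_class: "card {x::'a. cls x = y} = card (range (\<lambda>a::'a. a + a))"
proof -
  obtain x0 where y: "y = cls x0"
    by (rule cls_surj)
  have "{x. cls x = y} = (+) x0 ` range (\<lambda>a::'a. a + a)"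
    by (auto simp: y cls_eq_iff)
  then show ?thesis
    by (simp add: card_image)
qed

lemma inv_sqrt_double_square: "inv_sqrt_double TYPE('a) * inv_sqrt_double TYPE('a) * of_nat (card {x::'a. cls x = y}) = 1"
proof -
  have *: "complex_of_real (1 / sqrt (real n)) * complex_of_real (1 / sqrt (real n)) * of_nat n = 1"
    if "n > 0" for n
  proof -
    have "1 / sqrt (real n) * (1 / sqrt (real n)) * real n = 1"
      using that by simp
    then have "complex_of_real (1 / sqrt (real n) * (1 / sqrt (real n)) * real n) = 1"
      by (simp only: of_real_1)
    then show ?thesis
      by (simp only: of_real_mult of_real_of_nat_eq)
  qed
  have "card (range (\<lambda>a::'a. a + a)) > 0"
    by (simp add: card_gt_0_iff)
  then show ?thesis
    unfolding card_class inv_sqrt_double_def by (rule *)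
qed

lemma inv_sqrt_double_nonzero: "inv_sqrt_double TYPE('a) \<noteq> 0"
  using inv_sqrt_double_square[of 0] by auto

lemma \<epsilon>_square: "\<epsilon> * \<epsilon> = 1"
  using \<epsilon>_sign by auto

lemma sum_class_shift: "(\<Sum>x\<in>{x::'a. cls x = y}. f (x + z)) = (\<Sum>x\<in>{x. cls x = y + cls z}. f x)"
  by (rule sum.reindex_bij_witness[of _ "\<lambda>x. x - z" "\<lambda>x. x + z"]) (auto simp: cls_add cls_diff)

lemma bilin_\<sigma>: "bilin Q a b = \<sigma> a b * \<sigma> a b"
proof -
  have "Q x = q x * q x" for x
    by (simp add: \<sigma>_diag[symmetric] \<sigma>_self)
  then show ?thesis
    using q_nonzero[of a] q_nonzero[of b]
    by (simp add: bilin_def q_add field_simps W_square W_square_left)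
qed

text \<open>Orthogonality of characters on a class modulo doubles. Shifting x by u + u permutes the
  class and multiplies the summand by the bicharacter at u and k - e - p. If k differs from e + p,
  non-degeneracy provides a u for which this factor is not 1, so the sum is 0; otherwise the summand
  is a constant sign.\<close>

lemma sum_character:
  assumes k: "cls k = cls e + cls p"
  shows "(\<Sum>x\<in>{x. cls x = y}. \<sigma> x k * inverse (\<sigma> x e) * inverse (\<sigma> x p)) =
    (if k = e + p then of_nat (card {x::'a. cls x = y}) * W y e p else 0)"
proof (cases "k = e + p")
  case True
  have "(\<Sum>x\<in>{x. cls x = y}. \<sigma> x k * inverse (\<sigma> x e) * inverse (\<sigma> x p)) = (\<Sum>x\<in>{x::'a. cls x = y}. W y e p)"
    using \<sigma>_nonzero by (intro sum.cong refl) (simp add: True \<sigma>_add field_simps)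
  then show ?thesis
    by (simp add: True)
next
  case False
  define \<chi> where "\<chi> x = \<sigma> x k * inverse (\<sigma> x e) * inverse (\<sigma> x p)" for x
  have "k - e - p \<noteq> 0"
    using False by (simp add: algebra_simps)
  then obtain u where "bilin Q (k - e - p) u \<noteq> 1"
    using B_nondegenerate by blast
  then have u: "bilin Q u (k - e - p) \<noteq> 1"
    by (simp add: bilin_def add.commute mult_ac)
  have "bilin Q u ((k - e - p) + (e + p)) = bilin Q u (k - e - p) * (bilin Q u e * bilin Q u p)"
    by (simp only: B_mult_right)
  then have "bilin Q u k = bilin Q u (k - e - p) * (bilin Q u e * bilin Q u p)"
    by simp
  then have \<chi>u: "\<chi> u * \<chi> u = bilin Q u (k - e - p)"
    using \<sigma>_nonzero[of u e] \<sigma>_nonzero[of u p] by (simp add: \<chi>_def bilin_\<sigma> field_simps)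
  \<comment> \<open>The signs from the additivity defects of \<sigma> at k, e and p cancel because
    the class of k is the sum of the other two.\<close>
  have shift: "\<chi> (x + (u + u)) = \<chi> x * (\<chi> u * \<chi> u)" for x
    by (simp add: \<chi>_def \<sigma>_add_left W_simps k mult_ac)
  have "sum \<chi> {x. cls x = y} = (\<Sum>x\<in>{x. cls x = y}. \<chi> (x + (u + u)))"
    by (simp add: sum_class_shift cls_add)
  also have "\<dots> = sum \<chi> {x. cls x = y} * (\<chi> u * \<chi> u)"
    by (simp add: shift sum_distrib_right)
  finally have "sum \<chi> {x. cls x = y} = 0"
    using u \<chi>u by simp
  then show ?thesis
    by (simp add: False \<chi>_def)
qed

text \<open>The sum of the inverses of q is multiplied by the sum of q over the same class, in place
  of a complex conjugate. Writing b = a + d with d a double, the sum over a becomes a character sum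
  that leaves only d = 0, so the product is the size of the class.\<close>

lemma gauss_sum_nonzero: "gauss_sum \<delta> (\<lambda>a. inverse (q a)) \<noteq> 0"
proof -
  \<comment> \<open>On the class \<delta> the sign in \<open>q_add\<close> is trivial. The factors
    \<sigma> a 0 are 1; they give the summand the shape of \<open>sum_character\<close> with e = p =
    0.\<close>
  have q_shift: "inverse (q a) * q (a + d) = q d * (\<sigma> a d * inverse (\<sigma> a 0) * inverse (\<sigma> a 0))"
    if "cls a = \<delta>" "cls d = 0" for a d
    using that q_nonzero[of a] by (simp add: q_add W_0 \<sigma>_zero)
  have "(\<Sum>a\<in>{a. cls a = \<delta>}. inverse (q a)) * (\<Sum>b\<in>{b. cls b = \<delta>}. q b)
      = (\<Sum>a\<in>{a. cls a = \<delta>}. \<Sum>b\<in>{b. cls b = \<delta>}. inverse (q a) * q b)"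
    by (simp add: sum_product)
  also have "\<dots> = (\<Sum>a\<in>{a. cls a = \<delta>}. \<Sum>d\<in>{d. cls d = 0}. inverse (q a) * q (a + d))"
  proof (rule sum.cong[OF refl])
    fix a assume "a \<in> {a. cls a = \<delta>}"
    then show "(\<Sum>b\<in>{b. cls b = \<delta>}. inverse (q a) * q b) = (\<Sum>d\<in>{d. cls d = 0}. inverse (q a) * q (a + d))"
      using sum_class_shift[of "\<lambda>b. inverse (q a) * q b" a 0] by (simp add: add.commute)
  qed
  also have "\<dots> = (\<Sum>a\<in>{a. cls a = \<delta>}. \<Sum>d\<in>{d. cls d = 0}. q d * (\<sigma> a d * inverse (\<sigma> a 0) * inverse (\<sigma> a 0)))"
    by (intro sum.cong refl) (simp add: q_shift)
  also have "\<dots> = (\<Sum>d\<in>{d. cls d = 0}. q d * (\<Sum>a\<in>{a. cls a = \<delta>}. \<sigma> a d * inverse (\<sigma> a 0) * inverse (\<sigma> a 0)))"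
    by (subst sum.swap) (simp add: sum_distrib_left)
  also have "\<dots> = (\<Sum>d\<in>{d. cls d = 0}. q d * (if d = 0 then of_nat (card {x::'a. cls x = \<delta>}) else 0))"
    by (intro sum.cong refl) (simp add: sum_character cls_zero W_0_mid)
  also have "\<dots> = of_nat (card {x::'a. cls x = \<delta>})"
    by (simp add: cls_zero q_0 if_distrib cong: if_cong)
  finally have "(\<Sum>a\<in>{a. cls a = \<delta>}. inverse (q a)) \<noteq> 0"
    using inv_sqrt_double_square[of \<delta>] by auto
  then show ?thesis
    by (simp add: gauss_sum_def inv_sqrt_double_nonzero)
qed

lemma \<alpha>_nonzero: "\<alpha> \<noteq> 0"
  using \<alpha>_square gauss_sum_nonzero \<epsilon>_square by auto

lemma \<beta>_\<alpha>: "\<beta> * \<beta> * (\<alpha> * \<alpha>) = 1"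
proof -
  have "\<beta> * \<alpha> = 1 \<or> \<beta> * \<alpha> = - 1"
    using \<beta>_choice \<alpha>_nonzero by auto
  then have "(\<beta> * \<alpha>) * (\<beta> * \<alpha>) = 1"
    by auto
  then show ?thesis
    by (simp only: mult_ac)
qed

text \<open>Completing the square: up to a constant, the summand is the inverse of q at f + (e - p),
  and this translation carries the class of f to \<delta>.\<close>

lemma gauss_shift:
  "(\<Sum>f\<in>{f. cls f = \<delta> + cls e + cls p}. inverse (q f) * \<sigma> f p * inverse (\<sigma> f e)) =
    q e * q p * inverse (\<sigma> e p) * (\<Sum>a\<in>{a. cls a = \<delta>}. inverse (q a))"
proof -
  have "inverse (q f) * \<sigma> f p * inverse (\<sigma> f e) = q e * q p * inverse (\<sigma> e p) * inverse (q (f + (e + - p)))"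
    if f: "cls f = \<delta> + cls e + cls p" for f
  proof -
    have "q (f + (e + - p)) * (\<sigma> f p * \<sigma> e p) = q f * q e * q p * \<sigma> f e"
      by (simp add: q_add[of f] q_add[of e] q_uminus f W_simps \<sigma>_add \<sigma>_uminus \<sigma>_nonzero mult_ac
          del: add_uminus_conv_diff)
    then show ?thesis
      using \<sigma>_nonzero[of f p] \<sigma>_nonzero[of f e] \<sigma>_nonzero[of e p] q_nonzero
      by (simp add: field_simps)
  qed
  then have "(\<Sum>f\<in>{f. cls f = \<delta> + cls e + cls p}. inverse (q f) * \<sigma> f p * inverse (\<sigma> f e))
     = (\<Sum>f\<in>{f. cls f = \<delta> + cls e + cls p}. q e * q p * inverse (\<sigma> e p) * inverse (q (f + (e + - p))))"
    by (intro sum.cong refl) auto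
  also have "\<dots> = (\<Sum>f\<in>{f. cls f = \<delta>}. q e * q p * inverse (\<sigma> e p) * inverse (q f))"
    by (subst sum_class_shift) (simp add: cls_diff add_ac)
  finally show ?thesis
    by (simp add: sum_distrib_left)
qed

text \<open>For two twisted labels and summand t, both sides equal q(t) squared once \<alpha> and
  \<beta> have cancelled by \<open>\<beta>_\<alpha>\<close>. For one Vec and one twisted label,
  \<sigma> a a cancels the two inverses of q, and the sign left from the braiding is that of the
  tensor structure.\<close>

lemma twist_sym:
  assumes "s \<in> fus \<delta> a b"
  shows "twist_sym \<sigma> \<beta> s * \<tau>h (degree s) a b s = twist_sym \<sigma> \<beta> a * twist_sym \<sigma> \<beta> b * R a b s *
    R (h_simple (degree a) b) a s"
  using assms
  apply (cases a; cases b)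
  apply (auto simp: \<tau>h_def \<sigma>_self q_add q_uminus sgn_simps mult_ac add_ac q_nonzero)
    apply (rule \<sigma>_sym)
   apply (simp add: field_simps q_nonzero)
  using \<beta>_\<alpha> apply (simp add: mult_ac)
  done

section \<open>Symbol identities summed over intermediate labels\<close>

lemma \<epsilon>_square_left: "\<epsilon> * (\<epsilon> * x) = x"
  using \<epsilon>_square by (simp flip: mult.assoc)

lemma sum_fus_Tw:
  fixes g :: "'a simple \<Rightarrow> complex"
  assumes "\<And>l. l \<notin> fus \<delta> (Tw x) (Tw y) \<Longrightarrow> g l = 0"
  shows "sum g UNIV = (\<Sum>t\<in>{t. cls t = \<delta> + x + y}. g (Vec t))"
proof -
  have "sum g UNIV = sum g (fus \<delta> (Tw x) (Tw y))"
    using assms by (intro sum.mono_neutral_right) auto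
  also have "fus \<delta> (Tw x) (Tw y) = Vec ` {t. cls t = \<delta> + x + y}"
    by auto
  finally show ?thesis
    by (simp add: sum.reindex inj_on_def)
qed

lemma degree_eq_g: "degree l = Z2_g \<longleftrightarrow> (\<exists>x. l = Tw x)"
  by (cases l) auto

lemma Fi_F:
  assumes "e \<in> fus \<delta> a b" "k \<in> fus \<delta> e c" "f \<in> fus \<delta> b c" "k \<in> fus \<delta> a f"
    and "\<not> (degree a = Z2_g \<and> degree b = Z2_g \<and> degree c = Z2_g)"
  shows "Fi a b c e f k * F a b c e f k = 1"
proof -
  have "assoc_sym (\<lambda>a b. inverse (\<sigma> a b)) \<omega> \<delta> \<epsilon> a b c e f k * assoc_sym \<sigma> \<omega> \<delta> \<epsilon> a b c e f k = 1"
    using assms by (cases a; cases b; cases c) (auto simp: W_square \<omega>_square \<sigma>_nonzero)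
  then show ?thesis
    using assms by (simp add: F_def Fi_def)
qed

text \<open>For three twisted labels this is the orthogonality of two columns of the Fourier matrix.
  In all other cases the sum has one term and both channels coincide.\<close>

lemma Fi_F_sum:
  assumes "e \<in> fus \<delta> a b" "k \<in> fus \<delta> e c" "e' \<in> fus \<delta> a b" "k \<in> fus \<delta> e' c"
  shows "(\<Sum>f\<in>UNIV. Fi a b c e' f k * F a b c e f k) = (if e = e' then 1 else 0)"
proof (cases "degree a = Z2_g \<and> degree b = Z2_g \<and> degree c = Z2_g")
  case True
  then obtain x y z where abc: "a = Tw x" "b = Tw y" "c = Tw z"
    by (auto simp: degree_eq_g)
  obtain t t' where e: "e = Vec t" "e' = Vec t'" "cls t = \<delta> + x + y" "cls t' = \<delta> + x + y"
    and k: "k = Tw (cls t + z)"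
    using assms by (auto simp: abc)
  have "(\<Sum>f\<in>UNIV. Fi a b c e' f k * F a b c e f k) =
      (\<Sum>r\<in>{r. cls r = \<delta> + y + z}. Fi a b c e' (Vec r) k * F a b c e (Vec r) k)"
    unfolding abc by (rule sum_fus_Tw) (simp add: F_def Fi_def del: fus.simps)
  \<comment> \<open>The trivial factor \<sigma> r 0 is inserted so that \<open>sum_character\<close>
    applies with p = 0.\<close>
  also have "\<dots> = (\<Sum>r\<in>{r. cls r = \<delta> + y + z}. inv_sqrt_double TYPE('a) * inv_sqrt_double TYPE('a) *
      (\<sigma> r t' * inverse (\<sigma> r t) * inverse (\<sigma> r 0)))"
    using \<epsilon>_square by (intro sum.cong refl) (simp add: F_def Fi_def abc e k add_ac \<sigma>_zero \<sigma>_sym mult_ac \<epsilon>_square_left)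
  also have "\<dots> = inv_sqrt_double TYPE('a) * inv_sqrt_double TYPE('a) * (\<Sum>r\<in>{r. cls r = \<delta> + y + z}. 
      (\<sigma> r t' * inverse (\<sigma> r t) * inverse (\<sigma> r 0)))"
    by (simp add: sum_distrib_left)
  also have "\<dots> = (if t' = t then 1 else 0)"
    by (subst sum_character) (auto simp: e cls_zero W_0_right inv_sqrt_double_square)
  finally show ?thesis
    by (auto simp: e)
next
  case False
  obtain f where f: "f \<in> fus \<delta> b c" "k \<in> fus \<delta> a f" 
    "\<And>f'. f' \<in> fus \<delta> b c \<Longrightarrow> k \<in> fus \<delta> a f' \<Longrightarrow> f' = f"
    using fus_right[OF False assms(1,2)] by blast
  have "e = e'"
    using fus_left[OF False f(1,2)] assms by metis
  moreover have "(\<Sum>f\<in>UNIV. Fi a b c e f k * F a b c e f k) = Fi a b c e f k * F a b c e f k"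
    by (rule sum_unique) (use f(3) in \<open>auto simp: F_def\<close>)
  ultimately show ?thesis
    using Fi_F[OF assms(1,2) f(1,2) False] by simp
qed

lemma F_Fi_sum:
  assumes "f \<in> fus \<delta> b c" "k \<in> fus \<delta> a f" "f' \<in> fus \<delta> b c" "k \<in> fus \<delta> a f'"
  shows "(\<Sum>e\<in>UNIV. F a b c e f k * Fi a b c e f' k) = (if f = f' then 1 else 0)"
proof (cases "degree a = Z2_g \<and> degree b = Z2_g \<and> degree c = Z2_g")
  case True
  then obtain x y z where abc: "a = Tw x" "b = Tw y" "c = Tw z"
    by (auto simp: degree_eq_g)
  obtain t t' where f: "f = Vec t" "f' = Vec t'" "cls t = \<delta> + y + z" "cls t' = \<delta> + y + z"
    and k: "k = Tw (cls t + x)"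
    using assms by (auto simp: abc)
  have "(\<Sum>e\<in>UNIV. F a b c e f k * Fi a b c e f' k) =
      (\<Sum>r\<in>{r. cls r = \<delta> + x + y}. F a b c (Vec r) f k * Fi a b c (Vec r) f' k)"
    unfolding abc by (rule sum_fus_Tw) (simp add: F_def Fi_def del: fus.simps)
  also have "\<dots> = (\<Sum>r\<in>{r. cls r = \<delta> + x + y}. inv_sqrt_double TYPE('a) * inv_sqrt_double TYPE('a) *
      (\<sigma> r t' * inverse (\<sigma> r t) * inverse (\<sigma> r 0)))"
    using \<epsilon>_square by (intro sum.cong refl) (simp add: F_def Fi_def abc f k add_ac \<sigma>_zero mult_ac \<epsilon>_square_left)
  also have "\<dots> = inv_sqrt_double TYPE('a) * inv_sqrt_double TYPE('a) * (\<Sum>r\<in>{r. cls r = \<delta> + x + y}. 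
      (\<sigma> r t' * inverse (\<sigma> r t) * inverse (\<sigma> r 0)))"
    by (simp add: sum_distrib_left)
  also have "\<dots> = (if t' = t then 1 else 0)"
    by (subst sum_character) (auto simp: f cls_zero W_0_right inv_sqrt_double_square)
  finally show ?thesis
    by (auto simp: f)
next
  case False
  obtain e where e: "e \<in> fus \<delta> a b" "k \<in> fus \<delta> e c" 
    "\<And>e'. e' \<in> fus \<delta> a b \<Longrightarrow> k \<in> fus \<delta> e' c \<Longrightarrow> e' = e"
    using fus_left[OF False assms(1,2)] by blast
  have "f = f'"
    using fus_right[OF False e(1,2)] assms by metis
  moreover have "(\<Sum>e\<in>UNIV. F a b c e f k * Fi a b c e f k) = F a b c e f k * Fi a b c e f k"
    by (rule sum_unique) (use e(3) in \<open>auto simp: F_def\<close>)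
  ultimately show ?thesis
    using Fi_F[OF e(1,2) assms(1,2) False] by (simp add: mult.commute)
qed

text \<open>With four twisted labels the right-hand side is a character sum, which vanishes unless
  k' = e' + p'. On the left the same condition is the admissibility of k in the product of e and p,
  built into \<open>F\<close>.\<close>

lemma pentagon_sym:
  assumes "e \<in> fus \<delta> a b" "f \<in> fus \<delta> e c" "k \<in> fus \<delta> f d"
    "p \<in> fus \<delta> c d" "r \<in> fus \<delta> b p" "k \<in> fus \<delta> a r"
  shows "F e c d f p k * F a b p e r k = (\<Sum>x\<in>UNIV. F a b c e x f * F a x d f r k * F b c d x p r)"
proof (cases "degree a = Z2_g \<and> degree b = Z2_g \<and> degree c = Z2_g \<and> degree d = Z2_g")
  case True
  then obtain u v w z where abc: "a = Tw u" "b = Tw v" "c = Tw w" "d = Tw z"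
    by (auto simp: degree_eq_g)
  obtain e' where e: "e = Vec e'" "cls e' = \<delta> + u + v"
    using assms by (auto simp: abc)
  have f: "f = Tw (cls e' + w)" using assms by (auto simp: abc e)
  obtain p' where p: "p = Vec p'" "cls p' = \<delta> + w + z"
    using assms by (auto simp: abc)
  have r: "r = Tw (cls p' + v)" using assms by (auto simp: abc p)
  obtain k' where k: "k = Vec k'" "cls k' = cls e' + cls p'"
    using assms by (auto simp: abc e f p add_ac)
  have "(\<Sum>x\<in>UNIV. F a b c e x f * F a x d f r k * F b c d x p r) =
      (\<Sum>x\<in>{x. cls x = \<delta> + v + w}. F a b c e (Vec x) f * F a (Vec x) d f r k * F b c d (Vec x) p r)"
    unfolding abc by (rule sum_fus_Tw) (simp add: F_def Fi_def del: fus.simps)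
  also have "\<dots> = (\<Sum>x\<in>{x. cls x = \<delta> + v + w}. inv_sqrt_double TYPE('a) * inv_sqrt_double TYPE('a) *
      (\<sigma> x k' * inverse (\<sigma> x e') * inverse (\<sigma> x p')))"
    using \<epsilon>_square assms
    by (intro sum.cong refl) (simp add: F_def abc e f p r k cls_add add_ac \<sigma>_sym mult_ac \<epsilon>_square_left)
  also have "\<dots> = inv_sqrt_double TYPE('a) * inv_sqrt_double TYPE('a) * (\<Sum>x\<in>{x. cls x = \<delta> + v + w}. 
      (\<sigma> x k' * inverse (\<sigma> x e') * inverse (\<sigma> x p')))"
    by (simp add: sum_distrib_left)
  also have "\<dots> = (if k' = e' + p' then W (\<delta> + v + w) e' p' else 0)"
    by (subst sum_character) (auto simp: k inv_sqrt_double_square simp flip: mult.assoc)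
  also have "\<dots> = F e c d f p k * F a b p e r k"
    using assms by (auto simp: F_def abc e f p r k cls_add add_ac W_simps mult_ac)
  finally show ?thesis ..
next
  case False
  \<comment> \<open>If a, b, c are all twisted then d is not, and x is determined by b, c, d instead
    of by a, b, c; the third fusion condition then holds automatically.\<close>
  have ex: "\<exists>x. x \<in> fus \<delta> b c \<and> f \<in> fus \<delta> a x \<and> r \<in> fus \<delta> x d \<and>
     (\<forall>y. y \<in> fus \<delta> b c \<longrightarrow> f \<in> fus \<delta> a y \<longrightarrow> r \<in> fus \<delta> y d \<longrightarrow> y = x)"
  proof (cases "degree a = Z2_g \<and> degree b = Z2_g \<and> degree c = Z2_g")
    case True
    then have "\<not> (degree b = Z2_g \<and> degree c = Z2_g \<and> degree d = Z2_g)"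
      using False by blast
    then obtain x where x: "x \<in> fus \<delta> b c" "r \<in> fus \<delta> x d"
      "\<And>y. y \<in> fus \<delta> b c \<Longrightarrow> r \<in> fus \<delta> y d \<Longrightarrow> y = x"
      using fus_left[OF _ assms(4,5)] by blast
    moreover have "f \<in> fus \<delta> a x"
      using True False x(1,2) assms by (auto simp: degree_eq_g; cases d; auto simp: cls_add add_ac)
    ultimately show ?thesis by blast
  next
    case abc: False
    then obtain x where x: "x \<in> fus \<delta> b c" "f \<in> fus \<delta> a x"
      "\<And>y. y \<in> fus \<delta> b c \<Longrightarrow> f \<in> fus \<delta> a y \<Longrightarrow> y = x"
      using fus_right[OF _ assms(1,2)] by blast
    moreover have "r \<in> fus \<delta> x d"
      using abc x(1,2) assms
      apply (cases a; cases b; cases c; cases d; simp add: cls_add cls_uminus add_ac; (elim exE conjE)?;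
          simp add: cls_add cls_uminus add_ac)
      done
    ultimately show ?thesis by blast
  qed
  then obtain x where x: "x \<in> fus \<delta> b c" "f \<in> fus \<delta> a x" "r \<in> fus \<delta> x d"
    "\<And>y. y \<in> fus \<delta> b c \<Longrightarrow> f \<in> fus \<delta> a y \<Longrightarrow> r \<in> fus \<delta> y d \<Longrightarrow> y = x"
    by blast
  have "(\<Sum>x\<in>UNIV. F a b c e x f * F a x d f r k * F b c d x p r) = F a b c e x f * F a x d f r k * F b c d x p r"
    by (rule sum_unique) (use x(4) in \<open>auto simp: F_def\<close>)
  then show ?thesis
    using pentagon1[OF assms x(1-3) False] by simp
qed

text \<open>For three twisted labels the left side is evaluated by \<open>gauss_shift\<close>; the
  Gauss sum that appears is replaced by \<alpha> squared, matching the two braidings of twisted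
  labels on the right.\<close>

lemma hexagon1_sym:
  assumes "e \<in> fus \<delta> a b" "k \<in> fus \<delta> e d"
    "p \<in> fus \<delta> (h_simple (degree a) d) a" "k \<in> fus \<delta> (h_simple (degree a) b) p"
  shows "(\<Sum>f\<in>UNIV. F a b d e f k * R a f k * \<tau>h (degree a) b d f *
      F (h_simple (degree a) b) (h_simple (degree a) d) a (h_simple (degree a) f) p k)
    = R a b e * F (h_simple (degree a) b) a d e p k * R a d p"
proof (cases "degree a = Z2_g \<and> degree b = Z2_g \<and> degree d = Z2_g")
  case True
  then obtain u v w where abc: "a = Tw u" "b = Tw v" "d = Tw w"
    by (auto simp: degree_eq_g)
  obtain e' where e: "e = Vec e'" "cls e' = \<delta> + u + v"
    using assms by (auto simp: abc)
  obtain p' where p: "p = Vec p'" "cls p' = \<delta> + w + u"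
    using assms by (auto simp: abc)
  have k: "k = Tw (\<delta> + u + v + w)" using assms by (auto simp: abc e)
  have "(\<Sum>f\<in>UNIV. F a b d e f k * R a f k * \<tau>h (degree a) b d f *
      F (h_simple (degree a) b) (h_simple (degree a) d) a (h_simple (degree a) f) p k) =
     (\<Sum>f\<in>{f. cls f = \<delta> + v + w}. F a b d e (Vec f) k * R a (Vec f) k * \<tau>h (degree a) b d (Vec f) *
      F (h_simple (degree a) b) (h_simple (degree a) d) a (h_simple (degree a) (Vec f)) p k)"
    unfolding abc by (rule sum_fus_Tw) (simp add: F_def Fi_def del: fus.simps)
  also have "\<dots> = (\<Sum>f\<in>{f. cls f = \<delta> + v + w}. inv_sqrt_double TYPE('a) * inv_sqrt_double TYPE('a) *
      (inverse (q f) * \<sigma> f p' * inverse (\<sigma> f e')))"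
    using \<epsilon>_square 
    apply (intro sum.cong refl) 
    apply (simp add: F_def abc e p k cls_uminus add_ac \<tau>h_def \<sigma>_sym \<sigma>_uminus W_simps mult_ac)
    done
  also have "\<dots> = inv_sqrt_double TYPE('a) * inv_sqrt_double TYPE('a) * (q e' * q p' * inverse (\<sigma> e' p') * (\<Sum>a\<in>{a. cls a = \<delta>}. inverse (q a)))"
    using gauss_shift[of p' e'] by (simp add: sum_distrib_left[symmetric] e p add_ac)
  also have "\<dots> = \<epsilon> * inv_sqrt_double TYPE('a) * q e' * q p' * inverse (\<sigma> e' p') * (\<epsilon> * gauss_sum \<delta> (\<lambda>a. inverse (q a)))"
    using \<epsilon>_square by (simp add: gauss_sum_def mult_ac \<epsilon>_square_left)
  also have "\<dots> = R a b e * F (h_simple (degree a) b) a d e p k * R a d p"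
    unfolding \<alpha>_square[symmetric]
    using assms by (simp add: abc e p k F_def add_ac power2_eq_square mult_ac)
  finally show ?thesis .
next
  case False
  obtain f where f: "f \<in> fus \<delta> b d" "k \<in> fus \<delta> a f" 
    "\<And>f'. f' \<in> fus \<delta> b d \<Longrightarrow> k \<in> fus \<delta> a f' \<Longrightarrow> f' = f"
    using fus_right[OF False assms(1,2)] by blast
  show ?thesis
    unfolding hex1_1[OF assms(1,2) f(1,2) assms(3,4) False, symmetric]
    by (rule sum_unique) (use f(3) in \<open>auto simp: F_def\<close>)
qed

text \<open>The inverse associator contributes \<sigma> instead of its inverse, so the square is
  completed with - f' in place of f'.\<close>

lemma hexagon2_sym:
  assumes "f \<in> fus \<delta> b d" "k \<in> fus \<delta> a f"
    "p \<in> fus \<delta> (h_simple (degree a) (h_simple (degree b) d)) a" "k \<in> fus \<delta> p b"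
  shows "(\<Sum>e\<in>UNIV. Fi a b d e f k * R e d k * Fi (h_simple (degree a) (h_simple (degree b) d)) a b p e k)
    = R b d f * Fi a (h_simple (degree b) d) b p f k * R a (h_simple (degree b) d) p"
proof (cases "degree a = Z2_g \<and> degree b = Z2_g \<and> degree d = Z2_g")
  case True
  then obtain u v w where abc: "a = Tw u" "b = Tw v" "d = Tw w"
    by (auto simp: degree_eq_g)
  obtain f' where f: "f = Vec f'" "cls f' = \<delta> + v + w"
    using assms by (auto simp: abc)
  obtain p' where p: "p = Vec p'" "cls p' = \<delta> + w + u"
    using assms by (auto simp: abc)
  have k: "k = Tw (\<delta> + u + v + w)" using assms by (auto simp: abc f add_ac)
  have "(\<Sum>e\<in>UNIV. Fi a b d e f k * R e d k * Fi (h_simple (degree a) (h_simple (degree b) d)) a b p e k) =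
     (\<Sum>e\<in>{e. cls e = \<delta> + u + v}. Fi a b d (Vec e) f k * R (Vec e) d k * 
       Fi (h_simple (degree a) (h_simple (degree b) d)) a b p (Vec e) k)"
    unfolding abc by (rule sum_fus_Tw) (simp add: F_def Fi_def del: fus.simps)
  \<comment> \<open>Here \<sigma> e f' is rewritten as the inverse of \<sigma> e (- f') times a sign
    that depends on e only through its class; this is the shape required by
    \<open>gauss_shift\<close>.\<close>
  also have "\<dots> = (\<Sum>e\<in>{e. cls e = \<delta> + u + v}. inv_sqrt_double TYPE('a) * inv_sqrt_double TYPE('a) * W (\<delta> + u + v) f' (- f') *
      (inverse (q e) * \<sigma> e p' * inverse (\<sigma> e (- f'))))"
    using \<epsilon>_square 
    apply (intro sum.cong refl) 
    apply (simp add: Fi_def abc f p k cls_uminus add_ac \<sigma>_sym \<sigma>_uminus W_simps mult_ac)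
    done
  also have "\<dots> = inv_sqrt_double TYPE('a) * inv_sqrt_double TYPE('a) * W (\<delta> + u + v) f' (- f') *
     (q (- f') * q p' * inverse (\<sigma> (- f') p') * (\<Sum>a\<in>{a. cls a = \<delta>}. inverse (q a)))"
    using gauss_shift[of p' "- f'"] by (simp add: sum_distrib_left[symmetric] f p add_ac cls_uminus)
  also have "\<dots> = \<epsilon> * inv_sqrt_double TYPE('a) * q f' * q p' * \<sigma> f' p' * (\<epsilon> * gauss_sum \<delta> (\<lambda>a. inverse (q a)))"
    using \<epsilon>_square by (simp add: gauss_sum_def q_uminus \<sigma>_uminus_left W_simps f p mult_ac \<epsilon>_square_left)
  also have "\<dots> = R b d f * Fi a (h_simple (degree b) d) b p f k * R a (h_simple (degree b) d) p"
    unfolding \<alpha>_square[symmetric]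
    using assms by (simp add: abc f p k Fi_def add_ac power2_eq_square mult_ac \<sigma>_sym)
  finally show ?thesis .
next
  case False
  obtain e where e: "e \<in> fus \<delta> a b" "k \<in> fus \<delta> e d" 
    "\<And>e'. e' \<in> fus \<delta> a b \<Longrightarrow> k \<in> fus \<delta> e' d \<Longrightarrow> e' = e"
    using fus_left[OF False assms(1,2)] by blast
  show ?thesis
    unfolding hex2_1[OF assms(1,2) e(1,2) assms(3,4) False, symmetric]
    by (rule sum_unique) (use e(3) in \<open>auto simp: Fi_def\<close>)
qed

end

section \<open>Matrices\<close>

text \<open>\<open>mat_mult\<close> sums over the support of a column of the right factor, and a sum
  over an infinite set is 0 by convention. With finite columns it is the true matrix product;
  associativity and linearity in the right factor rely on this.\<close>

definition colfin :: "'a mat \<Rightarrow> bool" where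
  "colfin M \<longleftrightarrow> (\<forall>s. finite {t. M t s \<noteq> 0})"

lemma mat_mult_sum:
  assumes "finite T" "\<And>t. M t s \<noteq> 0 \<Longrightarrow> t \<in> T"
  shows "mat_mult N M u s = (\<Sum>t\<in>T. N u t * M t s)"
  unfolding mat_mult_def using assms by (intro sum.mono_neutral_left) auto

lemma mat_mult_sum_row:
  assumes "colfin M" "finite T" "\<And>t. N u t \<noteq> 0 \<Longrightarrow> t \<in> T"
  shows "mat_mult N M u s = (\<Sum>t\<in>T. N u t * M t s)"
proof -
  let ?S = "{t. M t s \<noteq> 0}"
  have fin: "finite ?S"
    using assms by (simp add: colfin_def)
  have "mat_mult N M u s = (\<Sum>t\<in>?S \<inter> T. N u t * M t s)"
    unfolding mat_mult_def using assms fin by (intro sum.mono_neutral_right) auto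
  also have "\<dots> = (\<Sum>t\<in>T. N u t * M t s)"
    using assms fin by (intro sum.mono_neutral_left) auto
  finally show ?thesis .
qed

lemma mat_mult_single:
  assumes "\<And>t. N u t * M t s \<noteq> 0 \<Longrightarrow> t = t0"
  shows "colfin M \<Longrightarrow> mat_mult N M u s = N u t0 * M t0 s"
proof -
  assume "colfin M"
  then have "finite {t. M t s \<noteq> 0}"
    by (simp add: colfin_def)
  then have "mat_mult N M u s = (\<Sum>t\<in>insert t0 {t. M t s \<noteq> 0}. N u t * M t s)"
    by (intro mat_mult_sum) auto
  also have "\<dots> = (\<Sum>t\<in>{t0}. N u t * M t s)"
    using assms \<open>finite _\<close> by (intro sum.mono_neutral_right) auto
  finally show ?thesis by simp
qed

lemma mat_mult_nonzeroE:
  assumes "mat_mult N M u s \<noteq> 0"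
  obtains t where "N u t \<noteq> 0" "M t s \<noteq> 0"
proof -
  have "\<exists>t. N u t * M t s \<noteq> 0"
    using assms unfolding mat_mult_def by (metis (mono_tags, lifting) sum.neutral)
  then show thesis using that by auto
qed

lemma colfin_mult: "colfin M \<Longrightarrow> colfin N \<Longrightarrow> colfin (mat_mult N M)"
proof -
  assume *: "colfin M" "colfin N"
  have "{u. mat_mult N M u s \<noteq> 0} \<subseteq> (\<Union>t\<in>{t. M t s \<noteq> 0}. {u. N u t \<noteq> 0})" for s
    by (auto elim: mat_mult_nonzeroE)
  then show ?thesis
    using * unfolding colfin_def by (meson finite_UN finite_subset)
qed

lemma mat_mult_assoc:
  assumes "colfin M" "colfin N"
  shows "mat_mult (mat_mult P N) M = mat_mult P (mat_mult N M)"
proof (intro ext)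
  fix u s
  let ?S = "{t. M t s \<noteq> 0}"
  let ?T = "\<Union>t\<in>?S. {w. N w t \<noteq> 0}"
  have S: "finite ?S" and T: "finite ?T"
    using assms by (auto simp: colfin_def)
  have "mat_mult (mat_mult P N) M u s = (\<Sum>t\<in>?S. (\<Sum>w\<in>?T. P u w * N w t) * M t s)"
    unfolding mat_mult_def[of "mat_mult P N"]
    by (intro sum.cong refl arg_cong2[of _ _ _ _ "(*)"] mat_mult_sum T) auto
  also have "\<dots> = (\<Sum>w\<in>?T. \<Sum>t\<in>?S. P u w * N w t * M t s)"
    unfolding sum_distrib_right by (rule sum.swap)
  also have "\<dots> = (\<Sum>w\<in>?T. P u w * mat_mult N M w s)"
    by (simp add: mat_mult_def sum_distrib_left mult.assoc)
  also have "\<dots> = mat_mult P (mat_mult N M) u s"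
    by (rule mat_mult_sum[symmetric]) (use T in \<open>auto elim: mat_mult_nonzeroE\<close>)
  finally show "mat_mult (mat_mult P N) M u s = mat_mult P (mat_mult N M) u s" .
qed

lemma mat_homI: "(\<And>u s. M u s \<noteq> 0 \<Longrightarrow> u \<in> B \<and> s \<in> A \<and> lab u = lab s) \<Longrightarrow> M \<in> mat_hom A B"
  by (simp add: mat_hom_def)

lemma mat_homD: "M \<in> mat_hom A B \<Longrightarrow> M u s \<noteq> 0 \<Longrightarrow> u \<in> B \<and> s \<in> A \<and> lab u = lab s"
  by (simp add: mat_hom_def)

lemma mat_hom_colfin: "M \<in> mat_hom A B \<Longrightarrow> finite B \<Longrightarrow> colfin M"
  unfolding colfin_def mat_hom_def by (auto intro: finite_subset[of _ B])

lemma mat_hom_eqI: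
  assumes "M \<in> mat_hom A B" "N \<in> mat_hom A B"
    and "\<And>u s. u \<in> B \<Longrightarrow> s \<in> A \<Longrightarrow> lab u = lab s \<Longrightarrow> M u s = N u s"
  shows "M = N"
proof (intro ext)
  fix u s
  show "M u s = N u s"
    using assms(3)[of u s] mat_homD[OF assms(1), of u s] mat_homD[OF assms(2), of u s] by metis
qed

lemma mat_mult_in: "M \<in> mat_hom A B \<Longrightarrow> N \<in> mat_hom B D \<Longrightarrow> mat_mult N M \<in> mat_hom A D"
  by (rule mat_homI) (metis mat_homD mat_mult_nonzeroE)

lemma mat_id_in: "mat_id A \<in> mat_hom A A"
  by (auto simp: mat_id_def mat_hom_def)

lemma mat_id_left: "colfin M \<Longrightarrow> (\<And>u s. M u s \<noteq> 0 \<Longrightarrow> u \<in> A) \<Longrightarrow> mat_mult (mat_id A) M = M"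
proof (intro ext)
  fix u s
  assume *: "colfin M" "\<And>u s. M u s \<noteq> 0 \<Longrightarrow> u \<in> A"
  have "mat_mult (mat_id A) M u s = mat_id A u u * M u s"
    by (rule mat_mult_single) (use * in \<open>auto simp: mat_id_def split: if_splits\<close>)
  then show "mat_mult (mat_id A) M u s = M u s"
    using *(2)[of u s] by (auto simp: mat_id_def)
qed

lemma colfin_id: "colfin (mat_id A)"
  by (simp add: colfin_def mat_id_def)

lemma mat_id_right: "(\<And>u s. M u s \<noteq> 0 \<Longrightarrow> s \<in> A) \<Longrightarrow> mat_mult M (mat_id A) = M"
proof (intro ext)
  fix u s
  assume *: "\<And>u s. M u s \<noteq> 0 \<Longrightarrow> s \<in> A"
  have "mat_mult M (mat_id A) u s = M u s * mat_id A s s"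
    by (rule mat_mult_single[OF _ colfin_id]) (auto simp: mat_id_def split: if_splits)
  then show "mat_mult M (mat_id A) u s = M u s"
    using *[of u s] by (auto simp: mat_id_def)
qed

lemma colfin_add:
  assumes "colfin M" "colfin N"
  shows "colfin (\<lambda>u s. M u s + N u s)"
  unfolding colfin_def
proof
  fix s
  have "finite ({t. M t s \<noteq> 0} \<union> {t. N t s \<noteq> 0})"
    using assms by (simp add: colfin_def)
  then show "finite {t. M t s + N t s \<noteq> 0}"
    by (rule finite_subset[rotated]) auto
qed

lemma colfin_smult: "colfin M \<Longrightarrow> colfin (\<lambda>u s. k * M u s)"
  unfolding colfin_def by simp

lemma mat_mult_add_left: "mat_mult (\<lambda>u s. M u s + N u s) P = (\<lambda>u s. mat_mult M P u s + mat_mult N P u s)"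
  by (intro ext) (simp add: mat_mult_def sum.distrib algebra_simps)

lemma mat_mult_add_right:
  assumes "colfin M" "colfin N"
  shows "mat_mult P (\<lambda>u s. M u s + N u s) = (\<lambda>u s. mat_mult P M u s + mat_mult P N u s)"
proof (intro ext)
  fix u s
  let ?T = "{t. M t s \<noteq> 0} \<union> {t. N t s \<noteq> 0}"
  have T: "finite ?T"
    using assms by (auto simp: colfin_def)
  show "mat_mult P (\<lambda>u s. M u s + N u s) u s = mat_mult P M u s + mat_mult P N u s"
    by (subst (1 2 3) mat_mult_sum[OF T]) (auto simp: sum.distrib algebra_simps)
qed

lemma mat_mult_smult_left: "mat_mult (\<lambda>u s. k * M u s) P = (\<lambda>u s. k * mat_mult M P u s)"
  by (intro ext) (simp add: mat_mult_def sum_distrib_left algebra_simps)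

lemma mat_mult_smult_right: "colfin M \<Longrightarrow> mat_mult P (\<lambda>u s. k * M u s) = (\<lambda>u s. k * mat_mult P M u s)"
proof (intro ext)
  fix u s
  assume "colfin M"
  then have T: "finite {t. M t s \<noteq> 0}"
    by (auto simp: colfin_def)
  show "mat_mult P (\<lambda>u s. k * M u s) u s = k * mat_mult P M u s"
    by (subst (1 2) mat_mult_sum[OF T]) (auto simp: sum_distrib_left algebra_simps)
qed

section \<open>The action of g on trees and matrices\<close>

lemma g_tree_g_tree [simp]: "g_tree (g_tree t) = t"
  by (induction t) auto

lemma lab_g_tree [simp]: "lab (g_tree t) = g_simple (lab t)"
  by (cases t) auto

lemma g_tree_eq_iff [simp]: "g_tree s = g_tree t \<longleftrightarrow> s = t"
  by (metis g_tree_g_tree)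

lemma g_tree_image_iff [simp]: "g_tree t \<in> g_tree ` A \<longleftrightarrow> t \<in> A"
  by (metis g_tree_g_tree image_iff)

lemma mem_g_tree_image: "t \<in> g_tree ` A \<longleftrightarrow> g_tree t \<in> A"
  by (metis g_tree_image_iff g_tree_g_tree)

text \<open>Relabelling the columns turns an equivariant structure from g X to X into a matrix on X
  itself that shifts labels by g. The composite of the structure with its g-image becomes the plain
  square of that matrix, so the action on morphisms disappears from the formulas.\<close>

definition pm :: "'a::ab_group_add mat \<Rightarrow> 'a mat" where
  "pm M = (\<lambda>u s. M u (g_tree s))"

lemma pm_pm [simp]: "pm (pm M) = M"
  by (simp add: pm_def)

lemma pm_mult: "mat_mult N (pm M) = pm (mat_mult N M)"
  by (simp add: mat_mult_def pm_def)

lemma mult_h_mat: "mat_mult N (h_mat Z2_g M) = pm (mat_mult (pm N) M)"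
proof (intro ext)
  fix u s
  have "mat_mult N (h_mat Z2_g M) u s = (\<Sum>t\<in>{t. M (g_tree t) (g_tree s) \<noteq> 0}. N u t * M (g_tree t) (g_tree s))"
    by (simp add: mat_mult_def h_mat_def)
  also have "\<dots> = (\<Sum>t\<in>{t. M t (g_tree s) \<noteq> 0}. N u (g_tree t) * M t (g_tree s))"
    by (rule sum.reindex_bij_witness[of _ g_tree g_tree]) auto
  finally show "mat_mult N (h_mat Z2_g M) u s = pm (mat_mult (pm N) M) u s"
    by (simp add: mat_mult_def pm_def)
qed

definition Z2_mult :: "Z2 \<Rightarrow> Z2 \<Rightarrow> Z2" where
  "Z2_mult h h' = (if h = h' then Z2_1 else Z2_g)"

lemma Z2_mult_simps [simp]: "Z2_mult Z2_1 h = h" "Z2_mult h Z2_1 = h" "Z2_mult Z2_g Z2_g = Z2_1"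
  by (cases h; simp add: Z2_mult_def)+

lemma h_simple_Z2_mult: "h_simple (Z2_mult h h') l = h_simple h (h_simple h' l)"
  by (cases h; cases h') auto

text \<open>Morphisms (h = 1) and actions of g (h = g) in one family, so that facts about tensor
  products, unitors, braiding and twist can be proved once for both.\<close>

definition mat_hhom :: "Z2 \<Rightarrow> 'a::ab_group_add tree set \<Rightarrow> 'a tree set \<Rightarrow> 'a mat set" where
  "mat_hhom h A B = {M. \<forall>u s. M u s \<noteq> 0 \<longrightarrow> u \<in> B \<and> s \<in> A \<and> lab u = h_simple h (lab s)}"

lemma mat_hhom_1: "mat_hhom Z2_1 A B = mat_hom A B"
  by (simp add: mat_hhom_def mat_hom_def)

lemma mat_hhomI:
  "(\<And>u s. M u s \<noteq> 0 \<Longrightarrow> u \<in> B \<and> s \<in> A \<and> lab u = h_simple h (lab s)) \<Longrightarrow> M \<in> mat_hhom h A B"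
  by (simp add: mat_hhom_def)

lemma mat_hhomD:
  "M \<in> mat_hhom h A B \<Longrightarrow> M u s \<noteq> 0 \<Longrightarrow> u \<in> B \<and> s \<in> A \<and> lab u = h_simple h (lab s)"
  by (simp add: mat_hhom_def)

lemma mat_hhom_colfin: "M \<in> mat_hhom h A B \<Longrightarrow> finite B \<Longrightarrow> colfin M"
  unfolding colfin_def mat_hhom_def by (auto intro: finite_subset[of _ B])

lemma mat_hhom_eqI:
  assumes "M \<in> mat_hhom h A B" "N \<in> mat_hhom h A B"
    and "\<And>u s. u \<in> B \<Longrightarrow> s \<in> A \<Longrightarrow> lab u = h_simple h (lab s) \<Longrightarrow> M u s = N u s"
  shows "M = N"
proof (intro ext)
  fix u s
  show "M u s = N u s"
    using assms(3)[of u s] mat_hhomD[OF assms(1), of u s] mat_hhomD[OF assms(2), of u s] by metis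
qed

lemma mat_hhom_mult:
  "M \<in> mat_hhom h A B \<Longrightarrow> N \<in> mat_hhom h' B D \<Longrightarrow> mat_mult N M \<in> mat_hhom (Z2_mult h' h) A D"
  unfolding mat_hhom_def by (fastforce elim: mat_mult_nonzeroE simp: h_simple_Z2_mult)

lemma mat_hhom_mult_sum:
  "M \<in> mat_hhom h A B \<Longrightarrow> finite B \<Longrightarrow> mat_mult N M u s = (\<Sum>t\<in>B. N u t * M t s)"
  by (rule mat_mult_sum) (auto dest: mat_hhomD)

lemma pm_in_hhom: "pm M \<in> mat_hhom Z2_g A B \<longleftrightarrow> M \<in> mat_hom (g_tree ` A) B"
  unfolding mat_hhom_def mat_hom_def pm_def
  by (auto simp: mem_g_tree_image) (metis g_tree_g_tree lab_g_tree g_simple_g_simple)+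

lemma h_mat_mult: "h_mat Z2_g (mat_mult N M) = mat_mult (h_mat Z2_g N) (h_mat Z2_g M)"
proof -
  have "pm (h_mat Z2_g N) u t = N (g_tree u) t" for u t
    by (simp add: pm_def h_mat_def)
  then show ?thesis
    by (intro ext) (simp add: mult_h_mat, simp add: pm_def h_mat_def mat_mult_def)
qed

lemma h_mat_h_mat [simp]: "h_mat Z2_g (h_mat Z2_g M) = M"
  by (simp add: h_mat_def)

lemma h_mat_id: "h_mat Z2_g (mat_id A) = mat_id (g_tree ` A)"
  by (auto simp: h_mat_def mat_id_def mem_g_tree_image intro!: ext)

lemma g_simple_eq_iff [simp]: "g_simple a = g_simple b \<longleftrightarrow> a = b"
  by (metis g_simple_g_simple)

lemma h_mat_in:
  assumes "M \<in> mat_hom A B"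
  shows "h_mat Z2_g M \<in> mat_hom (g_tree ` A) (g_tree ` B)"
proof (rule mat_homI)
  fix u s
  assume "h_mat Z2_g M u s \<noteq> 0"
  then show "u \<in> g_tree ` B \<and> s \<in> g_tree ` A \<and> lab u = lab s"
    using mat_homD[OF assms, of "g_tree u" "g_tree s"] by (simp add: h_mat_def mem_g_tree_image)
qed

lemma h_tree_image [simp]: "h_tree Z2_g ` A = g_tree ` A"
  by (rule image_cong) auto

section \<open>Tensor products of matrices\<close>

lemma Node_in_tens [simp]:
  "Node a b s \<in> tens \<delta> A B \<longleftrightarrow> a \<in> A \<and> b \<in> B \<and> s \<in> fus \<delta> (lab a) (lab b)"
  by (simp add: tens_def)

lemma Leaf_not_in_tens [simp]: "Leaf n s \<notin> tens \<delta> A B"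
  by (simp add: tens_def)

lemma tensE:
  assumes "t \<in> tens \<delta> A B"
  obtains a b s where "t = Node a b s" "a \<in> A" "b \<in> B" "s \<in> fus \<delta> (lab a) (lab b)"
  using assms by (auto simp: tens_def)

lemma finite_tens:
  fixes A B :: "'a::{finite, ab_group_add} tree set"
  assumes "finite A" "finite B"
  shows "finite (tens \<delta> A B)"
proof (rule finite_subset)
  show "tens \<delta> A B \<subseteq> (\<lambda>(a, b, s). Node a b s) ` (A \<times> B \<times> UNIV)"
    by (auto simp: tens_def image_iff)
qed (use assms in auto)

text \<open>
  A tensor product of matrices that shift labels by h, with an additional coefficient k; both the
  tensor product of morphisms and the equivariant structure of a tensor product are of this form.
\<close>

definition gtens :: "'a::ab_group_add mod2 \<Rightarrow> Z2 \<Rightarrow> ('a simple \<Rightarrow> 'a simple \<Rightarrow> 'a simple \<Rightarrow> complex) \<Rightarrow>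
    'a mat \<Rightarrow> 'a mat \<Rightarrow> 'a mat" where
  "gtens \<delta> h k M N = (\<lambda>u s. case (u, s) of
     (Node a' b' d', Node a b d) \<Rightarrow>
       if d' = h_simple h d \<and> d \<in> fus \<delta> (lab a) (lab b) then k (lab a) (lab b) d * M a' a * N b' b else 0
   | _ \<Rightarrow> 0)"

lemma gtens_Node [simp]:
  "gtens \<delta> h k M N (Node a' b' d') (Node a b d) =
    (if d' = h_simple h d \<and> d \<in> fus \<delta> (lab a) (lab b) then k (lab a) (lab b) d * M a' a * N b' b else 0)"
  by (simp add: gtens_def)

lemma gtens_nonzeroE:
  assumes "gtens \<delta> h k M N u s \<noteq> 0"
  obtains a' b' a b d where "u = Node a' b' (h_simple h d)" "s = Node a b d"
    "d \<in> fus \<delta> (lab a) (lab b)" "M a' a \<noteq> 0" "N b' b \<noteq> 0" "k (lab a) (lab b) d \<noteq> 0"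
  using assms by (auto simp: gtens_def split: basis_tree.splits if_splits)

lemma mat_tens_eq_gtens: "mat_tens \<delta> M N = gtens \<delta> Z2_1 (\<lambda>_ _ _. 1) M N"
  by (intro ext) (simp add: mat_tens_def gtens_def split: basis_tree.split)

lemma gtens_in:
  assumes "M \<in> mat_hhom h A A'" "N \<in> mat_hhom h B B'"
  shows "gtens \<delta> h k M N \<in> mat_hhom h (tens \<delta> A B) (tens \<delta> A' B')"
proof (rule mat_hhomI)
  fix u s
  assume "gtens \<delta> h k M N u s \<noteq> 0"
  then show "u \<in> tens \<delta> A' B' \<and> s \<in> tens \<delta> A B \<and> lab u = h_simple h (lab s)"
    using mat_hhomD[OF assms(1)] mat_hhomD[OF assms(2)]
    by (cases rule: gtens_nonzeroE) (auto; cases h; auto)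
qed

text \<open>The interchange law. The outer coefficient is read at labels that the inner factor has
  already shifted. It yields functoriality of the tensor product, equivariance of tensored
  morphisms, and the involution property of the action on a tensor product.\<close>

lemma gtens_mult:
  fixes A A' B B' :: "'a::{finite, ab_group_add} tree set"
  assumes M: "M \<in> mat_hhom h A A'" and N: "N \<in> mat_hhom h B B'" and fin: "finite A'" "finite B'"
  shows "mat_mult (gtens \<delta> h' k' M' N') (gtens \<delta> h k M N) =
    gtens \<delta> (Z2_mult h' h) (\<lambda>a b d. k' (h_simple h a) (h_simple h b) (h_simple h d) * k a b d)
      (mat_mult M' M) (mat_mult N' N)"
proof (intro ext)
  fix u s
  let ?L = "mat_mult (gtens \<delta> h' k' M' N') (gtens \<delta> h k M N) u s"
  let ?k = "\<lambda>a b d. k' (h_simple h a) (h_simple h b) (h_simple h d) * k a b d"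
  let ?R = "gtens \<delta> (Z2_mult h' h) ?k (mat_mult M' M) (mat_mult N' N) u s"
  show "?L = ?R"
  proof (cases "\<exists>a' b' d' a b d. u = Node a' b' d' \<and> s = Node a b d \<and> d \<in> fus \<delta> (lab a) (lab b)")
    case False
    then have "?L = 0"
      unfolding mat_mult_def by (intro sum.neutral) (auto elim!: gtens_nonzeroE simp: gtens_def split: basis_tree.splits)
    moreover have "?R = 0"
      by (rule ccontr, erule gtens_nonzeroE) (use False in auto)
    ultimately show ?thesis by simp
  next
    case True
    then obtain a' b' d' a b d where u: "u = Node a' b' d'" and s: "s = Node a b d"
      and d: "d \<in> fus \<delta> (lab a) (lab b)" by blast
    let ?n = "\<lambda>(a1, b1). Node a1 b1 (h_simple h d)"
    have "?L = (\<Sum>t\<in>?n ` (A' \<times> B'). gtens \<delta> h' k' M' N' u t * gtens \<delta> h k M N t s)"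
    proof (rule mat_mult_sum)
      fix t assume "gtens \<delta> h k M N t s \<noteq> 0"
      then show "t \<in> ?n ` (A' \<times> B')"
        using mat_hhomD[OF M] mat_hhomD[OF N] by (cases rule: gtens_nonzeroE) (auto simp: s image_iff)
    qed (use fin in auto)
    also have "\<dots> = (\<Sum>(a1, b1)\<in>A' \<times> B'. gtens \<delta> h' k' M' N' u (Node a1 b1 (h_simple h d)) *
        gtens \<delta> h k M N (Node a1 b1 (h_simple h d)) s)"
      by (subst sum.reindex) (auto simp: inj_on_def case_prod_unfold)
    also have "\<dots> = (\<Sum>(a1, b1)\<in>A' \<times> B'. (if d' = h_simple (Z2_mult h' h) d then ?k (lab a) (lab b) d else 0) *
        ((M' a' a1 * M a1 a) * (N' b' b1 * N b1 b)))"
    proof (rule sum.cong[OF refl], clarify)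
      fix a1 b1
      show "gtens \<delta> h' k' M' N' u (Node a1 b1 (h_simple h d)) * gtens \<delta> h k M N (Node a1 b1 (h_simple h d)) s =
        (if d' = h_simple (Z2_mult h' h) d then ?k (lab a) (lab b) d else 0) * ((M' a' a1 * M a1 a) * (N' b' b1 * N b1 b))"
        using d mat_hhomD[OF M, of a1 a] mat_hhomD[OF N, of b1 b]
        by (cases "M a1 a = 0 \<or> N b1 b = 0")
          (auto simp: u s h_simple_Z2_mult, (cases h; auto)+)
    qed
    also have "\<dots> = (if d' = h_simple (Z2_mult h' h) d then ?k (lab a) (lab b) d else 0) *
        (mat_mult M' M a' a * mat_mult N' N b' b)"
      unfolding mat_hhom_mult_sum[OF M fin(1)] mat_hhom_mult_sum[OF N fin(2)]
        sum_product sum.cartesian_product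
      by (subst sum_distrib_left) (simp add: case_prod_unfold)
    also have "\<dots> = ?R"
      using d by (simp add: u s)
    finally show ?thesis .
  qed
qed

lemma gtens_cong:
  assumes "\<And>a b d a' b'. d \<in> fus \<delta> (lab a) (lab b) \<Longrightarrow> M a' a \<noteq> 0 \<Longrightarrow> N b' b \<noteq> 0 \<Longrightarrow>
    k (lab a) (lab b) d = k' (lab a) (lab b) d"
  shows "gtens \<delta> h k M N = gtens \<delta> h k' M N"
  using assms by (intro ext) (fastforce simp: gtens_def split: basis_tree.split)

lemma gtens_id: "gtens \<delta> Z2_1 (\<lambda>_ _ _. 1) (mat_id A) (mat_id B) = mat_id (tens \<delta> A B)"
  by (intro ext) (auto simp: gtens_def mat_id_def split: basis_tree.split)

section \<open>The equivariantisation\<close>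

definition gact :: "'a::ab_group_add tree set \<times> 'a mat \<Rightarrow> 'a mat" where
  "gact A = pm (snd A)"

definition eob :: "'a::ab_group_add tree set \<times> 'a mat \<Rightarrow> bool" where
  "eob A \<longleftrightarrow> finite (fst A) \<and> gact A \<in> mat_hhom Z2_g (fst A) (fst A) \<and>
     mat_mult (gact A) (gact A) = mat_id (fst A)"

lemma eobI:
  assumes "finite X" "M \<in> mat_hhom Z2_g X X" "mat_mult M M = mat_id X"
  shows "eob (X, pm M)" "gact (X, pm M) = M"
  using assms by (simp_all add: eob_def gact_def)

lemma eob_finite: "eob A \<Longrightarrow> finite (fst A)"
  by (simp add: eob_def)

lemma gact_in: "eob A \<Longrightarrow> gact A \<in> mat_hhom Z2_g (fst A) (fst A)"
  by (simp add: eob_def)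

lemma gact_gact: "eob A \<Longrightarrow> mat_mult (gact A) (gact A) = mat_id (fst A)"
  by (simp add: eob_def)

lemma gact_colfin: "eob A \<Longrightarrow> colfin (gact A)"
  by (meson eob_finite gact_in mat_hhom_colfin)

definition ehom :: "'a::ab_group_add tree set \<times> 'a mat \<Rightarrow> 'a tree set \<times> 'a mat \<Rightarrow> 'a mat set" where
  "ehom A B = {f \<in> mat_hom (fst A) (fst B). mat_mult f (gact A) = mat_mult (gact B) f}"

lemma ehom_in: "f \<in> ehom A B \<Longrightarrow> f \<in> mat_hom (fst A) (fst B)"
  by (simp add: ehom_def)

lemma ehom_eq: "f \<in> ehom A B \<Longrightarrow> mat_mult f (gact A) = mat_mult (gact B) f"
  by (simp add: ehom_def)

lemma ehom_colfin: "f \<in> ehom A B \<Longrightarrow> eob B \<Longrightarrow> colfin f"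
  by (meson eob_finite ehom_in mat_hom_colfin)

lemma ehom_id: "eob A \<Longrightarrow> mat_id (fst A) \<in> ehom A A"
proof -
  assume A: "eob A"
  have "mat_mult (mat_id (fst A)) (gact A) = gact A"
    using A by (intro mat_id_left gact_colfin) (auto dest: mat_hhomD[OF gact_in])
  moreover have "mat_mult (gact A) (mat_id (fst A)) = gact A"
    using A by (intro mat_id_right) (auto dest: mat_hhomD[OF gact_in])
  ultimately show ?thesis
    by (simp add: ehom_def mat_id_in)
qed

lemma ehom_mult:
  assumes "eob A" "eob B" "eob D" "f \<in> ehom A B" "g \<in> ehom B D"
  shows "mat_mult g f \<in> ehom A D"
proof -
  note cf = gact_colfin[OF assms(1)] gact_colfin[OF assms(2)] gact_colfin[OF assms(3)]
    ehom_colfin[OF assms(4,2)] ehom_colfin[OF assms(5,3)]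
  have "mat_mult (mat_mult g f) (gact A) = mat_mult g (mat_mult (gact B) f)"
    by (simp add: mat_mult_assoc cf ehom_eq[OF assms(4)])
  also have "\<dots> = mat_mult (mat_mult (gact D) g) f"
    by (simp add: mat_mult_assoc[symmetric] cf ehom_eq[OF assms(5)])
  also have "\<dots> = mat_mult (gact D) (mat_mult g f)"
    by (rule mat_mult_assoc) (fact cf)+
  finally show ?thesis
    using assms mat_mult_in[OF ehom_in ehom_in, of f A B g D] by (simp add: ehom_def)
qed

lemma mat_hom_add: "M \<in> mat_hom A B \<Longrightarrow> N \<in> mat_hom A B \<Longrightarrow> (\<lambda>u s. M u s + N u s) \<in> mat_hom A B"
  unfolding mat_hom_def by auto (metis add.right_neutral)+

lemma mat_hom_smult: "M \<in> mat_hom A B \<Longrightarrow> (\<lambda>u s. k * M u s) \<in> mat_hom A B"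
  unfolding mat_hom_def by auto

lemma ehom_add:
  assumes "eob A" "eob B" "f \<in> ehom A B" "g \<in> ehom A B"
  shows "(\<lambda>u s. f u s + g u s) \<in> ehom A B"
proof -
  have "mat_mult (\<lambda>u s. f u s + g u s) (gact A) = mat_mult (gact B) (\<lambda>u s. f u s + g u s)"
    unfolding mat_mult_add_left mat_mult_add_right[OF ehom_colfin[OF assms(3,2)] ehom_colfin[OF assms(4,2)]]
    using assms by (simp add: ehom_eq)
  then show ?thesis
    using assms mat_hom_add[of f "fst A" "fst B" g] by (simp add: ehom_def)
qed

lemma ehom_smult:
  assumes "eob B" "f \<in> ehom A B"
  shows "(\<lambda>u s. k * f u s) \<in> ehom A B"
proof -
  have "mat_mult (\<lambda>u s. k * f u s) (gact A) = mat_mult (gact B) (\<lambda>u s. k * f u s)"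
    unfolding mat_mult_smult_left mat_mult_smult_right[OF ehom_colfin[OF assms(2,1)]]
    using assms by (simp add: ehom_eq)
  then show ?thesis
    using assms mat_hom_smult[of f "fst A" "fst B" k] by (simp add: ehom_def)
qed

lemma ehom_zero: "(\<lambda>u s. 0) \<in> ehom A B"
  by (simp add: ehom_def mat_hom_def mat_mult_def)

section \<open>Rows and columns of tensor products and associators\<close>

lemma colfin_slice: "inj f \<Longrightarrow> colfin N \<Longrightarrow> colfin (\<lambda>y s'. N (f y) s)"
  unfolding colfin_def using finite_vimageI[of "{t. N t s \<noteq> 0}" f] by (simp add: vimage_def)

text \<open>Reduces a factor acting on the second leg to that factor alone. The slice of N fixes the
  first leg, the summand and the column s; its own column argument s' is a dummy. Row formulas for
  associators and braidings thereby become usable inside a tensor factor.\<close>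

lemma tens_id_row_left:
  assumes M: "M \<in> mat_hom Y X" and a: "a \<in> A" and d: "d \<in> fus \<delta> (lab a) (lab x)" and N: "colfin N"
  shows "mat_mult (mat_tens \<delta> (mat_id A) M) N (Node a x d) s = mat_mult M (\<lambda>y s'. N (Node a y d) s) x s"
proof -
  have e: "mat_tens \<delta> (mat_id A) M (Node a x d) (Node a y d) = M x y" for y
    using a d mat_homD[OF M, of x y] by (cases "M x y = 0") (simp_all add: mat_tens_eq_gtens mat_id_def)
  have "mat_mult M (\<lambda>y s'. N (Node a y d) s) x s = (\<Sum>y | N (Node a y d) s \<noteq> 0. M x y * N (Node a y d) s)"
    by (simp add: mat_mult_def)
  also have "\<dots> = (\<Sum>t\<in>(\<lambda>y. Node a y d) ` {y. N (Node a y d) s \<noteq> 0}. mat_tens \<delta> (mat_id A) M (Node a x d) t * N t s)"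
    by (subst sum.reindex) (simp_all add: inj_on_def e)
  also have "\<dots> = mat_mult (mat_tens \<delta> (mat_id A) M) N (Node a x d) s"
    unfolding mat_mult_def using N
    by (intro sum.mono_neutral_left)
      (auto simp: colfin_def mat_tens_eq_gtens gtens_def mat_id_def split: if_splits basis_tree.splits)
  finally show ?thesis ..
qed

lemma tens_id_row_right:
  assumes M: "M \<in> mat_hom Y X" and b: "b \<in> B" and d: "d \<in> fus \<delta> (lab x) (lab b)" and N: "colfin N"
  shows "mat_mult (mat_tens \<delta> M (mat_id B)) N (Node x b d) s = mat_mult M (\<lambda>y s'. N (Node y b d) s) x s"
proof -
  have e: "mat_tens \<delta> M (mat_id B) (Node x b d) (Node y b d) = M x y" for y
    using b d mat_homD[OF M, of x y] by (cases "M x y = 0") (simp_all add: mat_tens_eq_gtens mat_id_def)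
  have "mat_mult M (\<lambda>y s'. N (Node y b d) s) x s = (\<Sum>y | N (Node y b d) s \<noteq> 0. M x y * N (Node y b d) s)"
    by (simp add: mat_mult_def)
  also have "\<dots> = (\<Sum>t\<in>(\<lambda>y. Node y b d) ` {y. N (Node y b d) s \<noteq> 0}. mat_tens \<delta> M (mat_id B) (Node x b d) t * N t s)"
    by (subst sum.reindex) (simp_all add: inj_on_def e)
  also have "\<dots> = mat_mult (mat_tens \<delta> M (mat_id B)) N (Node x b d) s"
    unfolding mat_mult_def using N
    by (intro sum.mono_neutral_left)
      (auto simp: colfin_def mat_tens_eq_gtens gtens_def mat_id_def split: if_splits basis_tree.splits)
  finally show ?thesis ..
qed

type_synonym 'a sixj = "'a simple \<Rightarrow> 'a simple \<Rightarrow> 'a simple \<Rightarrow> 'a simple \<Rightarrow> 'a simple \<Rightarrow> 'a simple \<Rightarrow> complex"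

text \<open>Separates the tree bookkeeping from the symbol. Admissibility is left to K, and the
  transpose \<open>aimat\<close> with the symbol \<open>Fi\<close> gives the inverse
  associator.\<close>

definition amat :: "'a sixj \<Rightarrow> 'a tree set \<Rightarrow> 'a tree set \<Rightarrow> 'a tree set \<Rightarrow> 'a mat" where
  "amat K A B C = (\<lambda>u s. case (s, u) of
     (Node (Node a b e) c d, Node a' (Node b' c' f) d') \<Rightarrow>
       if a' = a \<and> b' = b \<and> c' = c \<and> d' = d \<and> a \<in> A \<and> b \<in> B \<and> c \<in> C
       then K (lab a) (lab b) (lab c) e f d else 0
   | _ \<Rightarrow> 0)"

definition aimat :: "'a sixj \<Rightarrow> 'a tree set \<Rightarrow> 'a tree set \<Rightarrow> 'a tree set \<Rightarrow> 'a mat" where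
  "aimat K A B C = (\<lambda>u s. amat K A B C s u)"

lemma amat_Node:
  "amat K A B C (Node a' (Node b' c' f) d') (Node (Node a b e) c d) =
    (if a' = a \<and> b' = b \<and> c' = c \<and> d' = d \<and> a \<in> A \<and> b \<in> B \<and> c \<in> C
     then K (lab a) (lab b) (lab c) e f d else 0)"
  by (simp add: amat_def)

lemma amat_nonzeroE:
  assumes "amat K A B C u s \<noteq> 0"
  obtains a b c d e f where "s = Node (Node a b e) c d" "u = Node a (Node b c f) d"
    "a \<in> A" "b \<in> B" "c \<in> C" "K (lab a) (lab b) (lab c) e f d \<noteq> 0"
  using assms by (auto simp: amat_def split: basis_tree.splits if_splits)

lemma amat_row:
  fixes K :: "'a::{finite, ab_group_add} sixj"
  assumes "a \<in> A" "b \<in> B" "c \<in> C" "colfin N"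
  shows "mat_mult (amat K A B C) N (Node a (Node b c f) d) s =
    (\<Sum>e\<in>UNIV. K (lab a) (lab b) (lab c) e f d * N (Node (Node a b e) c d) s)"
proof -
  have "mat_mult (amat K A B C) N (Node a (Node b c f) d) s =
      (\<Sum>t\<in>range (\<lambda>e. Node (Node a b e) c d). amat K A B C (Node a (Node b c f) d) t * N t s)"
    using assms by (intro mat_mult_sum_row) (auto elim: amat_nonzeroE)
  also have "\<dots> = (\<Sum>e\<in>UNIV. K (lab a) (lab b) (lab c) e f d * N (Node (Node a b e) c d) s)"
    using assms by (subst sum.reindex) (auto simp: inj_on_def amat_Node)
  finally show ?thesis .
qed

lemma amat_col:
  fixes K :: "'a::{finite, ab_group_add} sixj"
  assumes "a \<in> A" "b \<in> B" "c \<in> C"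
  shows "mat_mult N (amat K A B C) u (Node (Node a b e) c d) =
    (\<Sum>f\<in>UNIV. N u (Node a (Node b c f) d) * K (lab a) (lab b) (lab c) e f d)"
proof -
  have "mat_mult N (amat K A B C) u (Node (Node a b e) c d) =
      (\<Sum>t\<in>range (\<lambda>f. Node a (Node b c f) d). N u t * amat K A B C t (Node (Node a b e) c d))"
    using assms by (intro mat_mult_sum) (auto elim: amat_nonzeroE)
  also have "\<dots> = (\<Sum>f\<in>UNIV. N u (Node a (Node b c f) d) * K (lab a) (lab b) (lab c) e f d)"
    using assms by (subst sum.reindex) (auto simp: inj_on_def amat_Node)
  finally show ?thesis .
qed

lemma aimat_row:
  fixes K :: "'a::{finite, ab_group_add} sixj"
  assumes "a \<in> A" "b \<in> B" "c \<in> C" "colfin N"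
  shows "mat_mult (aimat K A B C) N (Node (Node a b e) c d) s =
    (\<Sum>f\<in>UNIV. K (lab a) (lab b) (lab c) e f d * N (Node a (Node b c f) d) s)"
proof -
  have "mat_mult (aimat K A B C) N (Node (Node a b e) c d) s =
      (\<Sum>t\<in>range (\<lambda>f. Node a (Node b c f) d). aimat K A B C (Node (Node a b e) c d) t * N t s)"
    using assms by (intro mat_mult_sum_row) (auto simp: aimat_def elim: amat_nonzeroE)
  also have "\<dots> = (\<Sum>f\<in>UNIV. K (lab a) (lab b) (lab c) e f d * N (Node a (Node b c f) d) s)"
    using assms by (subst sum.reindex) (auto simp: inj_on_def amat_Node aimat_def)
  finally show ?thesis .
qed

lemma aimat_col:
  fixes K :: "'a::{finite, ab_group_add} sixj"
  assumes "a \<in> A" "b \<in> B" "c \<in> C"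
  shows "mat_mult N (aimat K A B C) u (Node a (Node b c f) d) =
    (\<Sum>e\<in>UNIV. N u (Node (Node a b e) c d) * K (lab a) (lab b) (lab c) e f d)"
proof -
  have "mat_mult N (aimat K A B C) u (Node a (Node b c f) d) =
      (\<Sum>t\<in>range (\<lambda>e. Node (Node a b e) c d). N u t * aimat K A B C t (Node a (Node b c f) d))"
    using assms by (intro mat_mult_sum) (auto simp: aimat_def elim: amat_nonzeroE)
  also have "\<dots> = (\<Sum>e\<in>UNIV. N u (Node (Node a b e) c d) * K (lab a) (lab b) (lab c) e f d)"
    using assms by (subst sum.reindex) (auto simp: inj_on_def amat_Node aimat_def)
  finally show ?thesis .
qed

context crossed_data
begin

section \<open>The equivariantisation in matrix form\<close>

abbreviation E where "E \<equiv> equivariantisation (crossed_category \<sigma> \<omega> \<delta> \<epsilon> q \<alpha> \<beta>)"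

text \<open>The structure morphism is invertible as soon as its composite with its g-image is the
  identity: applying g to that equation shows that the g-image is also a left inverse.\<close>

lemma Obj_E: "A \<in> Obj E \<longleftrightarrow> eob A"
proof -
  obtain X \<phi> where A: "A = (X, \<phi>)"
    by (cases A)
  have sq: "mat_mult \<phi> (h_mat Z2_g \<phi>) = mat_mult (gact (X, \<phi>)) (gact (X, \<phi>))"
    by (simp add: gact_def mult_h_mat pm_mult)
  have inv: "\<exists>f'. f' \<in> mat_hom X (g_tree ` X) \<and> mat_mult f' \<phi> = mat_id (g_tree ` X) \<and> mat_mult \<phi> f' = mat_id X"
    if "\<phi> \<in> mat_hom (g_tree ` X) X" "mat_mult \<phi> (h_mat Z2_g \<phi>) = mat_id X"
  proof (intro exI conjI)
    show "h_mat Z2_g \<phi> \<in> mat_hom X (g_tree ` X)"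
      using h_mat_in[OF that(1)] by (simp add: image_image)
    show "mat_mult (h_mat Z2_g \<phi>) \<phi> = mat_id (g_tree ` X)"
      using arg_cong[OF that(2), of "h_mat Z2_g"] by (simp add: h_mat_mult h_mat_id)
  qed (fact that)
  show ?thesis
    using inv unfolding A eob_def sq[symmetric]
    by (auto simp: equivariantisation_def crossed_category_def is_iso_def inverse_mor_def gact_def pm_in_hhom)
qed

lemma Hom_E: "Hom E A B = ehom A B"
proof -
  have "mat_mult f \<phi> = mat_mult \<psi> (h_mat Z2_g f) \<longleftrightarrow> mat_mult f (pm \<phi>) = mat_mult (pm \<psi>) f"
    for f \<phi> \<psi> :: "'a mat"
    by (simp add: mult_h_mat pm_mult) (metis pm_pm)
  then show ?thesis
    by (cases A; cases B) (simp add: equivariantisation_def crossed_category_def ehom_def gact_def)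
qed

lemma E_simps:
  "idm E A = mat_id (fst A)" "comp E = mat_mult" "zero E = (\<lambda>u s. 0)"
  "add E = (\<lambda>M N u s. M u s + N u s)" "smult E = (\<lambda>k M u s. k * M u s)"
  "tobj E A B = (tens \<delta> (fst A) (fst B), mat_mult (mat_tens \<delta> (snd A) (snd B)) (mat_tau \<omega> \<delta> (fst A) (fst B)))"
  "tmor E = mat_tens \<delta>" "unit E = (unit_obj, mat_id unit_obj)"
  "assoc E A B D = mat_assoc \<sigma> \<omega> \<delta> \<epsilon> (fst A) (fst B) (fst D)"
  "lunit E A = mat_lunit (fst A)" "runit E A = mat_runit (fst A)"
  by (simp_all add: equivariantisation_def crossed_category_def case_prod_unfold)

lemma mat_assoc_F: "mat_assoc \<sigma> \<omega> \<delta> \<epsilon> A B C = amat F A B C"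
  by (intro ext) (auto simp: mat_assoc_def amat_def F_def split: basis_tree.split)

lemma gact_tens: "gact (tobj E A B) = gtens \<delta> Z2_g \<tau> (gact A) (gact B)" if "eob A" "eob B"
proof (intro ext)
  fix u v
  let ?\<tau> = "mat_tau \<omega> \<delta> (fst A) (fst B)"
  have "gact (tobj E A B) u v = mat_mult (mat_tens \<delta> (snd A) (snd B)) ?\<tau> u (g_tree v)"
    by (simp add: gact_def pm_def E_simps)
  \<comment> \<open>The tensor structure is diagonal. Its entry at \<open>g_tree v\<close> is the
    symbol at v, since applying \<open>g_tree\<close> twice is the identity; hence \<tau> is read at
    the unshifted labels.\<close>
  also have "\<dots> = mat_tens \<delta> (snd A) (snd B) u (g_tree v) * ?\<tau> (g_tree v) (g_tree v)"
    by (rule mat_mult_single) (auto simp: mat_tau_def colfin_def split: if_splits)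
  also have "\<dots> = gtens \<delta> Z2_g \<tau> (gact A) (gact B) u v"
    using mat_hhomD[OF gact_in[OF that(1)]] mat_hhomD[OF gact_in[OF that(2)]]
    by (cases v; cases u) (auto simp: mat_tau_def mat_tens_eq_gtens gtens_def gact_def pm_def)
  finally show "gact (tobj E A B) u v = gtens \<delta> Z2_g \<tau> (gact A) (gact B) u v" .
qed

lemma fst_tobj: "fst (tobj E A B) = tens \<delta> (fst A) (fst B)"
  by (simp add: E_simps)

text \<open>Squaring the action multiplies the tensor structure signs at a label triple and at its
  g-image, and by \<open>\<tau>_square\<close> these cancel.\<close>

lemma eob_tobj: "eob (tobj E A B)" if A: "eob A" and B: "eob B"
proof -
  have "gact (tobj E A B) \<in> mat_hhom Z2_g (tens \<delta> (fst A) (fst B)) (tens \<delta> (fst A) (fst B))"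
    unfolding gact_tens[OF that] using that by (intro gtens_in gact_in)
  moreover have "mat_mult (gact (tobj E A B)) (gact (tobj E A B)) = mat_id (tens \<delta> (fst A) (fst B))"
    unfolding gact_tens[OF that] gtens_mult[OF gact_in[OF A] gact_in[OF B] eob_finite[OF A] eob_finite[OF B]]
      gact_gact[OF A] gact_gact[OF B] gtens_id[symmetric]
    by (simp, rule gtens_cong) (simp add: \<tau>_square)
  ultimately show ?thesis
    using that by (simp add: eob_def fst_tobj finite_tens)
qed

lemma ehom_tens:
  assumes ob: "eob A" "eob A'" "eob B" "eob B'" and f: "f \<in> ehom A A'" and g: "g \<in> ehom B B'"
  shows "mat_tens \<delta> f g \<in> ehom (tobj E A B) (tobj E A' B')"
proof -
  have in': "f \<in> mat_hhom Z2_1 (fst A) (fst A')" "g \<in> mat_hhom Z2_1 (fst B) (fst B')"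
    using f g by (simp_all add: mat_hhom_1 ehom_in)
  have "mat_mult (mat_tens \<delta> f g) (gact (tobj E A B)) = mat_mult (gact (tobj E A' B')) (mat_tens \<delta> f g)"
    unfolding gact_tens[OF ob(1,3)] gact_tens[OF ob(2,4)] mat_tens_eq_gtens
    by (simp add: gtens_mult[OF gact_in gact_in] gtens_mult[OF in'] ob eob_finite ehom_eq[OF f] ehom_eq[OF g])
  moreover have "mat_tens \<delta> f g \<in> mat_hom (tens \<delta> (fst A) (fst B)) (tens \<delta> (fst A') (fst B'))"
    using gtens_in[OF in'] by (simp add: mat_hhom_1 mat_tens_eq_gtens)
  ultimately show ?thesis
    by (simp add: ehom_def fst_tobj)
qed

lemma unit_ob: "eob (unit E)" "gact (unit E) = mat_id unit_obj" "fst (unit E) = unit_obj"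
proof -
  have *: "pm (mat_id unit_obj) = mat_id (unit_obj :: 'a tree set)"
  proof (intro ext)
    fix u s :: "'a tree"
    have "g_tree s = Leaf 0 (Vec 0) \<longleftrightarrow> s = Leaf 0 (Vec 0)"
      by (metis g_tree.simps(1) g_tree_g_tree g_simple.simps(1) minus_zero)
    then show "pm (mat_id unit_obj) u s = mat_id unit_obj u s"
      by (auto simp: pm_def mat_id_def unit_obj_def)
  qed
  show "gact (unit E) = mat_id unit_obj" "fst (unit E) = unit_obj"
    by (simp_all add: E_simps gact_def *)
  moreover have "mat_id unit_obj \<in> mat_hhom Z2_g unit_obj (unit_obj :: 'a tree set)"
    by (auto simp: mat_id_def mat_hhom_def unit_obj_def split: if_splits)
  moreover have "mat_mult (mat_id unit_obj) (mat_id unit_obj) = mat_id (unit_obj :: 'a tree set)"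
    by (rule mat_id_right) (auto simp: mat_id_def split: if_splits)
  ultimately show "eob (unit E)"
    by (simp add: eob_def unit_obj_def)
qed

end

section \<open>The monoidal structure\<close>

lemma fus_Vec_0 [simp]: "fus \<delta> (Vec 0) l = {l}" "fus \<delta> l (Vec 0) = {l}"
  by (cases l; simp add: cls_zero)+

lemma unit_obj_iff: "t \<in> unit_obj \<longleftrightarrow> t = Leaf 0 (Vec 0)"
  by (simp add: unit_obj_def)

text \<open>Inverses of equivariant matrices are equivariant, by conjugating the commutation
  relation. Hence isomorphisms only need an inverse among plain matrices.\<close>

lemma inverse_ehom:
  assumes "eob A" "eob B" and f: "f \<in> ehom A B" and f': "f' \<in> mat_hom (fst B) (fst A)"
    and l: "mat_mult f' f = mat_id (fst A)" and r: "mat_mult f f' = mat_id (fst B)"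
  shows "f' \<in> ehom B A"
proof -
  note cf = gact_colfin[OF assms(1)] gact_colfin[OF assms(2)] ehom_colfin[OF f assms(2)]
    mat_hom_colfin[OF f' eob_finite[OF assms(1)]]
  have "mat_mult f' (gact B) = mat_mult (mat_mult f' (gact B)) (mat_mult f f')"
    unfolding r by (rule mat_id_right[symmetric])
      (auto elim!: mat_mult_nonzeroE dest: mat_hhomD[OF gact_in[OF assms(2)]])
  also have "\<dots> = mat_mult (mat_mult f' (mat_mult (gact B) f)) f'"
    by (simp add: mat_mult_assoc cf colfin_mult)
  also have "\<dots> = mat_mult (mat_mult (mat_mult f' f) (gact A)) f'"
    by (simp add: mat_mult_assoc cf colfin_mult ehom_eq[OF f, symmetric])
  also have "\<dots> = mat_mult (gact A) f'"
    unfolding l by (subst mat_id_left) (auto simp: cf dest: mat_hhomD[OF gact_in[OF assms(1)]])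
  finally show ?thesis
    using f' by (simp add: ehom_def)
qed

lemma aimat_Node:
  "aimat K A B C (Node (Node a b e) c d) (Node a' (Node b' c' f) d') =
    (if a' = a \<and> b' = b \<and> c' = c \<and> d' = d \<and> a \<in> A \<and> b \<in> B \<and> c \<in> C
     then K (lab a) (lab b) (lab c) e f d else 0)"
  by (simp add: aimat_def amat_Node)

context crossed_data
begin

lemma mat_tens_Node [simp]:
  "mat_tens \<delta> M N (Node a' b' d') (Node a b d) =
    (if d' = d \<and> d \<in> fus \<delta> (lab a) (lab b) then M a' a * N b' b else 0)"
  by (simp add: mat_tens_eq_gtens)

lemma is_iso_E:
  assumes "eob A" "eob B" "f \<in> ehom A B" "f' \<in> mat_hom (fst B) (fst A)"
    "mat_mult f' f = mat_id (fst A)" "mat_mult f f' = mat_id (fst B)"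
  shows "inverse_mor E A B f f'" "is_iso E A B f"
proof -
  show "inverse_mor E A B f f'"
    using inverse_ehom[OF assms] assms by (simp add: inverse_mor_def Hom_E E_simps)
  then show "is_iso E A B f"
    using assms by (auto simp: is_iso_def Hom_E)
qed

lemma linear: "linear_category E"
proof
  show "add E (zero E) f = f" for f
    by (simp add: E_simps)
qed (auto simp: Obj_E Hom_E E_simps ehom_id ehom_add ehom_smult ehom_zero algebra_simps
    mat_mult_add_left mat_mult_smult_left fun_eq_iff
    mat_mult_add_right[OF ehom_colfin ehom_colfin] mat_mult_smult_right[OF ehom_colfin]
    mat_mult_assoc[OF ehom_colfin ehom_colfin]
    intro: ehom_mult intro!: mat_id_right[THEN fun_cong, THEN fun_cong] mat_id_left[THEN fun_cong, THEN fun_cong]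
    elim: ehom_colfin dest: mat_homD[OF ehom_in])

section \<open>The associator and the pentagon\<close>

lemma amat_F_in: "amat F A B C \<in> mat_hom (tens \<delta> (tens \<delta> A B) C) (tens \<delta> A (tens \<delta> B C))"
  by (rule mat_homI) (auto elim!: amat_nonzeroE simp: F_def split: if_splits)

lemma aimat_Fi_in: "aimat Fi A B C \<in> mat_hom (tens \<delta> A (tens \<delta> B C)) (tens \<delta> (tens \<delta> A B) C)"
  by (rule mat_homI) (auto elim!: amat_nonzeroE simp: Fi_def aimat_def split: if_splits)

lemma amat_colfin: "finite A \<Longrightarrow> finite B \<Longrightarrow> finite C \<Longrightarrow> colfin (amat F A B C)"
  by (rule mat_hom_colfin[OF amat_F_in]) (simp add: finite_tens)

lemma aimat_colfin: "finite A \<Longrightarrow> finite B \<Longrightarrow> finite C \<Longrightarrow> colfin (aimat Fi A B C)"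
  by (rule mat_hom_colfin[OF aimat_Fi_in]) (simp add: finite_tens)

lemma aimat_amat:
  assumes fin: "finite A" "finite B" "finite C"
  shows "mat_mult (aimat Fi A B C) (amat F A B C) = mat_id (tens \<delta> (tens \<delta> A B) C)"
proof (rule mat_hom_eqI[OF mat_mult_in[OF amat_F_in aimat_Fi_in] mat_id_in])
  fix u s
  assume "u \<in> tens \<delta> (tens \<delta> A B) C" "s \<in> tens \<delta> (tens \<delta> A B) C"
  then obtain a b c e d a' b' c' e' d' where *: "u = Node (Node a' b' e') c' d'" "s = Node (Node a b e) c d"
    "a \<in> A" "b \<in> B" "c \<in> C" "e \<in> fus \<delta> (lab a) (lab b)" "d \<in> fus \<delta> e (lab c)"
    "a' \<in> A" "b' \<in> B" "c' \<in> C" "e' \<in> fus \<delta> (lab a') (lab b')" "d' \<in> fus \<delta> e' (lab c')"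
    by (elim tensE) auto
  show "mat_mult (aimat Fi A B C) (amat F A B C) u s = mat_id (tens \<delta> (tens \<delta> A B) C) u s"
    using * Fi_F_sum[of e "lab a" "lab b" d "lab c" e']
    by (cases "a' = a \<and> b' = b \<and> c' = c \<and> d' = d")
      (auto simp: aimat_row[OF _ _ _ amat_colfin] fin amat_Node mat_id_def)
qed

lemma amat_aimat:
  assumes fin: "finite A" "finite B" "finite C"
  shows "mat_mult (amat F A B C) (aimat Fi A B C) = mat_id (tens \<delta> A (tens \<delta> B C))"
proof (rule mat_hom_eqI[OF mat_mult_in[OF aimat_Fi_in amat_F_in] mat_id_in])
  fix u s
  assume "u \<in> tens \<delta> A (tens \<delta> B C)" "s \<in> tens \<delta> A (tens \<delta> B C)"
  then obtain a b c e d a' b' c' e' d' where *: "u = Node a' (Node b' c' e') d'" "s = Node a (Node b c e) d"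
    "a \<in> A" "b \<in> B" "c \<in> C" "e \<in> fus \<delta> (lab b) (lab c)" "d \<in> fus \<delta> (lab a) e"
    "a' \<in> A" "b' \<in> B" "c' \<in> C" "e' \<in> fus \<delta> (lab b') (lab c')" "d' \<in> fus \<delta> (lab a') e'"
    by (elim tensE) auto
  show "mat_mult (amat F A B C) (aimat Fi A B C) u s = mat_id (tens \<delta> A (tens \<delta> B C)) u s"
    using * F_Fi_sum[of e' "lab b" "lab c" d "lab a" e]
    by (cases "a' = a \<and> b' = b \<and> c' = c \<and> d' = d")
      (auto simp: amat_row[OF _ _ _ aimat_colfin] fin aimat_Node mat_id_def)
qed

text \<open>Each side has a single surviving channel: the g-image of e when g acts first, and the
  g-image of f' when the associator acts first. Comparing the two entries is the symbol identity
  \<open>F_g\<close>.\<close>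

lemma ehom_assoc:
  assumes A: "eob A" and B: "eob B" and D: "eob D"
  shows "amat F (fst A) (fst B) (fst D) \<in> ehom (tobj E (tobj E A B) D) (tobj E A (tobj E B D))"
proof -
  let ?S = "tobj E (tobj E A B) D" and ?T = "tobj E A (tobj E B D)"
  let ?a = "amat F (fst A) (fst B) (fst D)"
  note ob = assms eob_tobj[OF A B] eob_tobj[OF B D] eob_tobj[OF eob_tobj[OF A B] D] eob_tobj[OF A eob_tobj[OF B D]]
  have a_in: "?a \<in> mat_hom (fst ?S) (fst ?T)"
    by (simp add: fst_tobj amat_F_in)
  have "mat_mult ?a (gact ?S) \<in> mat_hhom Z2_g (fst ?S) (fst ?T)"
    using mat_hhom_mult[OF gact_in[OF ob(6)] a_in[folded mat_hhom_1]] by simp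
  moreover have "mat_mult (gact ?T) ?a \<in> mat_hhom Z2_g (fst ?S) (fst ?T)"
    using mat_hhom_mult[OF a_in[folded mat_hhom_1] gact_in[OF ob(7)]] by simp
  ultimately have "mat_mult ?a (gact ?S) = mat_mult (gact ?T) ?a"
  proof (rule mat_hhom_eqI)
    fix u s
    assume "u \<in> fst ?T" "s \<in> fst ?S"
    then obtain a b c e d a' b' c' f' d' where *: "u = Node a' (Node b' c' f') d'" "s = Node (Node a b e) c d"
      "a \<in> fst A" "b \<in> fst B" "c \<in> fst D" "e \<in> fus \<delta> (lab a) (lab b)" "d \<in> fus \<delta> e (lab c)"
      "a' \<in> fst A" "b' \<in> fst B" "c' \<in> fst D" "f' \<in> fus \<delta> (lab b') (lab c')" "d' \<in> fus \<delta> (lab a') f'"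
      unfolding fst_tobj by (elim tensE) auto
    let ?p = "gact A a' a * gact B b' b * gact D c' c"
    have "mat_mult ?a (gact ?S) u s = (\<Sum>x\<in>UNIV. F (lab a') (lab b') (lab c') x f' d' * gact ?S (Node (Node a' b' x) c' d') s)"
      using * by (simp add: amat_row gact_colfin[OF ob(6)])
    also have "\<dots> = F (lab a') (lab b') (lab c') (g_simple e) f' d' * gact ?S (Node (Node a' b' (g_simple e)) c' d') s"
      by (rule sum_unique) (simp add: gact_tens ob *)
    also have "\<dots> = (if d' = g_simple d then F (lab a') (lab b') (lab c') (g_simple e) f' d' *
        (\<tau> (lab a) (lab b) e * \<tau> e (lab c) d) * ?p else 0)"
      by (simp add: gact_tens ob *)
    \<comment> \<open>If the product of action entries is non-zero, the primed labels are the
      g-images of the unprimed ones, which is the situation of \<open>F_g\<close>.\<close>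
    also have "\<dots> = (if d' = g_simple d then F (lab a) (lab b) (lab c) e (g_simple f') d *
        (\<tau> (lab b) (lab c) (g_simple f') * \<tau> (lab a) (g_simple f') d) * ?p else 0)"
    proof (cases "d' = g_simple d \<and> ?p \<noteq> 0")
      case True
      then have l: "lab a' = g_simple (lab a)" "lab b' = g_simple (lab b)" "lab c' = g_simple (lab c)"
        using mat_hhomD[OF gact_in[OF A]] mat_hhomD[OF gact_in[OF B]] mat_hhomD[OF gact_in[OF D]] by force+
      have "f' = g_simple (g_simple f')"
        by simp
      then have "g_simple f' \<in> fus \<delta> (lab b) (lab c)" "d \<in> fus \<delta> (lab a) (g_simple f')"
        using * True l g_simple_fus by metis+
      then show ?thesis
        using F_g[of e "lab a" "lab b" d "lab c" "g_simple f'"] * True by (simp add: l mult_ac)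
    qed auto
    also have "\<dots> = gact ?T u (Node a (Node b c (g_simple f')) d) * F (lab a) (lab b) (lab c) e (g_simple f') d"
      by (auto simp add: gact_tens ob * F_def)
    also have "\<dots> = (\<Sum>x\<in>UNIV. gact ?T u (Node a (Node b c x) d) * F (lab a) (lab b) (lab c) e x d)"
      by (rule sum_unique[symmetric]) (auto simp: gact_tens ob *)
    also have "\<dots> = mat_mult (gact ?T) ?a u s"
      using * by (simp add: amat_col)
    finally show "mat_mult ?a (gact ?S) u s = mat_mult (gact ?T) ?a u s" .
  qed
  then show ?thesis
    using a_in by (simp add: ehom_def)
qed

lemma assoc_iso_E:
  assumes "eob A" "eob B" "eob D"
  shows "inverse_mor E (tobj E (tobj E A B) D) (tobj E A (tobj E B D)) (assoc E A B D) (aimat Fi (fst A) (fst B) (fst D))"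
    "is_iso E (tobj E (tobj E A B) D) (tobj E A (tobj E B D)) (assoc E A B D)"
proof -
  have "assoc E A B D \<in> ehom (tobj E (tobj E A B) D) (tobj E A (tobj E B D))"
    by (simp add: E_simps(9) mat_assoc_F ehom_assoc[OF assms])
  from is_iso_E[OF _ _ this, of "aimat Fi (fst A) (fst B) (fst D)"]
  show "inverse_mor E (tobj E (tobj E A B) D) (tobj E A (tobj E B D)) (assoc E A B D) (aimat Fi (fst A) (fst B) (fst D))"
    "is_iso E (tobj E (tobj E A B) D) (tobj E A (tobj E B D)) (assoc E A B D)"
    using assms
    by (simp_all add: E_simps(9) mat_assoc_F eob_tobj aimat_Fi_in fst_tobj aimat_amat amat_aimat eob_finite)
qed

lemma inv_mor_E:
  assumes "eob A" "eob B" "f \<in> ehom A B" "inverse_mor E A B f f'"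
  shows "inv_mor E A B f = f'"
  unfolding inv_mor_def
proof (rule the_equality)
  fix f'' assume "inverse_mor E A B f f''"
  then have f'': "f'' \<in> ehom B A" "mat_mult f'' f = mat_id (fst A)"
    by (simp_all add: inverse_mor_def Hom_E E_simps)
  have f': "f' \<in> ehom B A" "mat_mult f f' = mat_id (fst B)"
    using assms by (simp_all add: inverse_mor_def Hom_E E_simps)
  have "f'' = mat_mult f'' (mat_mult f f')"
    unfolding f' using mat_homD[OF ehom_in[OF f''(1)]] by (intro mat_id_right[symmetric]) auto
  also have "\<dots> = mat_mult (mat_mult f'' f) f'"
    using assms f' by (intro mat_mult_assoc[symmetric]) (auto intro: ehom_colfin)
  also have "\<dots> = f'"
    unfolding f'' using assms mat_homD[OF ehom_in[OF f'(1)]] ehom_colfin[OF f'(1)] by (intro mat_id_left) auto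
  finally show "f'' = f'" .
qed (fact assms)

lemma assoc_inv_E:
  assumes "eob A" "eob B" "eob D"
  shows "assoc_inv E A B D = aimat Fi (fst A) (fst B) (fst D)"
  unfolding assoc_inv_def using assms assoc_iso_E[OF assms]
  by (intro inv_mor_E) (auto simp: eob_tobj is_iso_def Hom_E)

lemma assoc_natural_E:
  assumes ob: "eob A" "eob A'" "eob B" "eob B'" "eob D" "eob D'"
    and f: "f \<in> ehom A A'" and g: "g \<in> ehom B B'" and h: "h \<in> ehom D D'"
  shows "mat_mult (amat F (fst A') (fst B') (fst D')) (mat_tens \<delta> (mat_tens \<delta> f g) h) =
    mat_mult (mat_tens \<delta> f (mat_tens \<delta> g h)) (amat F (fst A) (fst B) (fst D))" (is "?L = ?R")
proof -
  note t1 = ehom_tens[OF eob_tobj[OF ob(1,3)] eob_tobj[OF ob(2,4)] ob(5,6) ehom_tens[OF ob(1-4) f g] h]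
  note t2 = ehom_tens[OF ob(1,2) eob_tobj[OF ob(3,5)] eob_tobj[OF ob(4,6)] f ehom_tens[OF ob(3-6) g h]]
  have "?L \<in> mat_hom (tens \<delta> (tens \<delta> (fst A) (fst B)) (fst D)) (tens \<delta> (fst A') (tens \<delta> (fst B') (fst D')))"
    using mat_mult_in[OF ehom_in[OF t1]] amat_F_in by (simp add: fst_tobj)
  moreover have "?R \<in> mat_hom (tens \<delta> (tens \<delta> (fst A) (fst B)) (fst D)) (tens \<delta> (fst A') (tens \<delta> (fst B') (fst D')))"
    using ehom_in[OF t2] by (intro mat_mult_in[OF amat_F_in]) (simp add: fst_tobj)
  ultimately show ?thesis
  proof (rule mat_hom_eqI)
    fix u s
    assume "u \<in> tens \<delta> (fst A') (tens \<delta> (fst B') (fst D'))" "s \<in> tens \<delta> (tens \<delta> (fst A) (fst B)) (fst D)"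
    then obtain a b c e d a' b' c' f' d' where *: "u = Node a' (Node b' c' f') d'" "s = Node (Node a b e) c d"
      "a \<in> fst A" "b \<in> fst B" "c \<in> fst D" "e \<in> fus \<delta> (lab a) (lab b)" "d \<in> fus \<delta> e (lab c)"
      "a' \<in> fst A'" "b' \<in> fst B'" "c' \<in> fst D'" "f' \<in> fus \<delta> (lab b') (lab c')" "d' \<in> fus \<delta> (lab a') f'"
      by (elim tensE) auto
    let ?p = "f a' a * g b' b * h c' c"
    have "?L u s = (\<Sum>x\<in>UNIV. F (lab a') (lab b') (lab c') x f' d' * mat_tens \<delta> (mat_tens \<delta> f g) h (Node (Node a' b' x) c' d') s)"
      using * by (simp add: amat_row ehom_colfin[OF t1] eob_tobj ob)
    also have "\<dots> = F (lab a') (lab b') (lab c') e f' d' * mat_tens \<delta> (mat_tens \<delta> f g) h (Node (Node a' b' e) c' d') s"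
      by (rule sum_unique) (simp add: *)
    also have "\<dots> = mat_tens \<delta> f (mat_tens \<delta> g h) u (Node a (Node b c f') d) * F (lab a) (lab b) (lab c) e f' d"
    proof (cases "d' = d \<and> ?p \<noteq> 0")
      case True
      then have l: "lab a' = lab a" "lab b' = lab b" "lab c' = lab c"
        using mat_homD[OF ehom_in[OF f]] mat_homD[OF ehom_in[OF g]] mat_homD[OF ehom_in[OF h]] by force+
      then show ?thesis
        using * True by simp
    qed (auto simp: *)
    also have "\<dots> = (\<Sum>x\<in>UNIV. mat_tens \<delta> f (mat_tens \<delta> g h) u (Node a (Node b c x) d) * F (lab a) (lab b) (lab c) e x d)"
      by (rule sum_unique[symmetric]) (auto simp: *)
    also have "\<dots> = ?R u s"
      using * by (simp add: amat_col)
    finally show "?L u s = ?R u s" .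
  qed
qed

text \<open>All matrices involved fix the four outer basis vectors and the total label, so the
  equation reduces entrywise to \<open>pentagon_sym\<close>; the sum over x comes from the
  associator applied inside the first tensor factor.\<close>

lemma pentagon_E:
  assumes fin: "finite A" "finite B" "finite D" "finite C"
  shows "mat_mult (amat F A B (tens \<delta> D C)) (amat F (tens \<delta> A B) D C) =
    mat_mult (mat_tens \<delta> (mat_id A) (amat F B D C))
      (mat_mult (amat F A (tens \<delta> B D) C) (mat_tens \<delta> (amat F A B D) (mat_id C)))" (is "?L = ?R")
proof -
  let ?S = "tens \<delta> (tens \<delta> (tens \<delta> A B) D) C" and ?T = "tens \<delta> A (tens \<delta> B (tens \<delta> D C))"
  let ?N2 = "mat_tens \<delta> (amat F A B D) (mat_id C)"
  let ?N = "mat_mult (amat F A (tens \<delta> B D) C) ?N2"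
  have L: "?L \<in> mat_hom ?S ?T"
    by (rule mat_mult_in[OF amat_F_in amat_F_in])
  have N2: "?N2 \<in> mat_hom ?S (tens \<delta> (tens \<delta> A (tens \<delta> B D)) C)"
    using gtens_in[of "amat F A B D" Z2_1 _ _ "mat_id C" C C]
    by (simp add: mat_hhom_1 amat_F_in mat_id_in mat_tens_eq_gtens)
  have N: "?N \<in> mat_hom ?S (tens \<delta> A (tens \<delta> (tens \<delta> B D) C))"
    by (rule mat_mult_in[OF N2 amat_F_in])
  have "mat_tens \<delta> (mat_id A) (amat F B D C) \<in> mat_hom (tens \<delta> A (tens \<delta> (tens \<delta> B D) C)) ?T"
    using gtens_in[of "mat_id A" Z2_1 A A "amat F B D C"]
    by (simp add: mat_hhom_1 amat_F_in mat_id_in mat_tens_eq_gtens)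
  then have R: "?R \<in> mat_hom ?S ?T"
    by (rule mat_mult_in[OF N])
  have cN2: "colfin ?N2" and cN: "colfin ?N"
    using N2 N by (auto elim!: mat_hom_colfin simp: fin finite_tens)
  show ?thesis
  proof (rule mat_hom_eqI[OF L R])
    fix u s
    assume "u \<in> ?T" "s \<in> ?S"
    then obtain a b c d p r k a1 b1 c1 d1 e f k1 where *:
      "u = Node a (Node b (Node c d p) r) k" "s = Node (Node (Node a1 b1 e) c1 f) d1 k1"
      "a \<in> A" "b \<in> B" "c \<in> D" "d \<in> C" "p \<in> fus \<delta> (lab c) (lab d)" "r \<in> fus \<delta> (lab b) p" "k \<in> fus \<delta> (lab a) r"
      "a1 \<in> A" "b1 \<in> B" "c1 \<in> D" "d1 \<in> C" "e \<in> fus \<delta> (lab a1) (lab b1)" "f \<in> fus \<delta> e (lab c1)" "k1 \<in> fus \<delta> f (lab d1)"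
      by (elim tensE) auto
    have "?L u s = (\<Sum>x\<in>UNIV. F (lab a) (lab b) p x r k * amat F (tens \<delta> A B) D C (Node (Node a b x) (Node c d p) k) s)"
      using * by (simp add: amat_row amat_colfin fin finite_tens)
    also have "\<dots> = F (lab a) (lab b) p e r k * amat F (tens \<delta> A B) D C (Node (Node a b e) (Node c d p) k) s"
      by (rule sum_unique) (simp add: * amat_Node)
    finally have Lus: "?L u s = F (lab a) (lab b) p e r k * amat F (tens \<delta> A B) D C (Node (Node a b e) (Node c d p) k) s" .
    have N_entry: "?N (Node a (Node (Node b c x) d r) k) s = F (lab a) x (lab d) f r k * ?N2 (Node (Node a (Node b c x) f) d k) s"
      if "x \<in> fus \<delta> (lab b) (lab c)" for x
    proof -
      have "?N (Node a (Node (Node b c x) d r) k) s = (\<Sum>y\<in>UNIV. F (lab a) x (lab d) y r k * ?N2 (Node (Node a (Node b c x) y) d k) s)"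
        using * that by (simp add: amat_row[OF _ _ _ cN2])
      also have "\<dots> = F (lab a) x (lab d) f r k * ?N2 (Node (Node a (Node b c x) f) d k) s"
        by (rule sum_unique) (simp add: * amat_Node)
      finally show ?thesis .
    qed
    have "?R u s = mat_mult (amat F B D C) (\<lambda>y s'. ?N (Node a y k) s) (Node b (Node c d p) r) s"
      unfolding *(1) using * by (intro tens_id_row_left[OF amat_F_in _ _ cN]) auto
    also have "\<dots> = (\<Sum>x\<in>UNIV. F (lab b) (lab c) (lab d) x p r * ?N (Node a (Node (Node b c x) d r) k) s)"
      using * by (intro amat_row colfin_slice[OF _ cN]) (auto intro: injI)
    also have "\<dots> = (\<Sum>x\<in>UNIV. F (lab b) (lab c) (lab d) x p r *
        (F (lab a) x (lab d) f r k * ?N2 (Node (Node a (Node b c x) f) d k) s))"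
    proof (rule sum.cong[OF refl])
      fix x
      show "F (lab b) (lab c) (lab d) x p r * ?N (Node a (Node (Node b c x) d r) k) s =
        F (lab b) (lab c) (lab d) x p r * (F (lab a) x (lab d) f r k * ?N2 (Node (Node a (Node b c x) f) d k) s)"
        using N_entry[of x] by (cases "x \<in> fus \<delta> (lab b) (lab c)") (auto simp: F_def)
    qed
    also have "\<dots> = ?L u s"
    proof (cases "a = a1 \<and> b = b1 \<and> c = c1 \<and> d = d1 \<and> k = k1")
      case True
      have "(\<Sum>x\<in>UNIV. F (lab b) (lab c) (lab d) x p r *
          (F (lab a) x (lab d) f r k * ?N2 (Node (Node a (Node b c x) f) d k) s)) =
        (\<Sum>x\<in>UNIV. F (lab a) (lab b) (lab c) e x f * F (lab a) x (lab d) f r k * F (lab b) (lab c) (lab d) x p r)"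
        using * True by (intro sum.cong refl) (simp add: amat_Node mat_id_def)
      also have "\<dots> = F e (lab c) (lab d) f p k * F (lab a) (lab b) p e r k"
        using * True by (intro pentagon_sym[symmetric]) auto
      also have "\<dots> = ?L u s"
        unfolding Lus using * True by (simp add: amat_Node)
      finally show ?thesis .
    next
      case False
      then have "?N2 (Node (Node a (Node b c x) f) d k) s = 0" for x
        using * by (auto simp: amat_Node mat_id_def)
      moreover have "amat F (tens \<delta> A B) D C (Node (Node a b e) (Node c d p) k) s = 0"
        using False * by (auto simp: amat_Node)
      ultimately show ?thesis
        unfolding Lus by simp
    qed
    finally show "?L u s = ?R u s" ..
  qed
qed

section \<open>Unit constraints and the monoidal axioms\<close>

lemma \<tau>_Vec_0: "\<tau> (Vec 0) l l = 1" "\<tau> l (Vec 0) l = 1"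
  by (cases l; simp add: W_simps)+

lemma colfin_lunit: "finite A \<Longrightarrow> colfin (mat_lunit A)" "finite A \<Longrightarrow> colfin (mat_runit A)"
  by (auto simp: colfin_def mat_lunit_def mat_runit_def)

lemma lunit_in: "mat_lunit A \<in> mat_hom (tens \<delta> unit_obj A) A" "mat_runit A \<in> mat_hom (tens \<delta> A unit_obj) A"
  by (auto simp: mat_hom_def mat_lunit_def mat_runit_def unit_obj_iff split: if_splits)

lemma lunit_inv_in:
  "(\<lambda>u s. mat_lunit A s u) \<in> mat_hom A (tens \<delta> unit_obj A)" "(\<lambda>u s. mat_runit A s u) \<in> mat_hom A (tens \<delta> A unit_obj)"
  by (auto simp: mat_hom_def mat_lunit_def mat_runit_def unit_obj_iff split: if_splits)

lemma lunit_row: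
  assumes "u \<in> A" "colfin N"
  shows "mat_mult (mat_lunit A) N u s = N (Node (Leaf 0 (Vec 0)) u (lab u)) s"
    "mat_mult (mat_runit A) N u s = N (Node u (Leaf 0 (Vec 0)) (lab u)) s"
proof -
  have "mat_mult (mat_lunit A) N u s = mat_lunit A u (Node (Leaf 0 (Vec 0)) u (lab u)) * N (Node (Leaf 0 (Vec 0)) u (lab u)) s"
    by (rule mat_mult_single[OF _ assms(2)]) (auto simp: mat_lunit_def split: if_splits)
  then show "mat_mult (mat_lunit A) N u s = N (Node (Leaf 0 (Vec 0)) u (lab u)) s"
    using assms by (simp add: mat_lunit_def)
  have "mat_mult (mat_runit A) N u s = mat_runit A u (Node u (Leaf 0 (Vec 0)) (lab u)) * N (Node u (Leaf 0 (Vec 0)) (lab u)) s"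
    by (rule mat_mult_single[OF _ assms(2)]) (auto simp: mat_runit_def split: if_splits)
  then show "mat_mult (mat_runit A) N u s = N (Node u (Leaf 0 (Vec 0)) (lab u)) s"
    using assms by (simp add: mat_runit_def)
qed

lemma lunit_col:
  assumes "a \<in> A" "finite A"
  shows "mat_mult N (mat_lunit A) u (Node (Leaf 0 (Vec 0)) a (lab a)) = N u a"
    "mat_mult N (mat_runit A) u (Node a (Leaf 0 (Vec 0)) (lab a)) = N u a"
proof -
  have "mat_mult N (mat_lunit A) u (Node (Leaf 0 (Vec 0)) a (lab a)) = N u a * mat_lunit A a (Node (Leaf 0 (Vec 0)) a (lab a))"
    by (rule mat_mult_single[OF _ colfin_lunit(1)[OF assms(2)]]) (auto simp: mat_lunit_def split: if_splits)
  then show "mat_mult N (mat_lunit A) u (Node (Leaf 0 (Vec 0)) a (lab a)) = N u a"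
    using assms by (simp add: mat_lunit_def)
  have "mat_mult N (mat_runit A) u (Node a (Leaf 0 (Vec 0)) (lab a)) = N u a * mat_runit A a (Node a (Leaf 0 (Vec 0)) (lab a))"
    by (rule mat_mult_single[OF _ colfin_lunit(2)[OF assms(2)]]) (auto simp: mat_runit_def split: if_splits)
  then show "mat_mult N (mat_runit A) u (Node a (Leaf 0 (Vec 0)) (lab a)) = N u a"
    using assms by (simp add: mat_runit_def)
qed

text \<open>The shift h and coefficient k are general so that h = 1 with k = 1 gives naturality of
  the unitors, while h = g with k = \<tau> and f the action on A gives their equivariance.\<close>

lemma lunit_natural_E:
  assumes "eob A" "eob A'" and f: "f \<in> mat_hhom h (fst A) (fst A')"
    and k: "\<And>l. k (Vec 0) l l = 1" "\<And>l. k l (Vec 0) l = 1"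
  shows "mat_mult (mat_lunit (fst A')) (gtens \<delta> h k (mat_id unit_obj) f) = mat_mult f (mat_lunit (fst A))"
    "mat_mult (mat_runit (fst A')) (gtens \<delta> h k f (mat_id unit_obj)) = mat_mult f (mat_runit (fst A))"
proof -
  have fin: "finite (fst A)" "finite (fst A')"
    using assms by (simp_all add: eob_finite)
  have i: "mat_id unit_obj \<in> mat_hhom h unit_obj (unit_obj :: 'a tree set)"
    by (cases h) (auto simp: mat_id_def mat_hhom_def unit_obj_def split: if_splits)
  have i1: "mat_id unit_obj (Leaf 0 (Vec 0)) (Leaf 0 (Vec 0) :: 'a tree) = 1"
    by (simp add: mat_id_def unit_obj_iff)
  note g1 = gtens_in[OF i f, of \<delta> k] and g2 = gtens_in[OF f i, of \<delta> k]
  have c: "colfin (gtens \<delta> h k (mat_id unit_obj) f)" "colfin (gtens \<delta> h k f (mat_id unit_obj))"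
    by (rule mat_hhom_colfin[OF g1] mat_hhom_colfin[OF g2], simp add: finite_tens fin unit_obj_def)+
  show "mat_mult (mat_lunit (fst A')) (gtens \<delta> h k (mat_id unit_obj) f) = mat_mult f (mat_lunit (fst A))"
  proof (rule mat_hhom_eqI)
    show "mat_mult (mat_lunit (fst A')) (gtens \<delta> h k (mat_id unit_obj) f) \<in> mat_hhom h (tens \<delta> unit_obj (fst A)) (fst A')"
      using mat_hhom_mult[OF g1 lunit_in(1)[folded mat_hhom_1]] by simp
    show "mat_mult f (mat_lunit (fst A)) \<in> mat_hhom h (tens \<delta> unit_obj (fst A)) (fst A')"
      using mat_hhom_mult[OF lunit_in(1)[folded mat_hhom_1] f] by simp
  next
    fix u s assume u: "u \<in> fst A'" "s \<in> tens \<delta> unit_obj (fst A)"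
    then obtain a where s: "s = Node (Leaf 0 (Vec 0)) a (lab a)" "a \<in> fst A"
      by (auto elim!: tensE simp: unit_obj_iff)
    show "mat_mult (mat_lunit (fst A')) (gtens \<delta> h k (mat_id unit_obj) f) u s = mat_mult f (mat_lunit (fst A)) u s"
      using u mat_hhomD[OF f, of u a]
      by (auto simp: s lunit_row c lunit_col fin k i1)
  qed
  show "mat_mult (mat_runit (fst A')) (gtens \<delta> h k f (mat_id unit_obj)) = mat_mult f (mat_runit (fst A))"
  proof (rule mat_hhom_eqI)
    show "mat_mult (mat_runit (fst A')) (gtens \<delta> h k f (mat_id unit_obj)) \<in> mat_hhom h (tens \<delta> (fst A) unit_obj) (fst A')"
      using mat_hhom_mult[OF g2 lunit_in(2)[folded mat_hhom_1]] by simp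
    show "mat_mult f (mat_runit (fst A)) \<in> mat_hhom h (tens \<delta> (fst A) unit_obj) (fst A')"
      using mat_hhom_mult[OF lunit_in(2)[folded mat_hhom_1] f] by simp
  next
    fix u s assume u: "u \<in> fst A'" "s \<in> tens \<delta> (fst A) unit_obj"
    then obtain a where s: "s = Node a (Leaf 0 (Vec 0)) (lab a)" "a \<in> fst A"
      by (auto elim!: tensE simp: unit_obj_iff)
    show "mat_mult (mat_runit (fst A')) (gtens \<delta> h k f (mat_id unit_obj)) u s = mat_mult f (mat_runit (fst A)) u s"
      using u mat_hhomD[OF f, of u a]
      by (auto simp: s lunit_row c lunit_col fin k i1)
  qed
qed

lemma lunit_Node:
  "mat_lunit A u (Node (Leaf 0 (Vec 0)) a l) = (if u \<in> A \<and> a = u \<and> l = lab u then 1 else 0)"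
  "mat_runit A u (Node a (Leaf 0 (Vec 0)) l) = (if u \<in> A \<and> a = u \<and> l = lab u then 1 else 0)"
  by (auto simp: mat_lunit_def mat_runit_def)

lemma lunit_iso_E:
  assumes A: "eob A"
  shows "is_iso E (tobj E (unit E) A) A (mat_lunit (fst A))" "is_iso E (tobj E A (unit E)) A (mat_runit (fst A))"
proof -
  have fin: "finite (fst A)"
    by (rule eob_finite[OF A])
  note nat = lunit_natural_E[where k = \<tau>, OF A A gact_in[OF A] \<tau>_Vec_0]
  have "mat_lunit (fst A) \<in> ehom (tobj E (unit E) A) A" "mat_runit (fst A) \<in> ehom (tobj E A (unit E)) A"
    using nat lunit_in by (simp_all add: ehom_def gact_tens A unit_ob fst_tobj)
  moreover have "colfin (\<lambda>u s. mat_lunit (fst A) s u)" "colfin (\<lambda>u s. mat_runit (fst A) s u)"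
    by (auto simp: colfin_def mat_lunit_def mat_runit_def)
  then have "mat_mult (mat_lunit (fst A)) (\<lambda>u s. mat_lunit (fst A) s u) = mat_id (fst A)"
    "mat_mult (mat_runit (fst A)) (\<lambda>u s. mat_runit (fst A) s u) = mat_id (fst A)"
    by - ((rule mat_hom_eqI[OF mat_mult_in[OF lunit_inv_in(1) lunit_in(1)] mat_id_in]
        mat_hom_eqI[OF mat_mult_in[OF lunit_inv_in(2) lunit_in(2)] mat_id_in],
      auto simp add: lunit_row mat_id_def lunit_Node)[1])+
  moreover have "mat_mult (\<lambda>u s. mat_lunit (fst A) s u) (mat_lunit (fst A)) = mat_id (tens \<delta> unit_obj (fst A))"
    "mat_mult (\<lambda>u s. mat_runit (fst A) s u) (mat_runit (fst A)) = mat_id (tens \<delta> (fst A) unit_obj)"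
    by - ((rule mat_hom_eqI[OF mat_mult_in[OF lunit_in(1) lunit_inv_in(1)] mat_id_in]
        mat_hom_eqI[OF mat_mult_in[OF lunit_in(2) lunit_inv_in(2)] mat_id_in],
      auto elim!: tensE simp: unit_obj_iff lunit_col fin mat_id_def lunit_Node split: if_splits)[1])+
  ultimately show "is_iso E (tobj E (unit E) A) A (mat_lunit (fst A))" "is_iso E (tobj E A (unit E)) A (mat_runit (fst A))"
    using is_iso_E(2)[of "tobj E (unit E) A" A "mat_lunit (fst A)" "\<lambda>u s. mat_lunit (fst A) s u"]
     is_iso_E(2)[of "tobj E A (unit E)" A "mat_runit (fst A)" "\<lambda>u s. mat_runit (fst A) s u"]
    by (simp_all add: A unit_ob eob_tobj fst_tobj lunit_inv_in)
qed

lemma triangle_E: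
  assumes fin: "finite A" "finite B"
  shows "mat_mult (mat_tens \<delta> (mat_id A) (mat_lunit B)) (amat F A unit_obj B) = mat_tens \<delta> (mat_runit A) (mat_id B)"
    (is "?L = ?R")
proof (rule mat_hom_eqI)
  have "mat_tens \<delta> (mat_id A) (mat_lunit B) \<in> mat_hom (tens \<delta> A (tens \<delta> unit_obj B)) (tens \<delta> A B)"
    using gtens_in[of "mat_id A" Z2_1 A A "mat_lunit B"]
    by (simp add: mat_hhom_1 lunit_in mat_id_in mat_tens_eq_gtens)
  then show "?L \<in> mat_hom (tens \<delta> (tens \<delta> A unit_obj) B) (tens \<delta> A B)"
    by (rule mat_mult_in[OF amat_F_in])
  show "?R \<in> mat_hom (tens \<delta> (tens \<delta> A unit_obj) B) (tens \<delta> A B)"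
    using gtens_in[of "mat_runit A" Z2_1 _ _ "mat_id B"]
    by (simp add: mat_hhom_1 lunit_in mat_id_in mat_tens_eq_gtens)
next
  fix u s
  assume "u \<in> tens \<delta> A B" "s \<in> tens \<delta> (tens \<delta> A unit_obj) B"
  then obtain a b d a' b' d' where *: "u = Node a' b' d'" "s = Node (Node a (Leaf 0 (Vec 0)) (lab a)) b d"
    "a \<in> A" "b \<in> B" "d \<in> fus \<delta> (lab a) (lab b)" "a' \<in> A" "b' \<in> B" "d' \<in> fus \<delta> (lab a') (lab b')"
    by (elim tensE) (auto simp: unit_obj_iff)
  have "?L u s = (\<Sum>f\<in>UNIV. mat_tens \<delta> (mat_id A) (mat_lunit B) u (Node a (Node (Leaf 0 (Vec 0)) b f) d) *
      F (lab a) (Vec 0) (lab b) (lab a) f d)"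
    using * by (simp add: amat_col unit_obj_iff)
  also have "\<dots> = mat_tens \<delta> (mat_id A) (mat_lunit B) u (Node a (Node (Leaf 0 (Vec 0)) b (lab b)) d) *
      F (lab a) (Vec 0) (lab b) (lab a) (lab b) d"
    by (rule sum_unique) (auto simp: * mat_lunit_def)
  also have "F (lab a) (Vec 0) (lab b) (lab a) (lab b) d = 1"
    using *(5) by (cases "lab a"; cases "lab b") (auto simp: F_def cls_zero W_simps \<sigma>_zero)
  finally show "?L u s = ?R u s"
    using * by (auto simp: mat_lunit_def mat_runit_def mat_id_def)
qed

lemma monoidal: "monoidal_category E"
proof -
  interpret linear_category E
    by (rule linear)
  have lin: "mat_tens \<delta> (\<lambda>u s. f u s + f' u s) g = (\<lambda>u s. mat_tens \<delta> f g u s + mat_tens \<delta> f' g u s)"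
    "mat_tens \<delta> f (\<lambda>u s. g u s + g' u s) = (\<lambda>u s. mat_tens \<delta> f g u s + mat_tens \<delta> f g' u s)"
    "mat_tens \<delta> (\<lambda>u s. k * f u s) g = (\<lambda>u s. k * mat_tens \<delta> f g u s)"
    "mat_tens \<delta> f (\<lambda>u s. k * g u s) = (\<lambda>u s. k * mat_tens \<delta> f g u s)" for f f' g g' k
    by (intro ext; simp add: mat_tens_def algebra_simps split: basis_tree.split)+
  show ?thesis
  proof
    fix A B D E' A' B' D' A'' B'' f f' g g' h k
    show "unit E \<in> Obj E"
      by (simp add: Obj_E unit_ob)
    show "tobj E A B \<in> Obj E" if "A \<in> Obj E" "B \<in> Obj E"
      using that by (simp add: Obj_E eob_tobj)
    show "tmor E f g \<in> Hom E (tobj E A B) (tobj E A' B')"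
      if "A \<in> Obj E" "A' \<in> Obj E" "B \<in> Obj E" "B' \<in> Obj E" "f \<in> Hom E A A'" "g \<in> Hom E B B'"
      using that ehom_tens unfolding Obj_E Hom_E E_simps(7) by blast
    show "tmor E (idm E A) (idm E B) = idm E (tobj E A B)" 
      by (simp add: E_simps(1,7) fst_tobj mat_tens_eq_gtens gtens_id)
    show "tmor E (comp E f' f) (comp E g' g) = comp E (tmor E f' g') (tmor E f g)"
      if "A \<in> Obj E" "A' \<in> Obj E" "A'' \<in> Obj E" "B \<in> Obj E" "B' \<in> Obj E" "B'' \<in> Obj E"
        "f \<in> Hom E A A'" "f' \<in> Hom E A' A''" "g \<in> Hom E B B'" "g' \<in> Hom E B' B''"
      using that gtens_mult[of f Z2_1 "fst A" "fst A'" g "fst B" "fst B'" \<delta> Z2_1 "\<lambda>_ _ _. 1" f' g' "\<lambda>_ _ _. 1"]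
      by (simp add: E_simps(2,7) mat_tens_eq_gtens Obj_E Hom_E ehom_in eob_finite mat_hhom_1)
    show "is_iso E (tobj E (tobj E A B) D) (tobj E A (tobj E B D)) (assoc E A B D)"
      if "A \<in> Obj E" "B \<in> Obj E" "D \<in> Obj E"
      using that assoc_iso_E(2) by (simp add: Obj_E)
    show "comp E (assoc E A' B' D') (tmor E (tmor E f g) h) = comp E (tmor E f (tmor E g h)) (assoc E A B D)"
      if "A \<in> Obj E" "A' \<in> Obj E" "B \<in> Obj E" "B' \<in> Obj E" "D \<in> Obj E" "D' \<in> Obj E"
         "f \<in> Hom E A A'" "g \<in> Hom E B B'" "h \<in> Hom E D D'"
      using assoc_natural_E[of A A' B B' D D' f g h] that
      by (simp add: E_simps(2,7,9) mat_assoc_F Obj_E Hom_E)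
    show "is_iso E (tobj E (unit E) A) A (lunit E A)" "is_iso E (tobj E A (unit E)) A (runit E A)" if "A \<in> Obj E"
      using lunit_iso_E[of A] that by (simp_all add: Obj_E E_simps(10,11))
    show "comp E (lunit E A') (tmor E (idm E (unit E)) f) = comp E f (lunit E A)"
      "comp E (runit E A') (tmor E f (idm E (unit E))) = comp E f (runit E A)"
      if "A \<in> Obj E" "A' \<in> Obj E" "f \<in> Hom E A A'"
      using lunit_natural_E[of A A' f Z2_1 "\<lambda>_ _ _. 1"] that
      by (simp_all add: Obj_E Hom_E E_simps(1,2,7,10,11) unit_ob mat_hhom_1 ehom_in mat_tens_eq_gtens)
    show "comp E (tmor E (idm E A) (lunit E B)) (assoc E A (unit E) B) = tmor E (runit E A) (idm E B)"
      if "A \<in> Obj E" "B \<in> Obj E"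
      using triangle_E[of "fst A" "fst B"] that
      by (simp add: Obj_E eob_finite E_simps(1,2,7,9,10,11) mat_assoc_F unit_ob)
    show "comp E (assoc E A B (tobj E D E')) (assoc E (tobj E A B) D E') =
       comp E (tmor E (idm E A) (assoc E B D E')) (comp E (assoc E A (tobj E B D) E') (tmor E (assoc E A B D) (idm E E')))"
      if "A \<in> Obj E" "B \<in> Obj E" "D \<in> Obj E" "E' \<in> Obj E"
      using pentagon_E[of "fst A" "fst B" "fst D" "fst E'"] that
      by (simp add: Obj_E eob_finite E_simps(1,2,7,9) mat_assoc_F fst_tobj)
  qed (simp_all add: E_simps(4,5,7) lin)
qed

end

section \<open>Braiding and twist\<close>

definition pd :: "Z2 \<Rightarrow> 'a::ab_group_add tree set \<times> 'a mat \<Rightarrow> 'a mat" where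
  "pd h A = (case h of Z2_1 \<Rightarrow> mat_id (fst A) | Z2_g \<Rightarrow> gact A)"

lemma pd_simps: "pd Z2_1 A = mat_id (fst A)" "pd Z2_g A = gact A"
  by (simp_all add: pd_def)

lemma pd_in: "eob A \<Longrightarrow> pd h A \<in> mat_hhom h (fst A) (fst A)"
  by (cases h) (simp_all add: pd_simps gact_in mat_hhom_1 mat_id_in)

lemma pd_colfin: "eob A \<Longrightarrow> colfin (pd h A)"
  by (cases h) (simp_all add: pd_simps gact_colfin colfin_id)

lemma pd_mult:
  assumes "eob A"
  shows "mat_mult (pd h A) (pd h' A) = pd (Z2_mult h h') A"
proof -
  have I: "mat_mult (mat_id (fst A)) (pd k A) = pd k A" "mat_mult (pd k A) (mat_id (fst A)) = pd k A" for k
    using mat_hhomD[OF pd_in[OF assms]] by (intro mat_id_left mat_id_right pd_colfin assms; auto)+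
  then show ?thesis
    using gact_gact[OF assms]
    by (cases h; cases h') (simp_all add: pd_simps I[of Z2_g, unfolded pd_simps] I[of Z2_1, unfolded pd_simps])
qed

lemma pd_comm: 
  assumes "mat_mult f (gact A) = mat_mult (gact B) f" "eob A" "eob B" "f \<in> mat_hhom h' (fst A) (fst B)"
  shows "mat_mult f (pd h A) = mat_mult (pd h B) f"
proof -
  have "mat_mult f (mat_id (fst A)) = f" "mat_mult (mat_id (fst B)) f = f"
    using mat_hhomD[OF assms(4)] by (intro mat_id_left mat_id_right mat_hhom_colfin[OF assms(4)] eob_finite assms; auto)+
  then show ?thesis
    using assms(1) by (cases h) (simp_all add: pd_simps)
qed

lemma h_simple_degree [simp]: "h_simple (degree l) l = l"
  by (cases l) auto

lemma h_simple_h_simple [simp]: "h_simple h (h_simple h l) = l"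
  by (cases h) auto

lemma degree_fus: "e \<in> fus \<delta> a b \<Longrightarrow> degree e = Z2_mult (degree a) (degree b)"
  by (cases a; cases b) auto

lemma Z2_mult_commute: "Z2_mult h h' = Z2_mult h' h"
  by (simp add: Z2_mult_def)

lemma mat_mult_const_col:
  "mat_mult N (\<lambda>t s'. c * M t s) u x = c * mat_mult N M u s"
  by (cases "c = 0") (simp_all add: mat_mult_def sum_distrib_left mult_ac)

lemma gtens_col:
  assumes M: "M \<in> mat_hhom h A A'" and N: "N \<in> mat_hhom h B B'" and fin: "finite A'" "finite B'"
    and d: "d \<in> fus \<delta> (lab a) (lab b)"
  shows "mat_mult P (gtens \<delta> h k M N) u (Node a b d) =
    k (lab a) (lab b) d * (\<Sum>x\<in>A'. \<Sum>y\<in>B'. P u (Node x y (h_simple h d)) * M x a * N y b)"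
proof -
  let ?n = "\<lambda>(x, y). Node x y (h_simple h d)"
  have "mat_mult P (gtens \<delta> h k M N) u (Node a b d) =
      (\<Sum>t\<in>?n ` (A' \<times> B'). P u t * gtens \<delta> h k M N t (Node a b d))"
  proof (rule mat_mult_sum)
    fix t assume "gtens \<delta> h k M N t (Node a b d) \<noteq> 0"
    then show "t \<in> ?n ` (A' \<times> B')"
      using mat_hhomD[OF M] mat_hhomD[OF N] by (cases rule: gtens_nonzeroE) (auto simp: image_iff)
  qed (use fin in auto)
  also have "\<dots> = (\<Sum>(x, y)\<in>A' \<times> B'. k (lab a) (lab b) d * (P u (Node x y (h_simple h d)) * M x a * N y b))"
    using d by (subst sum.reindex) (auto simp: inj_on_def case_prod_unfold mult_ac)
  finally show ?thesis
    by (simp add: sum_distrib_left sum.cartesian_product case_prod_unfold)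
qed

lemma gtens_Leaf [simp]: "gtens \<delta> h k M N (Leaf n l) s = 0" "gtens \<delta> h k M N u (Leaf n l) = 0"
  by (simp_all add: gtens_def split: basis_tree.split)

lemma mat_mult_0: "mat_mult N (\<lambda>t s. 0) = (\<lambda>u s. 0)" "mat_mult (\<lambda>u t. 0) M = (\<lambda>u s. 0)"
  by (simp_all add: mat_mult_def)

context crossed_data
begin

lemma pd_tens:
  assumes "eob A" "eob B"
  shows "pd h (tobj E A B) = gtens \<delta> h (\<tau>h h) (pd h A) (pd h B)"
  by (cases h) (simp_all add: pd_simps gact_tens[OF assms] fst_tobj gtens_id[symmetric] \<tau>h_def[abs_def])

text \<open>The sum over degrees in the braiding of the equivariantisation merges into one formula,
  because each basis vector of A has exactly one degree.\<close>

definition brd :: "'a tree set \<times> 'a mat \<Rightarrow> 'a tree set \<times> 'a mat \<Rightarrow> 'a mat" where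
  "brd A B = (\<lambda>u s. case (u, s) of
     (Node b' a' d', Node a b d) \<Rightarrow>
       if a' = a \<and> d' = d \<and> a \<in> fst A \<and> d \<in> fus \<delta> (lab a) (lab b)
       then R (lab a) (lab b) d * pd (degree (lab a)) B b' b else 0
   | _ \<Rightarrow> 0)"

lemma brd_Node [simp]:
  "brd A B (Node b' a' d') (Node a b d) =
    (if a' = a \<and> d' = d \<and> a \<in> fst A \<and> d \<in> fus \<delta> (lab a) (lab b)
     then R (lab a) (lab b) d * pd (degree (lab a)) B b' b else 0)"
  by (simp add: brd_def)

lemma brd_Leaf [simp]: "brd A B (Leaf n l) s = 0" "brd A B u (Leaf n l) = 0"
  by (simp_all add: brd_def split: basis_tree.split)

lemma brd_nonzeroE:
  assumes "brd A B u s \<noteq> 0"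
  obtains a b b' d where "u = Node b' a d" "s = Node a b d" "a \<in> fst A" "d \<in> fus \<delta> (lab a) (lab b)"
    "pd (degree (lab a)) B b' b \<noteq> 0"
  using assms by (auto simp: brd_def split: basis_tree.splits if_splits)

text \<open>The inclusions and projections of homogeneous parts are identity matrices of subsets, so
  they only restrict the left leg to degree h.\<close>

lemma braid_part:
  assumes A: "eob A" and B: "eob B"
  shows "mat_mult (mat_tens \<delta> (mat_id (fst B)) (mat_id (part_obj h (fst A))))
      (mat_mult (mat_tens \<delta> (eqv_mor (crossed_category \<sigma> \<omega> \<delta> \<epsilon> q \<alpha> \<beta>) h B) (mat_id (part_obj h (fst A))))
        (mat_mult (mat_xbraid \<sigma> \<omega> \<delta> q \<alpha> (part_obj h (fst A)) (fst B))
          (mat_tens \<delta> (mat_id (part_obj h (fst A))) (mat_id (fst B))))) u s =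
    (case s of Node a b d \<Rightarrow> if degree (lab a) = h then brd A B u s else 0 | _ \<Rightarrow> 0)"
proof -
  let ?X = "part_obj h (fst A)" and ?\<psi> = "eqv_mor (crossed_category \<sigma> \<omega> \<delta> \<epsilon> q \<alpha> \<beta>) h B"
  let ?b = "mat_xbraid \<sigma> \<omega> \<delta> q \<alpha> ?X (fst B)"
  have fin: "finite ?X"
    using eob_finite[OF A] by (simp add: part_obj_def)
  have \<psi>: "?\<psi> b' (h_tree h b) = pd h B b' b" for b' b
    by (cases h; cases B) (auto simp: pd_simps crossed_category_def gact_def pm_def)
  have b: "mat_mult ?b (mat_tens \<delta> (mat_id ?X) (mat_id (fst B))) = ?b"
    unfolding mat_tens_eq_gtens gtens_id by (rule mat_id_right) (auto simp: mat_xbraid_def split: if_splits)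
  have cb: "colfin ?b"
    unfolding colfin_def
  proof
    fix s
    have "{t. ?b t s \<noteq> 0} \<subseteq> (case s of Node a b d \<Rightarrow> {Node (h_tree (degree (lab a)) b) a d} | _ \<Rightarrow> {})"
      by (auto simp: mat_xbraid_def split: basis_tree.splits if_splits)
    then show "finite {t. ?b t s \<noteq> 0}"
      by (rule finite_subset) (simp split: basis_tree.split)
  qed
  let ?m = "mat_mult (mat_tens \<delta> ?\<psi> (mat_id ?X)) ?b"
  have m: "?m u s = (case s of Node a b d \<Rightarrow> if degree (lab a) = h then brd A B u s else 0 | _ \<Rightarrow> 0)" for u s
  proof (cases "s \<in> tens \<delta> ?X (fst B)")
    case False
    then have "?b t s = 0" for t
      by (simp only: mat_xbraid_def if_False)
    then have "?m u s = 0"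
      by (simp add: mat_mult_def)
    moreover have "degree (lab a) = h \<Longrightarrow> brd A B u (Node a b d) = 0" if "s = Node a b d" for a b d
    proof (rule ccontr, erule brd_nonzeroE)
      fix a' b0 b' d' assume *: "degree (lab a) = h" "Node a b d = Node a' b0 d'" "a' \<in> fst A"
        "d' \<in> fus \<delta> (lab a') (lab b0)" "pd (degree (lab a')) B b' b0 \<noteq> 0"
      then have "s \<in> tens \<delta> ?X (fst B)"
        using that mat_hhomD[OF pd_in[OF B] *(5)] by (simp add: part_obj_def)
      then show False
        using False by simp
    qed
    ultimately show ?thesis
      by (cases s) simp_all
  next
    case True
    then obtain a b d where s: "s = Node a b d" "a \<in> fst A" "degree (lab a) = h" "b \<in> fst B"
      "d \<in> fus \<delta> (lab a) (lab b)"
      by (auto elim!: tensE simp: part_obj_def)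
    let ?t = "Node (h_tree h b) a d"
    have d: "d \<in> fus \<delta> (lab (h_tree h b)) (lab a)"
    proof -
      have "lab (h_tree h b) = h_simple h (lab b)"
        by (cases h) auto
      then show ?thesis
        using s fus_h_simple[of \<delta> "lab a" "lab b"] by simp
    qed
    have "?m u s = mat_tens \<delta> ?\<psi> (mat_id ?X) u ?t * ?b ?t s"
      by (rule mat_mult_single[OF _ cb]) (use s in \<open>auto simp: mat_xbraid_def split: if_splits\<close>)
    also have "\<dots> = brd A B u s"
      using s d True by (cases u) (auto simp: mat_xbraid_def mat_id_def \<psi> mat_tens_eq_gtens gtens_def part_obj_def)
    finally show ?thesis
      using s by simp
  qed
  have cm: "colfin ?m"
  proof -
    have "colfin (mat_tens \<delta> ?\<psi> (mat_id ?X))"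
    proof -
      have "finite {b'. ?\<psi> b' b \<noteq> 0}" for b
      proof -
        have "b = h_tree h (h_tree h b)"
          by (cases h) auto
        then have "{b'. ?\<psi> b' b \<noteq> 0} \<subseteq> fst B"
          using \<psi>[of _ "h_tree h b"] mat_hhomD[OF pd_in[OF B]] by auto
        then show ?thesis
          using eob_finite[OF B] finite_subset by blast
      qed
      then have *: "finite ((\<lambda>(b', a, d). Node b' a d) ` ({b'. ?\<psi> b' b \<noteq> 0} \<times> ?X \<times> UNIV))" for b
        using fin by auto
      show ?thesis
        unfolding colfin_def
      proof
        fix s
        show "finite {t. mat_tens \<delta> ?\<psi> (mat_id ?X) t s \<noteq> 0}"
        proof (cases s)
          case (Node b a d)
          have "{t. mat_tens \<delta> ?\<psi> (mat_id ?X) t s \<noteq> 0} \<subseteq> (\<lambda>(b', a, d). Node b' a d) ` ({b'. ?\<psi> b' b \<noteq> 0} \<times> ?X \<times> UNIV)"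
            by (auto simp: Node mat_tens_eq_gtens mat_id_def image_iff elim!: gtens_nonzeroE split: if_splits)
          then show ?thesis
            using * finite_subset by blast
        qed (simp add: mat_tens_eq_gtens)
      qed
    qed
    then show ?thesis
      by (rule colfin_mult[OF cb])
  qed
  have "mat_mult (mat_tens \<delta> (mat_id (fst B)) (mat_id ?X)) ?m = ?m"
    unfolding mat_tens_eq_gtens gtens_id
  proof (rule mat_id_left)
    show "colfin (mat_mult (gtens \<delta> Z2_1 (\<lambda>_ _ _. 1) ?\<psi> (mat_id ?X)) ?b)"
      using cm by (simp add: mat_tens_eq_gtens)
  next
    fix u s assume "mat_mult (gtens \<delta> Z2_1 (\<lambda>_ _ _. 1) ?\<psi> (mat_id ?X)) ?b u s \<noteq> 0"
    then have "?m u s \<noteq> 0"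
      by (simp add: mat_tens_eq_gtens)
    then obtain a b d where "s = Node a b d" "degree (lab a) = h" "brd A B u s \<noteq> 0"
      unfolding m by (auto split: basis_tree.splits if_splits)
    then show "u \<in> tens \<delta> (fst B) ?X"
      using mat_hhomD[OF pd_in[OF B]] fus_h_simple[of \<delta>]
      by (auto elim!: brd_nonzeroE simp: part_obj_def)
  qed
  then show ?thesis
    by (simp only: b m)
qed

lemma braid_E:
  assumes A: "eob A" and B: "eob B"
  shows "braid E A B = brd A B"
proof (intro ext)
  fix u s
  obtain X \<phi> Y \<psi> where AB: "A = (X, \<phi>)" "B = (Y, \<psi>)"
    by (cases A; cases B)
  have "braid E A B u s = (\<Sum>h\<leftarrow>[Z2_1, Z2_g].
    (case s of Node a b d \<Rightarrow> if degree (lab a) = h then brd A B u s else 0 | _ \<Rightarrow> 0))"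
    using braid_part[OF A B, of Z2_1 u s] braid_part[OF A B, of Z2_g u s]
    by (simp add: equivariantisation_def crossed_category_def msum_def AB)
  also have "\<dots> = brd A B u s"
  proof (cases s)
    case (Node a b d)
    then show ?thesis
      by (cases "lab a") simp_all
  qed (simp add: brd_def split: basis_tree.split)
  finally show "braid E A B u s = brd A B u s" .
qed

lemma brd_in:
  assumes B: "eob B"
  shows "brd A B \<in> mat_hom (tens \<delta> (fst A) (fst B)) (tens \<delta> (fst B) (fst A))"
proof (rule mat_homI)
  fix u s assume "brd A B u s \<noteq> 0"
  then obtain a b b' d where *: "u = Node b' a d" "s = Node a b d" "a \<in> fst A" "d \<in> fus \<delta> (lab a) (lab b)"
    "pd (degree (lab a)) B b' b \<noteq> 0"
    by (rule brd_nonzeroE)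
  then show "u \<in> tens \<delta> (fst B) (fst A) \<and> s \<in> tens \<delta> (fst A) (fst B) \<and> lab u = lab s"
    using mat_hhomD[OF pd_in[OF B] *(5)] fus_h_simple[of \<delta> "lab a" "lab b"] by simp
qed

text \<open>The symbol R depends on the label before the action. A row knows only the label of b'
  after it, and the former is recovered by applying h again, h being an involution on
  labels.\<close>

lemma brd_row:
  assumes B: "eob B" and a: "a \<in> fst A" and d: "d \<in> fus \<delta> (lab b') (lab a)" and N: "colfin N"
  shows "mat_mult (brd A B) N (Node b' a d) s = R (lab a) (h_simple (degree (lab a)) (lab b')) d *
    mat_mult (pd (degree (lab a)) B) (\<lambda>y s'. N (Node a y d) s) b' s"
proof -
  let ?h = "degree (lab a)"
  have pd: "lab b' = h_simple ?h (lab b) \<and> b \<in> fst B" if "pd ?h B b' b \<noteq> 0" for b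
    using mat_hhomD[OF pd_in[OF B] that] by simp
  have "mat_mult (brd A B) N (Node b' a d) s =
      (\<Sum>t\<in>(\<lambda>y. Node a y d) ` fst B. brd A B (Node b' a d) t * N t s)"
    by (rule mat_mult_sum_row[OF N]) (use pd eob_finite[OF B] in \<open>auto elim!: brd_nonzeroE\<close>)
  also have "\<dots> = (\<Sum>y\<in>fst B. brd A B (Node b' a d) (Node a y d) * N (Node a y d) s)"
    by (subst sum.reindex) (auto simp: inj_on_def)
  also have "\<dots> = (\<Sum>y\<in>fst B. R (lab a) (h_simple ?h (lab b')) d * (pd ?h B b' y * N (Node a y d) s))"
  proof (rule sum.cong[OF refl])
    fix y
    show "brd A B (Node b' a d) (Node a y d) * N (Node a y d) s =
      R (lab a) (h_simple ?h (lab b')) d * (pd ?h B b' y * N (Node a y d) s)"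
      using pd[of y] d a fus_h_simple[of \<delta> "lab a" "lab y"] by (cases "pd ?h B b' y = 0") auto
  qed
  also have "\<dots> = R (lab a) (h_simple ?h (lab b')) d * (\<Sum>y\<in>fst B. pd ?h B b' y * N (Node a y d) s)"
    by (simp add: sum_distrib_left)
  also have "(\<Sum>y\<in>fst B. pd ?h B b' y * N (Node a y d) s) = mat_mult (pd ?h B) (\<lambda>y s'. N (Node a y d) s) b' s"
    by (rule mat_mult_sum_row[symmetric, OF colfin_slice[OF _ N]])
      (use pd eob_finite[OF B] in \<open>auto intro: injI\<close>)
  finally show ?thesis .
qed

lemma brd_col:
  assumes B: "eob B" and a: "a \<in> fst A" and d: "d \<in> fus \<delta> (lab a) (lab b)"
  shows "mat_mult N (brd A B) u (Node a b d) = R (lab a) (lab b) d *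
    mat_mult (\<lambda>x y. N u (Node y a d)) (pd (degree (lab a)) B) u b"
proof -
  let ?h = "degree (lab a)"
  have pd: "b' \<in> fst B" if "pd ?h B b' b \<noteq> 0" for b'
    using mat_hhomD[OF pd_in[OF B] that] by simp
  have "mat_mult N (brd A B) u (Node a b d) =
      (\<Sum>t\<in>(\<lambda>y. Node y a d) ` fst B. N u t * brd A B t (Node a b d))"
    by (rule mat_mult_sum) (use pd eob_finite[OF B] in \<open>auto elim!: brd_nonzeroE\<close>)
  also have "\<dots> = (\<Sum>y\<in>fst B. N u (Node y a d) * brd A B (Node y a d) (Node a b d))"
    by (subst sum.reindex) (auto simp: inj_on_def)
  also have "\<dots> = R (lab a) (lab b) d * (\<Sum>y\<in>fst B. N u (Node y a d) * pd ?h B y b)"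
    using a d by (simp add: sum_distrib_left mult_ac)
  also have "(\<Sum>y\<in>fst B. N u (Node y a d) * pd ?h B y b) = mat_mult (\<lambda>x y. N u (Node y a d)) (pd ?h B) u b"
    by (rule mat_mult_sum[symmetric]) (use pd eob_finite[OF B] in auto)
  finally show ?thesis .
qed

text \<open>With h = 1 and k = 1 this is naturality of the braiding. With h = g, k = \<tau> and f, g
  the actions on A and B it is equivariance, where hypothesis k is \<open>R_g\<close>.\<close>

lemma brd_natural_aux:
  assumes ob: "eob A" "eob A'" "eob B" "eob B'"
    and f: "f \<in> mat_hhom h (fst A) (fst A')" "mat_mult f (gact A) = mat_mult (gact A') f"
    and g: "g \<in> mat_hhom h (fst B) (fst B')" "mat_mult g (gact B) = mat_mult (gact B') g"
    and k: "\<And>a b d. d \<in> fus \<delta> a b \<Longrightarrow> R (h_simple h a) (h_simple h b) (h_simple h d) * k a b d =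
      R a b d * k (h_simple (degree a) b) a d"
  shows "mat_mult (brd A' B') (gtens \<delta> h k f g) = mat_mult (gtens \<delta> h k g f) (brd A B)" (is "?L = ?R")
proof (rule mat_hhom_eqI)
  let ?S = "tens \<delta> (fst A) (fst B)" and ?T = "tens \<delta> (fst B') (fst A')"
  have fg: "gtens \<delta> h k f g \<in> mat_hhom h ?S (tens \<delta> (fst A') (fst B'))"
    by (rule gtens_in[OF f(1) g(1)])
  show "?L \<in> mat_hhom h ?S ?T"
    using mat_hhom_mult[OF fg brd_in[OF ob(4), folded mat_hhom_1]] by simp
  show "?R \<in> mat_hhom h ?S ?T"
    using mat_hhom_mult[OF brd_in[OF ob(3), folded mat_hhom_1] gtens_in[OF g(1) f(1)]] by simp
  have cfg: "colfin (gtens \<delta> h k f g)"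
    by (rule mat_hhom_colfin[OF fg]) (simp add: finite_tens eob_finite ob)
  fix u s assume "u \<in> ?T" "s \<in> ?S"
  then obtain a b d a' b' d' where *: "u = Node b' a' d'" "s = Node a b d"
    "a \<in> fst A" "b \<in> fst B" "d \<in> fus \<delta> (lab a) (lab b)"
    "a' \<in> fst A'" "b' \<in> fst B'" "d' \<in> fus \<delta> (lab b') (lab a')"
    by (elim tensE) auto
  show "?L u s = ?R u s"
  proof (cases "f a' a = 0 \<or> d' \<noteq> h_simple h d")
    case True
    then show ?thesis
      using * by (auto simp: brd_row[OF ob(4) _ _ cfg] brd_col[OF ob(3)] mat_mult_0 cong: if_cong)
  next
    case False
    then have la: "lab a' = h_simple h (lab a)" and d': "d' = h_simple h d"
      using mat_hhomD[OF f(1), of a' a] by auto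
    let ?h = "degree (lab a)"
    have com: "mat_mult g (pd ?h B) = mat_mult (pd ?h B') g"
      by (rule pd_comm[OF g(2) ob(3,4) g(1)])
    have "?L u s = R (lab a') (h_simple ?h (lab b')) d' * mat_mult (pd ?h B') (\<lambda>y s'. (k (lab a) (lab b) d * f a' a) * g y b) b' s"
      using * False by (simp add: brd_row[OF ob(4) _ _ cfg] la mult_ac)
    also have "\<dots> = R (lab a') (h_simple ?h (lab b')) d' * (k (lab a) (lab b) d * f a' a) * mat_mult (pd ?h B') g b' b"
      unfolding mat_mult_const_col[where M = g and s = b] by (simp only: mult.assoc)
    finally have L: "?L u s = R (lab a') (h_simple ?h (lab b')) d' * (k (lab a) (lab b) d * f a' a) * mat_mult (pd ?h B') g b' b" .
    have "?R u s = R (lab a) (lab b) d * mat_mult (\<lambda>x y. gtens \<delta> h k g f u (Node y a d)) (pd ?h B) u b"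
      using * by (simp add: brd_col[OF ob(3)])
    also have "mat_mult (\<lambda>x y. gtens \<delta> h k g f u (Node y a d)) (pd ?h B) u b =
      (\<Sum>y\<in>fst B. gtens \<delta> h k g f u (Node y a d) * pd ?h B y b)"
      by (rule mat_mult_sum) (use mat_hhomD[OF pd_in[OF ob(3)]] eob_finite[OF ob(3)] in auto)
    also have "\<dots> = (\<Sum>y\<in>fst B. (k (h_simple ?h (lab b)) (lab a) d * f a' a) * (g b' y * pd ?h B y b))"
    proof (rule sum.cong[OF refl])
      fix y
      show "gtens \<delta> h k g f u (Node y a d) * pd ?h B y b =
        (k (h_simple ?h (lab b)) (lab a) d * f a' a) * (g b' y * pd ?h B y b)"
        using mat_hhomD[OF pd_in[OF ob(3)], of ?h y b] * fus_h_simple[of \<delta> "lab a" "lab b"]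
        by (cases "pd ?h B y b = 0") (auto simp: d')
    qed
    also have "\<dots> = (k (h_simple ?h (lab b)) (lab a) d * f a' a) * mat_mult g (pd ?h B) b' b"
      by (simp add: mat_hhom_mult_sum[OF pd_in[OF ob(3)] eob_finite[OF ob(3)]] sum_distrib_left)
    finally have Rr: "?R u s = R (lab a) (lab b) d * (k (h_simple ?h (lab b)) (lab a) d * f a' a) * mat_mult g (pd ?h B) b' b"
      by (simp add: mult_ac)
    show ?thesis
    proof (cases "mat_mult (pd ?h B') g b' b = 0")
      case False
      then obtain y where "pd ?h B' b' y \<noteq> 0" "g y b \<noteq> 0"
        by (rule mat_mult_nonzeroE)
      then have "lab b' = h_simple ?h (h_simple h (lab b))"
        using mat_hhomD[OF pd_in[OF ob(4)]] mat_hhomD[OF g(1)] by metis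
      then show ?thesis
        unfolding L Rr com using k[OF *(5)] by (simp add: la d' mult_ac)
    qed (simp add: L Rr com)
  qed
qed

lemma braid_natural_E:
  assumes ob: "eob A" "eob A'" "eob B" "eob B'" and f: "f \<in> ehom A A'" and g: "g \<in> ehom B B'"
  shows "mat_mult (brd A' B') (mat_tens \<delta> f g) = mat_mult (mat_tens \<delta> g f) (brd A B)"
  unfolding mat_tens_eq_gtens using ob f g
  by (intro brd_natural_aux) (auto simp: ehom_eq mat_hhom_1 ehom_in)

lemma ehom_brd:
  assumes A: "eob A" and B: "eob B"
  shows "brd A B \<in> ehom (tobj E A B) (tobj E B A)"
proof -
  have k: "R (h_simple Z2_g a) (h_simple Z2_g b) (h_simple Z2_g d) * \<tau> a b d = R a b d * \<tau> (h_simple (degree a) b) a d"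
    if "d \<in> fus \<delta> a b" for a b d
    using R_g[of "g_simple d" "g_simple a" "g_simple b"] that by (simp add: mult_ac)
  have "mat_mult (brd A B) (gact (tobj E A B)) = mat_mult (gact (tobj E B A)) (brd A B)"
    unfolding gact_tens[OF A B] gact_tens[OF B A]
    by (rule brd_natural_aux[OF A A B B gact_in[OF A] refl gact_in[OF B] refl k])
  then show ?thesis
    using brd_in[OF B] by (simp add: ehom_def fst_tobj)
qed

end

section \<open>Inverse braiding and the hexagons\<close>

lemma mat_id_hhom: "mat_id A \<in> mat_hhom Z2_1 A A"
  by (simp add: mat_hhom_1 mat_id_in)

context crossed_data
begin

text \<open>The action matrix of each degree is an involution, so the inverse braiding uses the same
  action entry and the reciprocal of R, read at the label of the target leg b'.\<close>

definition brdi :: "'a tree set \<times> 'a mat \<Rightarrow> 'a tree set \<times> 'a mat \<Rightarrow> 'a mat" where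
  "brdi A B = (\<lambda>u s. case (u, s) of
     (Node a' b' d', Node b a d) \<Rightarrow>
       if a' = a \<and> d' = d \<and> a \<in> fst A \<and> d \<in> fus \<delta> (lab a) (lab b')
       then inverse (R (lab a) (lab b') d) * pd (degree (lab a)) B b' b else 0
   | _ \<Rightarrow> 0)"

lemma brdi_Node [simp]:
  "brdi A B (Node a' b' d') (Node b a d) =
    (if a' = a \<and> d' = d \<and> a \<in> fst A \<and> d \<in> fus \<delta> (lab a) (lab b')
     then inverse (R (lab a) (lab b') d) * pd (degree (lab a)) B b' b else 0)"
  by (simp add: brdi_def)

lemma brdi_in:
  assumes B: "eob B"
  shows "brdi A B \<in> mat_hom (tens \<delta> (fst B) (fst A)) (tens \<delta> (fst A) (fst B))"
proof (rule mat_homI)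
  fix u s assume "brdi A B u s \<noteq> 0"
  then obtain a b b' d where *: "s = Node b a d" "u = Node a b' d" "a \<in> fst A" "d \<in> fus \<delta> (lab a) (lab b')"
    "pd (degree (lab a)) B b' b \<noteq> 0"
    by (auto simp: brdi_def split: basis_tree.splits if_splits)
  have "lab b' = h_simple (degree (lab a)) (lab b)" "b \<in> fst B" "b' \<in> fst B"
    using mat_hhomD[OF pd_in[OF B] *(5)] by auto
  then show "u \<in> tens \<delta> (fst A) (fst B) \<and> s \<in> tens \<delta> (fst B) (fst A) \<and> lab u = lab s"
    using * fus_h_simple[of \<delta> "lab a" "lab b"] fus_h_simple[of \<delta> "lab a" "lab b'"] by simp
qed

lemma R_nonzero: "d \<in> fus \<delta> a b \<Longrightarrow> R a b d \<noteq> 0"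
  by (cases a; cases b) (auto simp: \<sigma>_nonzero q_nonzero \<alpha>_nonzero W_nonzero)

lemma brd_brdi:
  assumes A: "eob A" and B: "eob B"
  shows "mat_mult (brd A B) (brdi A B) = mat_id (tens \<delta> (fst B) (fst A))"
proof (rule mat_hom_eqI[OF mat_mult_in[OF brdi_in[OF B] brd_in[OF B]] mat_id_in])
  fix u s assume "u \<in> tens \<delta> (fst B) (fst A)" "s \<in> tens \<delta> (fst B) (fst A)"
  then obtain a b d a' b' d' where *: "u = Node b' a' d'" "s = Node b a d"
    "a \<in> fst A" "b \<in> fst B" "d \<in> fus \<delta> (lab b) (lab a)"
    "a' \<in> fst A" "b' \<in> fst B" "d' \<in> fus \<delta> (lab b') (lab a')"
    by (elim tensE) auto
  let ?h = "degree (lab a')"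
  have ci: "colfin (brdi A B)"
    by (rule mat_hom_colfin[OF brdi_in[OF B]]) (simp add: finite_tens eob_finite A B)
  have "mat_mult (brd A B) (brdi A B) u s = R (lab a') (h_simple ?h (lab b')) d' *
      mat_mult (pd ?h B) (\<lambda>y s'. brdi A B (Node a' y d') s) b' s"
    unfolding *(1) by (rule brd_row[OF B *(6,8) ci])
  also have "mat_mult (pd ?h B) (\<lambda>y s'. brdi A B (Node a' y d') s) b' s =
     (\<Sum>y\<in>fst B. pd ?h B b' y * brdi A B (Node a' y d') s)"
    using mat_hhomD[OF pd_in[OF B], of ?h b'] eob_finite[OF B]
    by (intro mat_mult_sum_row colfin_slice[OF _ ci]) (auto intro: injI)
  also have "\<dots> = (\<Sum>y\<in>fst B. (if a' = a \<and> d' = d then inverse (R (lab a') (h_simple ?h (lab b')) d') else 0) *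
     (pd ?h B b' y * pd ?h B y b))"
  proof (rule sum.cong[OF refl])
    fix y
    show "pd ?h B b' y * brdi A B (Node a' y d') s =
      (if a' = a \<and> d' = d then inverse (R (lab a') (h_simple ?h (lab b')) d') else 0) * (pd ?h B b' y * pd ?h B y b)"
      using mat_hhomD[OF pd_in[OF B], of ?h b' y] * fus_h_simple[of \<delta> "lab a'" "lab y"]
      by (cases "pd ?h B b' y = 0") auto
  qed
  also have "\<dots> = (if a' = a \<and> d' = d then inverse (R (lab a') (h_simple ?h (lab b')) d') else 0) * mat_mult (pd ?h B) (pd ?h B) b' b"
    by (simp add: mat_hhom_mult_sum[OF pd_in[OF B] eob_finite[OF B]] sum_distrib_left)
  also have "mat_mult (pd ?h B) (pd ?h B) = mat_id (fst B)"
    unfolding pd_mult[OF B] by (simp add: Z2_mult_def pd_simps)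
  finally show "mat_mult (brd A B) (brdi A B) u s = mat_id (tens \<delta> (fst B) (fst A)) u s"
    using * R_nonzero[of d' "lab a'" "h_simple ?h (lab b')"] fus_h_simple[of \<delta> "lab a'" "h_simple ?h (lab b')"]
    by (auto simp: mat_id_def)
qed

lemma brdi_brd:
  assumes A: "eob A" and B: "eob B"
  shows "mat_mult (brdi A B) (brd A B) = mat_id (tens \<delta> (fst A) (fst B))"
proof (rule mat_hom_eqI[OF mat_mult_in[OF brd_in[OF B] brdi_in[OF B]] mat_id_in])
  fix u s assume "u \<in> tens \<delta> (fst A) (fst B)" "s \<in> tens \<delta> (fst A) (fst B)"
  then obtain a b d a' b' d' where *: "u = Node a' b' d'" "s = Node a b d"
    "a \<in> fst A" "b \<in> fst B" "d \<in> fus \<delta> (lab a) (lab b)"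
    "a' \<in> fst A" "b' \<in> fst B" "d' \<in> fus \<delta> (lab a') (lab b')"
    by (elim tensE) auto
  let ?h = "degree (lab a)"
  have "mat_mult (brdi A B) (brd A B) u s = R (lab a) (lab b) d *
      mat_mult (\<lambda>x y. brdi A B u (Node y a d)) (pd ?h B) u b"
    unfolding *(2) by (rule brd_col[OF B *(3,5)])
  also have "mat_mult (\<lambda>x y. brdi A B u (Node y a d)) (pd ?h B) u b =
     (\<Sum>y\<in>fst B. brdi A B u (Node y a d) * pd ?h B y b)"
    by (rule mat_hhom_mult_sum[OF pd_in[OF B] eob_finite[OF B]])
  also have "\<dots> = (\<Sum>y\<in>fst B. (if a' = a \<and> d' = d then inverse (R (lab a) (lab b') d) else 0) * (pd ?h B b' y * pd ?h B y b))"
    using * by (intro sum.cong refl) auto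
  also have "\<dots> = (if a' = a \<and> d' = d then inverse (R (lab a) (lab b') d) else 0) * mat_mult (pd ?h B) (pd ?h B) b' b"
    by (simp add: mat_hhom_mult_sum[OF pd_in[OF B] eob_finite[OF B]] sum_distrib_left)
  also have "mat_mult (pd ?h B) (pd ?h B) = mat_id (fst B)"
    unfolding pd_mult[OF B] by (simp add: Z2_mult_def pd_simps)
  finally show "mat_mult (brdi A B) (brd A B) u s = mat_id (tens \<delta> (fst A) (fst B)) u s"
    using * R_nonzero[of d "lab a" "lab b"] by (auto simp: mat_id_def)
qed

lemma braid_iso_E:
  assumes "eob A" "eob B"
  shows "is_iso E (tobj E A B) (tobj E B A) (brd A B)"
  using assms ehom_brd[OF assms] brdi_in[of B A]
  by (intro is_iso_E(2)[of _ _ _ "brdi A B"]) (simp_all add: eob_tobj fst_tobj brdi_brd brd_brdi)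

lemma hexagon1_E:
  assumes A: "eob A" and B: "eob B" and D: "eob D"
  shows "mat_mult (amat F (fst B) (fst D) (fst A)) (mat_mult (brd A (tobj E B D)) (amat F (fst A) (fst B) (fst D))) =
    mat_mult (mat_tens \<delta> (mat_id (fst B)) (brd A D))
      (mat_mult (amat F (fst B) (fst A) (fst D)) (mat_tens \<delta> (brd A B) (mat_id (fst D))))" (is "?L = ?R")
proof -
  let ?S = "tens \<delta> (tens \<delta> (fst A) (fst B)) (fst D)" and ?T = "tens \<delta> (fst B) (tens \<delta> (fst D) (fst A))"
  let ?N1 = "mat_mult (brd A (tobj E B D)) (amat F (fst A) (fst B) (fst D))"
  let ?N2 = "mat_tens \<delta> (brd A B) (mat_id (fst D))"
  let ?N = "mat_mult (amat F (fst B) (fst A) (fst D)) ?N2"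
  note fin = eob_finite[OF A] eob_finite[OF B] eob_finite[OF D] finite_tens
  have BD: "eob (tobj E B D)"
    by (rule eob_tobj[OF B D])
  have N1: "?N1 \<in> mat_hom ?S (tens \<delta> (tens \<delta> (fst B) (fst D)) (fst A))"
    using mat_mult_in[OF amat_F_in brd_in[OF BD, of A, unfolded fst_tobj]] .
  have N2: "?N2 \<in> mat_hom ?S (tens \<delta> (tens \<delta> (fst B) (fst A)) (fst D))"
    using gtens_in[of "brd A B" Z2_1 _ _ "mat_id (fst D)" "fst D" "fst D"]
    by (simp add: mat_hhom_1 brd_in[OF B] mat_id_in mat_tens_eq_gtens)
  have N: "?N \<in> mat_hom ?S (tens \<delta> (fst B) (tens \<delta> (fst A) (fst D)))"
    by (rule mat_mult_in[OF N2 amat_F_in])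
  have M: "mat_tens \<delta> (mat_id (fst B)) (brd A D) \<in> mat_hom (tens \<delta> (fst B) (tens \<delta> (fst A) (fst D))) ?T"
    using gtens_in[of "mat_id (fst B)" Z2_1 "fst B" "fst B" "brd A D"]
    by (simp add: mat_hhom_1 brd_in[OF D] mat_id_in mat_tens_eq_gtens)
  have L: "?L \<in> mat_hom ?S ?T"
    by (rule mat_mult_in[OF N1 amat_F_in])
  have R: "?R \<in> mat_hom ?S ?T"
    by (rule mat_mult_in[OF N M])
  have cN1: "colfin ?N1" and cN2: "colfin ?N2" and cN: "colfin ?N"
    using N1 N2 N by (auto elim!: mat_hom_colfin simp: fin)
  show ?thesis
  proof (rule mat_hom_eqI[OF L R])
    fix u s
    assume "u \<in> ?T" "s \<in> ?S"
    then obtain b' d' a p k a1 b d e k1 where *: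
      "u = Node b' (Node d' a p) k" "s = Node (Node a1 b e) d k1"
      "b' \<in> fst B" "d' \<in> fst D" "a \<in> fst A" "p \<in> fus \<delta> (lab d') (lab a)" "k \<in> fus \<delta> (lab b') p"
      "a1 \<in> fst A" "b \<in> fst B" "d \<in> fst D" "e \<in> fus \<delta> (lab a1) (lab b)" "k1 \<in> fus \<delta> e (lab d)"
      by (elim tensE) auto
    let ?h = "degree (lab a)"
    let ?c = "if a = a1 \<and> k = k1 then pd ?h B b' b * pd ?h D d' d else 0"
    \<comment> \<open>The degree of a acts on the product of B and D by acting on both legs, moving
      the channel f to h f and contributing \<open>\<tau>h\<close>. Hence the double sum over x and
      f collapses to x = h f, and all action entries gather in \<open>?c\<close>.\<close>
    have br: "brd A (tobj E B D) (Node (Node b' d' x) a k) (Node a1 (Node b d f) k1) * F (lab a1) (lab b) (lab d) e f k1 =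
      (if x = h_simple ?h f then R (lab a) f k * \<tau>h ?h (lab b) (lab d) f * F (lab a) (lab b) (lab d) e f k * ?c else 0)" for x f
      using * by (auto simp: pd_tens[OF B D] F_def)
    have "?L u s = (\<Sum>x\<in>UNIV. F (lab b') (lab d') (lab a) x p k * ?N1 (Node (Node b' d' x) a k) s)"
      using * by (simp add: amat_row[OF _ _ _ cN1])
    also have "\<dots> = (\<Sum>x\<in>UNIV. F (lab b') (lab d') (lab a) x p k * (\<Sum>f\<in>UNIV. 
       if x = h_simple ?h f then R (lab a) f k * \<tau>h ?h (lab b) (lab d) f * F (lab a) (lab b) (lab d) e f k * ?c else 0))"
      unfolding *(2) amat_col[OF *(8-10)] br ..
    also have "\<dots> = (\<Sum>f\<in>UNIV. \<Sum>x\<in>UNIV. F (lab b') (lab d') (lab a) x p k * 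
       (if x = h_simple ?h f then R (lab a) f k * \<tau>h ?h (lab b) (lab d) f * F (lab a) (lab b) (lab d) e f k * ?c else 0))"
      unfolding sum_distrib_left by (rule sum.swap)
    also have "\<dots> = (\<Sum>f\<in>UNIV. F (lab a) (lab b) (lab d) e f k * R (lab a) f k * \<tau>h ?h (lab b) (lab d) f * 
       F (lab b') (lab d') (lab a) (h_simple ?h f) p k) * ?c"
      unfolding sum_distrib_right
      by (rule sum.cong[OF refl], subst sum_unique) (auto simp: mult_ac)
    finally have Lus: "?L u s = (\<Sum>f\<in>UNIV. F (lab a) (lab b) (lab d) e f k * R (lab a) f k * \<tau>h ?h (lab b) (lab d) f * 
       F (lab b') (lab d') (lab a) (h_simple ?h f) p k) * ?c" .
    have N_entry: "?N (Node b' (Node a y p) k) s =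
        (if y = d \<and> a = a1 \<and> k = k1 then F (lab b') (lab a) (lab y) e p k * (R (lab a) (lab b) e * pd ?h B b' b) else 0)"
      if "y \<in> fst D" for y
    proof -
      have "?N (Node b' (Node a y p) k) s = (\<Sum>x\<in>UNIV. F (lab b') (lab a) (lab y) x p k * ?N2 (Node (Node b' a x) y k) s)"
        using * that by (simp add: amat_row[OF _ _ _ cN2])
      also have "\<dots> = F (lab b') (lab a) (lab y) e p k * ?N2 (Node (Node b' a e) y k) s"
        by (rule sum_unique) (auto simp: *)
      also have "\<dots> = (if y = d \<and> a = a1 \<and> k = k1 then F (lab b') (lab a) (lab y) e p k * (R (lab a) (lab b) e * pd ?h B b' b) else 0)"
        using * by (auto simp: mat_id_def)
      finally show ?thesis .
    qed
    have "?R u s = mat_mult (brd A D) (\<lambda>y s'. ?N (Node b' y k) s) (Node d' a p) s"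
      unfolding *(1) using * by (intro tens_id_row_left[OF brd_in[OF D] _ _ cN]) auto
    also have "\<dots> = R (lab a) (h_simple ?h (lab d')) p * mat_mult (pd ?h D) (\<lambda>y s'. ?N (Node b' (Node a y p) k) s) d' s"
      using * by (intro brd_row[OF D _ _ colfin_slice[OF _ cN]]) (auto intro: injI)
    also have "mat_mult (pd ?h D) (\<lambda>y s'. ?N (Node b' (Node a y p) k) s) d' s =
      (\<Sum>y\<in>fst D. pd ?h D d' y * ?N (Node b' (Node a y p) k) s)"
      using mat_hhomD[OF pd_in[OF D], of ?h d'] fin
      by (intro mat_mult_sum_row colfin_slice[OF _ cN]) (auto intro: injI)
    also have "\<dots> = (\<Sum>y\<in>fst D. if y = d then (F (lab b') (lab a) (lab d) e p k * R (lab a) (lab b) e) * ?c else 0)"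
    proof (rule sum.cong[OF refl])
      fix y assume y: "y \<in> fst D"
      show "pd ?h D d' y * ?N (Node b' (Node a y p) k) s =
        (if y = d then (F (lab b') (lab a) (lab d) e p k * R (lab a) (lab b) e) * ?c else 0)"
        unfolding N_entry[OF y] by auto
    qed
    also have "\<dots> = (F (lab b') (lab a) (lab d) e p k * R (lab a) (lab b) e) * ?c"
      using * fin by (simp add: sum.delta)
    finally have Rus: "?R u s = R (lab a) (h_simple ?h (lab d')) p * ((F (lab b') (lab a) (lab d) e p k * R (lab a) (lab b) e) * ?c)" .
    show "?L u s = ?R u s"
    proof (cases "?c = 0")
      case False
      then have a: "a = a1" "k = k1" and l: "lab b' = h_simple ?h (lab b)" "lab d' = h_simple ?h (lab d)"
        using mat_hhomD[OF pd_in[OF B]] mat_hhomD[OF pd_in[OF D]] by (auto split: if_splits)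
      have p: "p \<in> fus \<delta> (h_simple ?h (lab d)) (lab a)" "k \<in> fus \<delta> (h_simple ?h (lab b)) p"
        using *(6,7) unfolding l .
      show ?thesis
        unfolding Lus Rus l using * a p
        by (subst hexagon1_sym) (simp_all add: mult_ac)
    qed (simp add: Lus Rus)
  qed
qed

lemma hexagon2_E:
  assumes A: "eob A" and B: "eob B" and D: "eob D"
  shows "mat_mult (aimat Fi (fst D) (fst A) (fst B)) (mat_mult (brd (tobj E A B) D) (aimat Fi (fst A) (fst B) (fst D))) =
    mat_mult (mat_tens \<delta> (brd A D) (mat_id (fst B)))
      (mat_mult (aimat Fi (fst A) (fst D) (fst B)) (mat_tens \<delta> (mat_id (fst A)) (brd B D)))" (is "?L = ?R")
proof -
  let ?S = "tens \<delta> (fst A) (tens \<delta> (fst B) (fst D))" and ?T = "tens \<delta> (tens \<delta> (fst D) (fst A)) (fst B)"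
  let ?N1 = "mat_mult (brd (tobj E A B) D) (aimat Fi (fst A) (fst B) (fst D))"
  let ?N2 = "mat_tens \<delta> (mat_id (fst A)) (brd B D)"
  let ?N = "mat_mult (aimat Fi (fst A) (fst D) (fst B)) ?N2"
  note fin = eob_finite[OF A] eob_finite[OF B] eob_finite[OF D] finite_tens
  have N1: "?N1 \<in> mat_hom ?S (tens \<delta> (fst D) (tens \<delta> (fst A) (fst B)))"
    using mat_mult_in[OF aimat_Fi_in brd_in[OF D, of "tobj E A B", unfolded fst_tobj]] .
  have N2: "?N2 \<in> mat_hom ?S (tens \<delta> (fst A) (tens \<delta> (fst D) (fst B)))"
    using gtens_in[of "mat_id (fst A)" Z2_1 "fst A" "fst A" "brd B D"]
    by (simp add: mat_hhom_1 brd_in[OF D] mat_id_in mat_tens_eq_gtens)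
  have N: "?N \<in> mat_hom ?S (tens \<delta> (tens \<delta> (fst A) (fst D)) (fst B))"
    by (rule mat_mult_in[OF N2 aimat_Fi_in])
  have M: "mat_tens \<delta> (brd A D) (mat_id (fst B)) \<in> mat_hom (tens \<delta> (tens \<delta> (fst A) (fst D)) (fst B)) ?T"
    using gtens_in[of "brd A D" Z2_1 _ _ "mat_id (fst B)" "fst B" "fst B"]
    by (simp add: mat_hhom_1 brd_in[OF D] mat_id_in mat_tens_eq_gtens)
  have L: "?L \<in> mat_hom ?S ?T"
    by (rule mat_mult_in[OF N1 aimat_Fi_in])
  have R: "?R \<in> mat_hom ?S ?T"
    by (rule mat_mult_in[OF N M])
  have cN1: "colfin ?N1" and cN2: "colfin ?N2" and cN: "colfin ?N"
    using N1 N2 N by (auto elim!: mat_hom_colfin simp: fin)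
  show ?thesis
  proof (rule mat_hom_eqI[OF L R])
    fix u s
    assume "u \<in> ?T" "s \<in> ?S"
    then obtain d' a p b k a1 b1 d f k1 where *:
      "u = Node (Node d' a p) b k" "s = Node a1 (Node b1 d f) k1"
      "d' \<in> fst D" "a \<in> fst A" "b \<in> fst B" "p \<in> fus \<delta> (lab d') (lab a)" "k \<in> fus \<delta> p (lab b)"
      "a1 \<in> fst A" "b1 \<in> fst B" "d \<in> fst D" "f \<in> fus \<delta> (lab b1) (lab d)" "k1 \<in> fus \<delta> (lab a1) f"
      by (elim tensE) auto
    let ?h = "degree (lab a)" and ?h' = "degree (lab b)"
    let ?c = "if a = a1 \<and> b = b1 \<and> k = k1 then pd (Z2_mult ?h ?h') D d' d else 0"
    have br: "brd (tobj E A B) D (Node d' (Node a b x) k) (Node (Node a1 b1 e) d k1) * Fi (lab a1) (lab b1) (lab d) e f k1 =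
      (if e = x then Fi (lab a) (lab b) (lab d) x f k * R x (lab d) k * ?c else 0)" for x e
      using * by (auto simp: fst_tobj Fi_def degree_fus)
    have "?L u s = (\<Sum>x\<in>UNIV. Fi (lab d') (lab a) (lab b) p x k * ?N1 (Node d' (Node a b x) k) s)"
      using * by (simp add: aimat_row[OF _ _ _ cN1])
    also have "\<dots> = (\<Sum>x\<in>UNIV. Fi (lab d') (lab a) (lab b) p x k * (\<Sum>e\<in>UNIV. 
       if e = x then Fi (lab a) (lab b) (lab d) x f k * R x (lab d) k * ?c else 0))"
      unfolding *(2) aimat_col[OF *(8-10)] br ..
    also have "\<dots> = (\<Sum>e\<in>UNIV. Fi (lab a) (lab b) (lab d) e f k * R e (lab d) k * Fi (lab d') (lab a) (lab b) p e k) * ?c"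
      unfolding sum_distrib_right by (intro sum.cong refl) (simp add: mult_ac)
    finally have Lus: "?L u s = (\<Sum>e\<in>UNIV. Fi (lab a) (lab b) (lab d) e f k * R e (lab d) k * Fi (lab d') (lab a) (lab b) p e k) * ?c" .
    let ?c' = "if a = a1 \<and> b = b1 \<and> k = k1 then 1 else 0 :: complex"
    have N_entry: "?N (Node (Node a y p) b k) s =
        Fi (lab a) (lab y) (lab b) p f k * (R (lab b) (lab d) f * ?c') * pd ?h' D y d"
      if "y \<in> fst D" for y
    proof -
      have "?N (Node (Node a y p) b k) s = (\<Sum>x\<in>UNIV. Fi (lab a) (lab y) (lab b) p x k * ?N2 (Node a (Node y b x) k) s)"
        using * that by (simp add: aimat_row[OF _ _ _ cN2])
      also have "\<dots> = Fi (lab a) (lab y) (lab b) p f k * ?N2 (Node a (Node y b f) k) s"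
        by (rule sum_unique) (auto simp: *)
      also have "\<dots> = Fi (lab a) (lab y) (lab b) p f k * (R (lab b) (lab d) f * ?c') * pd ?h' D y d"
        using * by (auto simp: mat_id_def)
      finally show ?thesis .
    qed
    have "?R u s = mat_mult (brd A D) (\<lambda>y s'. ?N (Node y b k) s) (Node d' a p) s"
      unfolding *(1) using * by (intro tens_id_row_right[OF brd_in[OF D] _ _ cN]) auto
    also have "\<dots> = R (lab a) (h_simple ?h (lab d')) p * mat_mult (pd ?h D) (\<lambda>y s'. ?N (Node (Node a y p) b k) s) d' s"
      using * by (intro brd_row[OF D _ _ colfin_slice[OF _ cN]]) (auto intro: injI)
    also have "mat_mult (pd ?h D) (\<lambda>y s'. ?N (Node (Node a y p) b k) s) d' s =
      (\<Sum>y\<in>fst D. pd ?h D d' y * ?N (Node (Node a y p) b k) s)"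
      using mat_hhomD[OF pd_in[OF D], of ?h d'] fin
      by (intro mat_mult_sum_row colfin_slice[OF _ cN]) (auto intro: injI)
    also have "\<dots> = (\<Sum>y\<in>fst D. Fi (lab a) (h_simple ?h (lab d')) (lab b) p f k * (R (lab b) (lab d) f * ?c') * (pd ?h D d' y * pd ?h' D y d))"
    proof (rule sum.cong[OF refl])
      fix y assume y: "y \<in> fst D"
      show "pd ?h D d' y * ?N (Node (Node a y p) b k) s =
        Fi (lab a) (h_simple ?h (lab d')) (lab b) p f k * (R (lab b) (lab d) f * ?c') * (pd ?h D d' y * pd ?h' D y d)"
        using mat_hhomD[OF pd_in[OF D], of ?h d' y]
        by (cases "pd ?h D d' y = 0") (simp_all add: N_entry[OF y] mult_ac)
    qed
    \<comment> \<open>The actions of the degrees of b and of a on D compose to the action of the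
      product degree, which is the one occurring in the braiding with the product of A and
      B.\<close>
    also have "\<dots> = Fi (lab a) (h_simple ?h (lab d')) (lab b) p f k * R (lab b) (lab d) f * ?c"
      using pd_mult[OF D, of ?h ?h']
      by (simp add: sum_distrib_left[symmetric] mat_hhom_mult_sum[OF pd_in[OF D] eob_finite[OF D], symmetric])
    finally have Rus: "?R u s = R (lab a) (h_simple ?h (lab d')) p * (Fi (lab a) (h_simple ?h (lab d')) (lab b) p f k * R (lab b) (lab d) f * ?c)" .
    show "?L u s = ?R u s"
    proof (cases "?c = 0")
      case False
      then have a: "a = a1" "b = b1" "k = k1" and l: "lab d' = h_simple ?h (h_simple ?h' (lab d))"
        using mat_hhomD[OF pd_in[OF D]] by (auto simp: h_simple_Z2_mult split: if_splits)
      have p: "p \<in> fus \<delta> (h_simple ?h (h_simple ?h' (lab d))) (lab a)"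
        using *(6) unfolding l .
      show ?thesis
        unfolding Lus Rus l using * a p
        by (subst hexagon2_sym) (simp_all add: mult_ac)
    qed (simp add: Lus Rus)
  qed
qed

section \<open>The twist\<close>

definition tw :: "'a tree set \<times> 'a mat \<Rightarrow> 'a mat" where
  "tw A = (\<lambda>u s. twist_sym \<sigma> \<beta> (lab s) * pd (degree (lab s)) A u s)"

lemma twist_part:
  assumes A: "eob A"
  shows "mat_mult (eqv_mor (crossed_category \<sigma> \<omega> \<delta> \<epsilon> q \<alpha> \<beta>) h A)
      (mat_mult (h_mat h (mat_id (part_obj h (fst A))))
        (mat_mult (mat_xtwist \<sigma> \<beta> (part_obj h (fst A))) (mat_id (part_obj h (fst A))))) u s =
    (if degree (lab s) = h then tw A u s else 0)"
proof -
  let ?X = "part_obj h (fst A)" and ?\<phi> = "eqv_mor (crossed_category \<sigma> \<omega> \<delta> \<epsilon> q \<alpha> \<beta>) h A"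
  let ?t = "mat_xtwist \<sigma> \<beta> ?X"
  have \<phi>: "?\<phi> b' (h_tree h b) = pd h A b' b" for b' b
    by (cases h; cases A) (auto simp: pd_simps crossed_category_def gact_def pm_def)
  have t: "mat_mult ?t (mat_id ?X) = ?t"
    by (rule mat_id_right) (auto simp: mat_xtwist_def split: if_splits)
  have ct: "colfin ?t"
    by (auto simp: colfin_def mat_xtwist_def)
  have "h_mat h (mat_id ?X) = mat_id (h_tree h ` ?X)"
    by (cases h) (simp_all add: h_mat_id, simp add: h_mat_def)
  then have "mat_mult (h_mat h (mat_id ?X)) ?t = ?t"
    using ct by (simp, intro mat_id_left) (auto simp: mat_xtwist_def part_obj_def split: if_splits)
  then have "mat_mult ?\<phi> (mat_mult (h_mat h (mat_id ?X)) (mat_mult ?t (mat_id ?X))) u s = mat_mult ?\<phi> ?t u s"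
    by (simp add: t)
  also have "\<dots> = ?\<phi> u (h_tree h s) * ?t (h_tree h s) s"
    by (rule mat_mult_single[OF _ ct]) (auto simp: mat_xtwist_def part_obj_def split: if_splits)
  also have "\<dots> = (if degree (lab s) = h then tw A u s else 0)"
    using mat_hhomD[OF pd_in[OF A], of h u s]
    by (auto simp: \<phi> mat_xtwist_def tw_def part_obj_def)
  finally show ?thesis .
qed

lemma twist_E:
  assumes A: "eob A"
  shows "twist E A = tw A"
proof (intro ext)
  fix u s
  obtain X \<phi> where AX: "A = (X, \<phi>)"
    by (cases A)
  have "twist E A u s = (\<Sum>h\<leftarrow>[Z2_1, Z2_g]. if degree (lab s) = h then tw A u s else 0)"
    using twist_part[OF A, of Z2_1 u s] twist_part[OF A, of Z2_g u s]
    by (simp add: equivariantisation_def crossed_category_def msum_def AX)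
  also have "\<dots> = tw A u s"
    by (cases "lab s") simp_all
  finally show "twist E A u s = tw A u s" .
qed

lemma twist_sym_h [simp]: "twist_sym \<sigma> \<beta> (h_simple h l) = twist_sym \<sigma> \<beta> l"
proof -
  have "\<sigma> (- a) (- a) = \<sigma> a a" for a
    by (simp add: \<sigma>_neg_neg W_square mult.assoc)
  then show ?thesis
    by (cases h; cases l) simp_all
qed

lemma twist_sym_nonzero: "twist_sym \<sigma> \<beta> l \<noteq> 0"
  using \<beta>_\<alpha> by (cases l) (auto simp: \<sigma>_nonzero)

lemma tw_in:
  assumes A: "eob A"
  shows "tw A \<in> mat_hom (fst A) (fst A)"
proof (rule mat_homI)
  fix u s assume "tw A u s \<noteq> 0"
  then have "pd (degree (lab s)) A u s \<noteq> 0"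
    by (simp add: tw_def)
  from mat_hhomD[OF pd_in[OF A] this] show "u \<in> fst A \<and> s \<in> fst A \<and> lab u = lab s"
    by simp
qed

text \<open>The twist is a scalar depending only on the g-orbit of the label, times the action of
  the degree, and both commute with f. Taking h = g and f the action on A gives equivariance of the
  twist.\<close>

lemma tw_natural:
  assumes A: "eob A" and B: "eob B" and f: "f \<in> mat_hhom h (fst A) (fst B)" "mat_mult f (gact A) = mat_mult (gact B) f"
  shows "mat_mult f (tw A) = mat_mult (tw B) f"
proof (intro ext)
  fix u s :: "'a tree"
  let ?h = "degree (lab s)"
  have "mat_mult f (tw A) u s = (\<Sum>t\<in>fst A. f u t * tw A t s)"
    by (rule mat_hhom_mult_sum[OF tw_in[OF A, folded mat_hhom_1] eob_finite[OF A]])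
  also have "\<dots> = twist_sym \<sigma> \<beta> (lab s) * mat_mult f (pd ?h A) u s"
    by (simp add: mat_hhom_mult_sum[OF pd_in[OF A] eob_finite[OF A]] sum_distrib_left tw_def mult_ac)
  also have "\<dots> = twist_sym \<sigma> \<beta> (lab s) * mat_mult (pd ?h B) f u s"
    using pd_comm[OF f(2) A B f(1)] by simp
  also have "\<dots> = (\<Sum>t\<in>fst B. twist_sym \<sigma> \<beta> (lab s) * (pd ?h B u t * f t s))"
    by (simp add: mat_hhom_mult_sum[OF f(1) eob_finite[OF B]] sum_distrib_left)
  also have "\<dots> = (\<Sum>t\<in>fst B. tw B u t * f t s)"
  proof (rule sum.cong[OF refl])
    fix t
    show "twist_sym \<sigma> \<beta> (lab s) * (pd ?h B u t * f t s) = tw B u t * f t s"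
      using mat_hhomD[OF f(1), of t s] by (cases "f t s = 0") (simp_all add: tw_def)
  qed
  also have "\<dots> = mat_mult (tw B) f u s"
    by (simp add: mat_hhom_mult_sum[OF f(1) eob_finite[OF B]])
  finally show "mat_mult f (tw A) u s = mat_mult (tw B) f u s" .
qed

lemma ehom_tw: "eob A \<Longrightarrow> tw A \<in> ehom A A"
  using tw_natural[of A A "gact A" Z2_g] by (simp add: ehom_def tw_in gact_in)

lemma twist_iso_E:
  assumes A: "eob A"
  shows "is_iso E A A (tw A)"
proof -
  \<comment> \<open>The action of a fixed degree is an involution, so inverting the scalar
    suffices.\<close>
  define tw' where "tw' = (\<lambda>u s. inverse (twist_sym \<sigma> \<beta> (lab s)) * pd (degree (lab s)) A u s)"
  have in': "tw' \<in> mat_hom (fst A) (fst A)"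
  proof (rule mat_homI)
    fix u s assume "tw' u s \<noteq> 0"
    then have "pd (degree (lab s)) A u s \<noteq> 0"
      by (simp add: tw'_def)
    from mat_hhomD[OF pd_in[OF A] this] show "u \<in> fst A \<and> s \<in> fst A \<and> lab u = lab s"
      by simp
  qed
  have *: "(\<Sum>t\<in>fst A. pd (degree (lab t)) A u t * pd (degree (lab s)) A t s) = mat_id (fst A) u s" for u s
  proof -
    have "(\<Sum>t\<in>fst A. pd (degree (lab t)) A u t * pd (degree (lab s)) A t s) =
      (\<Sum>t\<in>fst A. pd (degree (lab s)) A u t * pd (degree (lab s)) A t s)"
    proof (rule sum.cong[OF refl])
      fix t
      show "pd (degree (lab t)) A u t * pd (degree (lab s)) A t s = pd (degree (lab s)) A u t * pd (degree (lab s)) A t s"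
        using mat_hhomD[OF pd_in[OF A], of "degree (lab s)" t s]
        by (cases "pd (degree (lab s)) A t s = 0") simp_all
    qed
    also have "\<dots> = mat_id (fst A) u s"
      by (simp add: mat_hhom_mult_sum[OF pd_in[OF A] eob_finite[OF A], symmetric] pd_mult[OF A] Z2_mult_def pd_simps)
    finally show ?thesis .
  qed
  have "mat_mult tw' (tw A) u s = mat_id (fst A) u s" for u s
  proof -
    have "mat_mult tw' (tw A) u s = (\<Sum>t\<in>fst A. tw' u t * tw A t s)"
      by (rule mat_hhom_mult_sum[OF tw_in[OF A, folded mat_hhom_1] eob_finite[OF A]])
    also have "\<dots> = (\<Sum>t\<in>fst A. pd (degree (lab t)) A u t * pd (degree (lab s)) A t s)"
    proof (rule sum.cong[OF refl])
      fix t
      show "tw' u t * tw A t s = pd (degree (lab t)) A u t * pd (degree (lab s)) A t s"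
        using mat_hhomD[OF pd_in[OF A], of "degree (lab s)" t s]
        by (cases "pd (degree (lab s)) A t s = 0") (simp_all add: tw'_def tw_def twist_sym_nonzero)
    qed
    finally show ?thesis
      by (simp add: *)
  qed
  moreover have "mat_mult (tw A) tw' u s = mat_id (fst A) u s" for u s
  proof -
    have "mat_mult (tw A) tw' u s = (\<Sum>t\<in>fst A. tw A u t * tw' t s)"
      by (rule mat_hhom_mult_sum[OF in'[folded mat_hhom_1] eob_finite[OF A]])
    also have "\<dots> = (\<Sum>t\<in>fst A. pd (degree (lab t)) A u t * pd (degree (lab s)) A t s)"
    proof (rule sum.cong[OF refl])
      fix t
      show "tw A u t * tw' t s = pd (degree (lab t)) A u t * pd (degree (lab s)) A t s"
        using mat_hhomD[OF pd_in[OF A], of "degree (lab s)" t s]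
        by (cases "pd (degree (lab s)) A t s = 0") (simp_all add: tw'_def tw_def twist_sym_nonzero)
    qed
    finally show ?thesis
      by (simp add: *)
  qed
  ultimately show ?thesis
    by (intro is_iso_E(2)[OF A A ehom_tw[OF A] in']) (auto intro!: ext)
qed

text \<open>On each leg the twist contributes the action of its own degree and the double braiding
  that of the other leg, which together is the action of the total degree. The scalars then agree by
  \<open>twist_sym\<close>.\<close>

lemma twist_tensor_E:
  assumes A: "eob A" and B: "eob B"
  shows "tw (tobj E A B) = mat_mult (brd B A) (mat_mult (brd A B) (mat_tens \<delta> (tw A) (tw B)))" (is "?L = ?R")
proof -
  let ?S = "tens \<delta> (fst A) (fst B)"
  let ?N = "mat_tens \<delta> (tw A) (tw B)"
  note fin = eob_finite[OF A] eob_finite[OF B] finite_tens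
  have N: "?N \<in> mat_hom ?S ?S"
    using gtens_in[of "tw A" Z2_1 _ _ "tw B"] tw_in[OF A] tw_in[OF B] by (simp add: mat_hhom_1 mat_tens_eq_gtens)
  have N2: "mat_mult (brd A B) ?N \<in> mat_hom ?S (tens \<delta> (fst B) (fst A))"
    by (rule mat_mult_in[OF N brd_in[OF B]])
  have cN: "colfin ?N" and cN2: "colfin (mat_mult (brd A B) ?N)"
    using N N2 by (auto elim!: mat_hom_colfin simp: fin)
  have L: "?L \<in> mat_hom ?S ?S"
    using tw_in[OF eob_tobj[OF A B]] by (simp add: fst_tobj)
  show ?thesis
  proof (rule mat_hom_eqI[OF L mat_mult_in[OF N2 brd_in[OF A]]])
    fix u s assume "u \<in> ?S" "s \<in> ?S"
    then obtain a b d a' b' d' where *: "u = Node a' b' d'" "s = Node a b d"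
      "a \<in> fst A" "b \<in> fst B" "d \<in> fus \<delta> (lab a) (lab b)"
      "a' \<in> fst A" "b' \<in> fst B" "d' \<in> fus \<delta> (lab a') (lab b')"
      by (elim tensE) auto
    let ?i = "degree (lab a)" and ?j = "degree (lab b)"
    let ?\<theta> = "if d' = d then twist_sym \<sigma> \<beta> (lab a) * twist_sym \<sigma> \<beta> (lab b) else 0"
    have row1: "mat_mult (brd A B) ?N (Node b' y d') s =
        R (lab a) (h_simple ?i (lab b')) d' * ?\<theta> * pd ?i A y a * pd (Z2_mult ?i ?j) B b' b"
      if y: "y \<in> fst A" "lab y = lab a" "d' \<in> fus \<delta> (lab b') (lab a)" for y
    proof -
      have "mat_mult (brd A B) ?N (Node b' y d') s =
         R (lab a) (h_simple ?i (lab b')) d' * mat_mult (pd ?i B) (\<lambda>z s'. ?N (Node y z d') s) b' s"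
        using brd_row[OF B y(1) _ cN, of d' b' s] y by simp
      also have "mat_mult (pd ?i B) (\<lambda>z s'. ?N (Node y z d') s) b' s = (\<Sum>z\<in>fst B. pd ?i B b' z * ?N (Node y z d') s)"
        using mat_hhomD[OF pd_in[OF B], of ?i b'] fin
        by (intro mat_mult_sum_row colfin_slice[OF _ cN]) (auto intro: injI)
      also have "\<dots> = (\<Sum>z\<in>fst B. ?\<theta> * pd ?i A y a * (pd ?i B b' z * pd ?j B z b))"
        using * by (intro sum.cong refl) (auto simp: tw_def)
      also have "\<dots> = ?\<theta> * pd ?i A y a * pd (Z2_mult ?i ?j) B b' b"
        by (simp add: sum_distrib_left[symmetric] mat_hhom_mult_sum[OF pd_in[OF B] eob_finite[OF B], symmetric] pd_mult[OF B])
      finally show ?thesis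
        by (simp add: mult_ac)
    qed
    have nz: "d' = d \<and> lab y = lab a \<and> lab b' = h_simple ?i (lab b)"
      if "mat_mult (brd A B) ?N (Node b' y d') s \<noteq> 0" for y
    proof -
      obtain t where t: "brd A B (Node b' y d') t \<noteq> 0" "?N t s \<noteq> 0"
        using \<open>_ \<noteq> 0\<close> by (rule mat_mult_nonzeroE)
      obtain z where z: "t = Node y z d'" "pd (degree (lab y)) B b' z \<noteq> 0"
        using t(1) by (auto elim!: brd_nonzeroE)
      have "tw A y a \<noteq> 0" "tw B z b \<noteq> 0" "d' = d"
        using t(2) unfolding z *(2) by (auto split: if_splits)
      then show ?thesis
        using mat_homD[OF tw_in[OF A], of y a] mat_homD[OF tw_in[OF B], of z b] mat_hhomD[OF pd_in[OF B] z(2)]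
        by simp
    qed
    \<comment> \<open>Extends \<open>row1\<close> to all y: when the labels do not match, both sides
      vanish.\<close>
    have row2: "mat_mult (brd A B) ?N (Node b' y d') s =
        R (lab a) (h_simple ?i (lab b')) d' * ?\<theta> * pd ?i A y a * pd (Z2_mult ?i ?j) B b' b"
      if y: "y \<in> fst A" for y
    proof (cases "d' = d \<and> lab y = lab a \<and> lab b' = h_simple ?i (lab b)")
      case True
      then have "d' \<in> fus \<delta> (lab b') (lab a)"
        using *(5) fus_h_simple[of \<delta> "lab a" "lab b"] by simp
      then show ?thesis
        using row1[OF y] True by blast
    next
      case False
      then have "?\<theta> * pd ?i A y a * pd (Z2_mult ?i ?j) B b' b = 0"
        using mat_hhomD[OF pd_in[OF A], of ?i y a] mat_hhomD[OF pd_in[OF B], of "Z2_mult ?i ?j" b' b]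
        by (auto simp: h_simple_Z2_mult)
      then have "R (lab a) (h_simple ?i (lab b')) d' * (?\<theta> * pd ?i A y a * pd (Z2_mult ?i ?j) B b' b) = 0"
        by (simp only: mult_zero_right)
      moreover have "mat_mult (brd A B) ?N (Node b' y d') s = 0"
        using nz[of y] False by blast
      ultimately show ?thesis
        by (simp only: mult.assoc)
    qed
    have dd: "h_simple (Z2_mult ?i ?j) d = d"
      using degree_fus[OF *(5)] h_simple_degree[of d] by simp
    have L: "?L u s = (if d' = d then twist_sym \<sigma> \<beta> d * \<tau>h (degree d) (lab a) (lab b) d *
        (pd (Z2_mult ?i ?j) A a' a * pd (Z2_mult ?i ?j) B b' b) else 0)"
      using * dd by (auto simp: tw_def pd_tens[OF A B] degree_fus)
    have "?R u s = R (lab b') (h_simple (degree (lab b')) (lab a')) d' *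
        mat_mult (pd (degree (lab b')) A) (\<lambda>y s'. mat_mult (brd A B) ?N (Node b' y d') s) a' s"
      unfolding *(1) by (rule brd_row[OF A *(7,8) cN2])
    also have "mat_mult (pd (degree (lab b')) A) (\<lambda>y s'. mat_mult (brd A B) ?N (Node b' y d') s) a' s =
        (\<Sum>y\<in>fst A. pd (degree (lab b')) A a' y * mat_mult (brd A B) ?N (Node b' y d') s)"
      using mat_hhomD[OF pd_in[OF A], of _ a'] fin
      by (intro mat_mult_sum_row colfin_slice[OF _ cN2]) (auto intro: injI)
    also have "\<dots> = (\<Sum>y\<in>fst A. R (lab a) (h_simple ?i (lab b')) d' * ?\<theta> * pd (Z2_mult ?i ?j) B b' b *
        (pd (degree (lab b')) A a' y * pd ?i A y a))"
      by (intro sum.cong refl) (simp add: row2 mult_ac)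
    also have "\<dots> = R (lab a) (h_simple ?i (lab b')) d' * ?\<theta> * pd (Z2_mult ?i ?j) B b' b *
        pd (Z2_mult (degree (lab b')) ?i) A a' a"
      by (simp add: sum_distrib_left[symmetric] mat_hhom_mult_sum[OF pd_in[OF A] eob_finite[OF A], symmetric] pd_mult[OF A])
    finally have Rus: "?R u s = R (lab b') (h_simple (degree (lab b')) (lab a')) d' *
        (R (lab a) (h_simple ?i (lab b')) d' * ?\<theta> * pd (Z2_mult ?i ?j) B b' b * pd (Z2_mult (degree (lab b')) ?i) A a' a)" .
    show "?L u s = ?R u s"
    proof (cases "d' = d \<and> pd (Z2_mult ?i ?j) B b' b \<noteq> 0 \<and> pd (Z2_mult (degree (lab b')) ?i) A a' a \<noteq> 0")
      case True
      then have lb: "lab b' = h_simple ?i (lab b)"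
        using mat_hhomD[OF pd_in[OF B], of "Z2_mult ?i ?j" b' b] by (simp add: h_simple_Z2_mult)
      then have la: "lab a' = h_simple ?j (lab a)"
        using True mat_hhomD[OF pd_in[OF A], of "Z2_mult (degree (lab b')) ?i" a' a] by (simp add: h_simple_Z2_mult)
      show ?thesis
        using True twist_sym[OF *(5)] unfolding L Rus by (simp add: la lb Z2_mult_commute mult_ac)
    next
      case False
      then have "d' \<noteq> d \<or> pd (Z2_mult ?i ?j) A a' a * pd (Z2_mult ?i ?j) B b' b = 0"
      proof -
        have "degree (lab b') = ?j" if "pd (Z2_mult ?i ?j) B b' b \<noteq> 0"
          using mat_hhomD[OF pd_in[OF B] that] by simp
        then show ?thesis
          using False by (auto simp: Z2_mult_commute)
      qed
      then show ?thesis
        using False unfolding L Rus by auto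
    qed
  qed
qed

text \<open>Only the summand \<open>Vec 0\<close> reaches the unit, so the two legs carry dual
  labels. On Vec labels both twists are the same scalar. On twisted labels each twist is \<beta>
  times the action of g, and invariance of ev moves an involution from one leg to the other.\<close>

lemma twist_dual_E:
  assumes A: "eob A" and A': "eob A'" and ev: "ev \<in> ehom (tobj E A' A) (unit E)"
  shows "mat_mult ev (mat_tens \<delta> (tw A') (mat_id (fst A))) = mat_mult ev (mat_tens \<delta> (mat_id (fst A')) (tw A))"
    (is "?L = ?R")
proof -
  let ?S = "tens \<delta> (fst A') (fst A)"
  note fin = eob_finite[OF A] eob_finite[OF A']
  have T: "mat_tens \<delta> (tw A') (mat_id (fst A)) \<in> mat_hom ?S ?S" "mat_tens \<delta> (mat_id (fst A')) (tw A) \<in> mat_hom ?S ?S"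
    unfolding mat_tens_eq_gtens mat_hhom_1[symmetric]
    by (intro gtens_in; simp add: mat_hhom_1 mat_id_in tw_in A A')+
  have ev_in: "ev \<in> mat_hom ?S unit_obj"
    using ehom_in[OF ev] by (simp add: fst_tobj unit_ob)
  have ev_eq: "mat_mult ev (gact (tobj E A' A)) = ev"
  proof -
    have "mat_mult ev (gact (tobj E A' A)) = mat_mult (mat_id unit_obj) ev"
      using ehom_eq[OF ev] by (simp add: unit_ob)
    also have "\<dots> = ev"
      using mat_homD[OF ev_in] by (intro mat_id_left ehom_colfin[OF ev unit_ob(1)]) auto
    finally show ?thesis .
  qed
  show ?thesis
  proof (rule mat_hom_eqI[OF mat_mult_in[OF T(1) ev_in] mat_mult_in[OF T(2) ev_in]])
    fix u s assume "u \<in> unit_obj" "s \<in> ?S" "lab u = lab s"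
    then obtain a b d where d: "s = Node a b d" "a \<in> fst A'" "b \<in> fst A" "d \<in> fus \<delta> (lab a) (lab b)"
      by (elim tensE)
    have u: "u = Leaf 0 (Vec 0)"
      using \<open>u \<in> unit_obj\<close> by (simp add: unit_obj_iff)
    have "d = Vec 0"
      using \<open>lab u = lab s\<close> by (simp add: u d(1))
    note * = u d[unfolded \<open>d = Vec 0\<close>]
    let ?e = "\<lambda>x y. ev u (Node x y (Vec 0))"
    have L: "?L u s = (\<Sum>x\<in>fst A'. ?e x b * tw A' x a)"
    proof -
      have "?L u s = (\<Sum>x\<in>fst A'. \<Sum>y\<in>fst A. ?e x y * tw A' x a * mat_id (fst A) y b)"
        unfolding *(2) mat_tens_eq_gtens
        by (subst gtens_col[OF tw_in[OF A', folded mat_hhom_1] mat_id_hhom fin(2,1) *(5)]) simp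
      also have "\<dots> = (\<Sum>x\<in>fst A'. \<Sum>y\<in>fst A. if y = b then ?e x b * tw A' x a else 0)"
        using * by (intro sum.cong refl) (simp add: mat_id_def)
      finally show ?thesis
        using * fin by (simp add: sum.delta)
    qed
    have R: "?R u s = (\<Sum>y\<in>fst A. ?e a y * tw A y b)"
    proof -
      have "?R u s = (\<Sum>x\<in>fst A'. \<Sum>y\<in>fst A. ?e x y * mat_id (fst A') x a * tw A y b)"
        unfolding *(2) mat_tens_eq_gtens
        by (subst gtens_col[OF mat_id_hhom tw_in[OF A, folded mat_hhom_1] fin(2,1) *(5)]) simp
      also have "\<dots> = (\<Sum>y\<in>fst A. \<Sum>x\<in>fst A'. if x = a then ?e a y * tw A y b else 0)"
        using * by (subst sum.swap, intro sum.cong refl) (simp add: mat_id_def)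
      finally show ?thesis
        using * fin by (simp add: sum.delta)
    qed
    show "?L u s = ?R u s"
    proof (cases "lab a")
      case (Vec x)
      then have lb: "lab b = Vec (- x)"
        using *(5) by (cases "lab b") (auto simp: eq_neg_iff_add_eq_0 add.commute)
      have "twist_sym \<sigma> \<beta> (lab b) = twist_sym \<sigma> \<beta> (lab a)"
        using twist_sym_h[of Z2_g "lab a"] by (simp add: Vec lb)
      then show ?thesis
        unfolding L R using * fin by (simp add: tw_def Vec lb pd_simps mat_id_def sum.delta if_distrib cong: if_cong)
    next
      case (Tw x)
      then obtain y where lb: "lab b = Tw y"
        using *(5) by (cases "lab b") auto
      \<comment> \<open>Invariance of ev under g on both legs at once; for two twisted labels the
        tensor structure sign at the summand 0 is 1. Acting once more on the second leg leaves the
        action on the first leg only.\<close>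
      have inv: "?e a z = (\<Sum>v\<in>fst A'. \<Sum>w\<in>fst A. ?e v w * gact A' v a * gact A w z)" if z: "z \<in> fst A" "lab z = lab b" for z
      proof -
        have "?e a z = mat_mult ev (gact (tobj E A' A)) u (Node a z (Vec 0))"
          by (simp add: ev_eq)
        also have "\<dots> = \<tau> (lab a) (lab b) (Vec 0) * (\<Sum>v\<in>fst A'. \<Sum>w\<in>fst A. ev u (Node v w (g_simple (Vec 0))) * gact A' v a * gact A w z)"
          unfolding gact_tens[OF A' A] using *(5) z
          by (subst gtens_col[OF gact_in[OF A'] gact_in[OF A] fin(2,1)]) simp_all
        finally show ?thesis
          by (simp add: Tw lb W_simps)
      qed
      have "(\<Sum>z\<in>fst A. ?e a z * gact A z b) = (\<Sum>z\<in>fst A. (\<Sum>v\<in>fst A'. \<Sum>w\<in>fst A. ?e v w * gact A' v a * gact A w z) * gact A z b)"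
      proof (rule sum.cong[OF refl])
        fix z assume "z \<in> fst A"
        then show "?e a z * gact A z b = (\<Sum>v\<in>fst A'. \<Sum>w\<in>fst A. ?e v w * gact A' v a * gact A w z) * gact A z b"
          using inv[of z] mat_hhomD[OF gact_in[OF A], of z b] by (cases "gact A z b = 0") (simp_all add: lb)
      qed
      also have "\<dots> = (\<Sum>v\<in>fst A'. \<Sum>w\<in>fst A. \<Sum>z\<in>fst A. ?e v w * gact A' v a * (gact A w z * gact A z b))"
        unfolding sum_distrib_right by (subst sum.swap, rule sum.cong[OF refl], subst sum.swap) (simp add: mult_ac)
      also have "\<dots> = (\<Sum>v\<in>fst A'. \<Sum>w\<in>fst A. ?e v w * gact A' v a * mat_id (fst A) w b)"
        by (simp add: sum_distrib_left[symmetric] mat_hhom_mult_sum[OF gact_in[OF A] eob_finite[OF A], symmetric] gact_gact[OF A])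
      also have "\<dots> = (\<Sum>v\<in>fst A'. \<Sum>w\<in>fst A. if w = b then ?e v b * gact A' v a else 0)"
        using * by (intro sum.cong refl) (simp add: mat_id_def)
      also have "\<dots> = (\<Sum>v\<in>fst A'. ?e v b * gact A' v a)"
        using * fin by (simp add: sum.delta)
      finally have "(\<Sum>z\<in>fst A. ?e a z * gact A z b) = (\<Sum>v\<in>fst A'. ?e v b * gact A' v a)" .
      then have "\<beta> * (\<Sum>z\<in>fst A. ?e a z * gact A z b) = \<beta> * (\<Sum>v\<in>fst A'. ?e v b * gact A' v a)"
        by simp
      then show ?thesis
        unfolding L R by (simp add: tw_def Tw lb pd_simps sum_distrib_left mult_ac)
    qed
  qed
qed

end

section \<open>Direct sums and semisimplicity\<close>

text \<open>A direct sum needs disjoint copies of basis vectors with unchanged labels. The index of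
  the copy is stored in a left child whose label carries no meaning.\<close>

definition tag :: "nat \<Rightarrow> 'a::ab_group_add tree \<Rightarrow> 'a tree" where
  "tag i t = Node (Leaf i (Tw 0)) t (lab t)"

lemma tag_simps [simp]: "tag i s = tag j t \<longleftrightarrow> i = j \<and> s = t" "lab (tag i t) = lab t"
  by (auto simp: tag_def)

definition untag :: "'a tree \<Rightarrow> nat \<times> 'a tree" where
  "untag t = (case t of Node (Leaf i l) t' l' \<Rightarrow> (i, t') | _ \<Rightarrow> (0, t))"

lemma untag_tag [simp]: "untag (tag i t) = (i, t)"
  by (simp add: untag_def tag_def)

locale sum_construction =
  fixes As :: "('a::{finite, ab_group_add} tree set \<times> 'a mat) list"
  assumes ob: "A \<in> set As \<Longrightarrow> eob A"
begin

definition X where "X = (\<Union>i<length As. tag i ` fst (As ! i))"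

definition M where "M = (\<lambda>u s. if u \<in> X \<and> s \<in> X \<and> fst (untag u) = fst (untag s)
    then gact (As ! fst (untag s)) (snd (untag u)) (snd (untag s)) else 0)"

definition inc where "inc i = (\<lambda>u s. if s \<in> fst (As ! i) \<and> u = tag i s then 1 else 0 :: complex)"

definition pr where "pr i = (\<lambda>u s. if u \<in> fst (As ! i) \<and> s = tag i u then 1 else 0 :: complex)"

lemma ob_nth: "i < length As \<Longrightarrow> eob (As ! i)"
  by (simp add: ob)

lemma tag_in_X [simp]: "tag i t \<in> X \<longleftrightarrow> i < length As \<and> t \<in> fst (As ! i)"
  by (auto simp: X_def)

lemma XE:
  assumes "u \<in> X"
  obtains i t where "i < length As" "t \<in> fst (As ! i)" "u = tag i t"
  using assms by (auto simp: X_def)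

lemma finite_X: "finite X"
  by (simp add: X_def ob_nth eob_finite)

lemma M_tag [simp]: "i < length As \<Longrightarrow> s \<in> fst (As ! i) \<Longrightarrow> j < length As \<Longrightarrow> t \<in> fst (As ! j) \<Longrightarrow>
    M (tag i s) (tag j t) = (if i = j then gact (As ! i) s t else 0)"
  by (simp add: M_def)

lemma inc_in: "i < length As \<Longrightarrow> inc i \<in> mat_hom (fst (As ! i)) X"
  by (rule mat_homI) (auto simp: inc_def split: if_splits)

lemma pr_in: "i < length As \<Longrightarrow> pr i \<in> mat_hom X (fst (As ! i))"
  by (rule mat_homI) (auto simp: pr_def split: if_splits)

lemma inc_colfin: "colfin (inc i)"
  by (simp add: colfin_def inc_def)

lemma pr_colfin: "i < length As \<Longrightarrow> colfin (pr i)"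
  by (rule mat_hom_colfin[OF pr_in]) (simp_all add: ob_nth eob_finite)

lemma inc_col: "s \<in> fst (As ! i) \<Longrightarrow> mat_mult N (inc i) u s = N u (tag i s)"
proof -
  assume "s \<in> fst (As ! i)"
  moreover have "mat_mult N (inc i) u s = N u (tag i s) * inc i (tag i s) s"
    by (rule mat_mult_single[OF _ inc_colfin]) (auto simp: inc_def split: if_splits)
  ultimately show ?thesis
    by (simp add: inc_def)
qed

lemma pr_row: "u \<in> fst (As ! i) \<Longrightarrow> colfin N \<Longrightarrow> mat_mult (pr i) N u s = N (tag i u) s"
proof -
  assume "u \<in> fst (As ! i)" "colfin N"
  moreover from this(2) have "mat_mult (pr i) N u s = pr i u (tag i u) * N (tag i u) s"
    by (rule mat_mult_single[rotated]) (auto simp: pr_def split: if_splits)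
  ultimately show ?thesis
    by (simp add: pr_def)
qed

lemma inc_row: "t \<in> fst (As ! j) \<Longrightarrow> colfin N \<Longrightarrow> mat_mult (inc i) N (tag j t) s = (if i = j then N t s else 0)"
proof -
  assume "t \<in> fst (As ! j)" "colfin N"
  moreover from this(2) have "mat_mult (inc i) N (tag j t) s = inc i (tag j t) t * N t s"
    by (rule mat_mult_single[rotated]) (auto simp: inc_def split: if_splits)
  ultimately show ?thesis
    by (simp add: inc_def)
qed

lemma pr_col: "t \<in> fst (As ! j) \<Longrightarrow> i < length As \<Longrightarrow> mat_mult N (pr i) u (tag j t) = (if i = j then N u t else 0)"
proof -
  assume "t \<in> fst (As ! j)" "i < length As"
  moreover from this(2) have "mat_mult N (pr i) u (tag j t) = N u t * pr i t (tag j t)"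
    by (intro mat_mult_single[OF _ pr_colfin]) (auto simp: pr_def split: if_splits)
  ultimately show ?thesis
    by (simp add: pr_def)
qed

lemma inc_pr_tag: "k < length As \<Longrightarrow> t \<in> fst (As ! i) \<Longrightarrow> t' \<in> fst (As ! j) \<Longrightarrow>
    mat_mult (inc k) (pr k) (tag i t) (tag j t') = (if k = i \<and> i = j \<and> t = t' then 1 else 0)"
  by (simp add: inc_row pr_colfin) (simp add: pr_def)

lemma M_in: "M \<in> mat_hhom Z2_g X X"
proof (rule mat_hhomI)
  fix u s assume nz: "M u s \<noteq> 0"
  then have "u \<in> X" "s \<in> X"
    by (auto simp: M_def split: if_splits)
  then show "u \<in> X \<and> s \<in> X \<and> lab u = h_simple Z2_g (lab s)"
    using nz mat_hhomD[OF gact_in[OF ob_nth]] by (auto elim!: XE split: if_splits)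
qed

lemma M_colfin: "colfin M"
  by (rule mat_hhom_colfin[OF M_in finite_X])

lemma inc_M: "i < length As \<Longrightarrow> mat_mult (inc i) (gact (As ! i)) = mat_mult M (inc i)"
proof (rule mat_hhom_eqI)
  assume i: "i < length As"
  show "mat_mult (inc i) (gact (As ! i)) \<in> mat_hhom Z2_g (fst (As ! i)) X"
    using mat_hhom_mult[OF gact_in[OF ob_nth[OF i]] inc_in[OF i, folded mat_hhom_1]] by simp
  show "mat_mult M (inc i) \<in> mat_hhom Z2_g (fst (As ! i)) X"
    using mat_hhom_mult[OF inc_in[OF i, folded mat_hhom_1] M_in] by simp
  show "mat_mult (inc i) (gact (As ! i)) u s = mat_mult M (inc i) u s"
    if "u \<in> X" "s \<in> fst (As ! i)" for u s
    using that i by (auto elim!: XE simp: inc_row inc_col gact_colfin[OF ob_nth])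
qed

lemma pr_M: "i < length As \<Longrightarrow> mat_mult (pr i) M = mat_mult (gact (As ! i)) (pr i)"
proof (rule mat_hhom_eqI)
  assume i: "i < length As"
  show "mat_mult (pr i) M \<in> mat_hhom Z2_g X (fst (As ! i))"
    using mat_hhom_mult[OF M_in pr_in[OF i, folded mat_hhom_1]] by simp
  show "mat_mult (gact (As ! i)) (pr i) \<in> mat_hhom Z2_g X (fst (As ! i))"
    using mat_hhom_mult[OF pr_in[OF i, folded mat_hhom_1] gact_in[OF ob_nth[OF i]]] by simp
  show "mat_mult (pr i) M u s = mat_mult (gact (As ! i)) (pr i) u s"
    if "s \<in> X" "u \<in> fst (As ! i)" for u s
    using that i by (auto elim!: XE simp: pr_row pr_col M_colfin)
qed

lemma pr_inc:
  assumes "i < length As" "j < length As"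
  shows "mat_mult (pr i) (inc j) = (if i = j then mat_id (fst (As ! i)) else (\<lambda>u s. 0))"
proof (rule mat_hom_eqI[OF mat_mult_in[OF inc_in[OF assms(2)] pr_in[OF assms(1)]]])
  show "(if i = j then mat_id (fst (As ! i)) else (\<lambda>u s. 0)) \<in> mat_hom (fst (As ! j)) (fst (As ! i))"
    using mat_id_in by (auto simp: mat_hom_def)
qed (use assms in \<open>auto simp: inc_col pr_def mat_id_def\<close>)

lemma sum_inc_pr: "(\<Sum>i<length As. mat_mult (inc i) (pr i) u s) = mat_id X u s"
proof (cases "u \<in> X \<and> s \<in> X")
  case True
  then obtain i t j t' where *: "i < length As" "t \<in> fst (As ! i)" "u = tag i t"
    "j < length As" "t' \<in> fst (As ! j)" "s = tag j t'"
    by (auto elim!: XE)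
  have "mat_mult (inc k) (pr k) u s = (if k = i then (if i = j \<and> t = t' then 1 else 0) else 0)" if "k < length As" for k
    using * that by (auto simp: inc_pr_tag)
  then have "(\<Sum>k<length As. mat_mult (inc k) (pr k) u s) = (\<Sum>k<length As. if k = i then (if i = j \<and> t = t' then 1 else 0) else 0)"
    by (intro sum.cong refl) auto
  then show ?thesis
    using * by (simp add: sum.delta mat_id_def)
next
  case False
  have "mat_mult (inc k) (pr k) u s = 0" if "k < length As" for k
    using mat_homD[OF mat_mult_in[OF pr_in[OF that] inc_in[OF that]], of u s] False by auto
  then show ?thesis
    using False by (auto simp: mat_id_def)
qed

lemma M_M: "mat_mult M M = mat_id X"
proof (rule mat_hom_eqI[OF _ mat_id_in])
  show "mat_mult M M \<in> mat_hom X X"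
    using mat_hhom_mult[OF M_in M_in] by (simp add: mat_hhom_1)
  fix u s assume "u \<in> X" "s \<in> X"
  then obtain i t j t' where *: "i < length As" "t \<in> fst (As ! i)" "u = tag i t"
    "j < length As" "t' \<in> fst (As ! j)" "s = tag j t'"
    by (auto elim!: XE)
  have "mat_mult M M u s = mat_mult (mat_mult M M) (inc j) u t'"
    using * by (simp add: inc_col)
  also have "mat_mult (mat_mult M M) (inc j) = mat_mult (inc j) (mat_mult (gact (As ! j)) (gact (As ! j)))"
  proof -
    note cf = M_colfin inc_colfin gact_colfin[OF ob_nth[OF *(4)]]
    have "mat_mult (mat_mult M M) (inc j) = mat_mult M (mat_mult (inc j) (gact (As ! j)))"
      by (simp add: mat_mult_assoc cf inc_M[OF *(4), symmetric])
    also have "\<dots> = mat_mult (mat_mult (inc j) (gact (As ! j))) (gact (As ! j))"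
      by (simp add: mat_mult_assoc[symmetric] cf inc_M[OF *(4), symmetric])
    finally show ?thesis
      by (simp add: mat_mult_assoc cf)
  qed
  also have "\<dots> u t' = mat_id X u s"
    using * by (simp add: gact_gact ob_nth inc_row colfin_id) (simp add: mat_id_def)
  finally show "mat_mult M M u s = mat_id X u s" .
qed

lemma direct_sum_ob: "eob (X, pm M)" "gact (X, pm M) = M"
  using eobI[OF finite_X M_in M_M] by simp_all

end

context crossed_data
begin

lemma msum_E: "msum E fs = (\<lambda>u s. \<Sum>f\<leftarrow>fs. f u s)"
  by (induction fs) (simp_all add: msum_def E_simps)

lemma direct_sum_E:
  assumes "eob A" "\<And>i. i < length As \<Longrightarrow> inc i \<in> ehom (As ! i) A \<and> pr i \<in> ehom A (As ! i)"
    "\<And>i j. i < length As \<Longrightarrow> j < length As \<Longrightarrow>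
      mat_mult (pr i) (inc j) = (if i = j then mat_id (fst (As ! i)) else (\<lambda>u s. 0))"
    "\<And>u s. (\<Sum>i<length As. mat_mult (inc i) (pr i) u s) = mat_id (fst A) u s"
  shows "is_direct_sum E A As"
  unfolding is_direct_sum_def Hom_E E_simps(1,2,3) msum_E
proof (rule exI[of _ inc], rule exI[of _ pr], intro conjI)
  have "(\<Sum>f\<leftarrow>map (\<lambda>i. mat_mult (inc i) (pr i)) [0..<length As]. f u s) = mat_id (fst A) u s" for u s
    using assms(4)[of u s] by (simp add: o_def interv_sum_list_conv_sum_set_nat atLeast0LessThan)
  then show "(\<lambda>u s. \<Sum>f\<leftarrow>map (\<lambda>i. mat_mult (inc i) (pr i)) [0..<length As]. f u s) = mat_id (fst A)"
    by (intro ext)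
qed (use assms in auto)

lemma direct_sums_E:
  assumes "set As \<subseteq> Obj E"
  shows "\<exists>X\<in>Obj E. is_direct_sum E X As"
proof -
  interpret sum_construction As
    using assms by unfold_locales (auto simp: Obj_E)
  show ?thesis
    by (rule bexI[of _ "(X, pm M)"], rule direct_sum_E[where inc = inc and pr = pr])
      (auto simp: Obj_E direct_sum_ob pr_inc sum_inc_pr ehom_def inc_in pr_in inc_M pr_M)
qed

end

text \<open>
  The simple objects: a basis vector with label l together with its image under g, where g acts
  with sign e; e = -1 only gives something new if g fixes l.
\<close>

definition sX :: "'a::ab_group_add simple \<Rightarrow> 'a tree set" where
  "sX l = {Leaf 0 l, Leaf 0 (g_simple l)}"

definition sob :: "'a::ab_group_add simple \<Rightarrow> complex \<Rightarrow> 'a tree set \<times> 'a mat" where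
  "sob l e = (sX l, \<lambda>u s. e * mat_id (sX l) u s)"

definition simples :: "('a::ab_group_add tree set \<times> 'a mat) set" where
  "simples = {sob l e | l e. e = 1 \<or> (e = -1 \<and> g_simple l = l)}"

lemma fst_sob [simp]: "fst (sob l e) = sX l"
  by (simp add: sob_def)

lemma g_tree_eq_Leaf: "g_tree s = Leaf n l \<longleftrightarrow> s = Leaf n (g_simple l)"
  by (cases s) auto

lemma gact_sob: "gact (sob l e) u s = (if s \<in> sX l \<and> u = g_tree s then e else 0)"
  by (auto simp: gact_def sob_def pm_def mat_id_def sX_def g_tree_eq_Leaf)

lemma finite_sX: "finite (sX l)"
  by (simp add: sX_def)

lemma sX_lab_inj: "s \<in> sX l \<Longrightarrow> t \<in> sX l \<Longrightarrow> lab s = lab t \<Longrightarrow> s = t"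
  by (auto simp: sX_def)

lemma gact_sob_in: "gact (sob l e) \<in> mat_hhom Z2_g (sX l) (sX l)"
  by (rule mat_hhomI) (auto simp: gact_sob sX_def split: if_splits)

lemma gact_sob_row:
  assumes "s \<in> sX l"
  shows "mat_mult N (gact (sob l e)) u s = N u (g_tree s) * e"
proof -
  have "mat_mult N (gact (sob l e)) u s = N u (g_tree s) * gact (sob l e) (g_tree s) s"
    by (rule mat_mult_single[OF _ mat_hhom_colfin[OF gact_sob_in finite_sX]]) (auto simp: gact_sob split: if_splits)
  then show ?thesis
    using assms by (simp add: gact_sob)
qed

lemma gact_sob_col:
  assumes "u \<in> sX l" "colfin N"
  shows "mat_mult (gact (sob l e)) N u s = e * N (g_tree u) s"
proof -
  have "mat_mult (gact (sob l e)) N u s = gact (sob l e) u (g_tree u) * N (g_tree u) s"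
    by (rule mat_mult_single[OF _ assms(2)]) (auto simp: gact_sob split: if_splits)
  then show ?thesis
    using assms by (auto simp: gact_sob sX_def)
qed

lemma eob_sob:
  assumes "e * e = 1"
  shows "eob (sob l e)"
proof -
  have "mat_mult (gact (sob l e)) (gact (sob l e)) = mat_id (sX l)"
  proof (rule mat_hom_eqI[OF _ mat_id_in])
    show "mat_mult (gact (sob l e)) (gact (sob l e)) \<in> mat_hom (sX l) (sX l)"
      using mat_hhom_mult[OF gact_sob_in gact_sob_in] by (simp add: mat_hhom_1)
    show "mat_mult (gact (sob l e)) (gact (sob l e)) u s = mat_id (sX l) u s"
      if "u \<in> sX l" "s \<in> sX l" for u s
      using that assms by (auto simp: gact_sob_row gact_sob mat_id_def sX_def)
  qed
  then show ?thesis
    by (simp add: eob_def finite_sX gact_sob_in)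
qed

lemma simples_ob: "S \<in> simples \<Longrightarrow> eob S"
  by (auto simp: simples_def intro!: eob_sob)

lemma finite_simples: "finite (simples :: ('a::{finite, ab_group_add} tree set \<times> 'a mat) set)"
proof (rule finite_subset)
  show "(simples :: ('a tree set \<times> 'a mat) set) \<subseteq> case_prod sob ` (UNIV \<times> {1, -1 :: complex})"
  proof
    fix S :: "'a tree set \<times> 'a mat" assume "S \<in> simples"
    then obtain l e where "S = sob l e" "e = 1 \<or> e = -1"
      by (auto simp: simples_def)
    then show "S \<in> case_prod sob ` (UNIV \<times> {1, -1})"
      by (intro image_eqI[of _ _ "(l, e)"]) auto
  qed
qed simp

context crossed_data
begin

section \<open>Simplicity and Schur's lemma\<close>

lemma unit_simple: "unit E \<in> simples"
proof -
  have "unit E = sob (Vec 0) 1"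
    by (simp add: E_simps sob_def sX_def unit_obj_def)
  then show ?thesis
    by (auto simp: simples_def)
qed

lemma ehom_sob:
  assumes "f \<in> ehom (sob l e) (sob l' e')" "e' * e' = 1" "s \<in> sX l" "u \<in> sX l'"
  shows "f u (g_tree s) * e = e' * f (g_tree u) s"
proof -
  have "mat_mult f (gact (sob l e)) u s = mat_mult (gact (sob l' e')) f u s"
    by (simp add: ehom_eq[OF assms(1)])
  then show ?thesis
    using assms ehom_colfin[OF assms(1) eob_sob[OF assms(2)]] by (simp add: gact_sob_row gact_sob_col)
qed

text \<open>Distinct basis vectors of \<open>sX l\<close> have distinct labels, so an endomorphism
  is diagonal; commuting with g equates the entries along the orbit.\<close>

lemma is_simple_sob:
  assumes "e * e = 1"
  shows "is_simple E (sob l e)"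
  unfolding is_simple_def Obj_E Hom_E E_simps
proof (intro conjI equalityI subsetI)
  show "eob (sob l e)"
    by (rule eob_sob[OF assms])
  show "mat_id (fst (sob l e)) \<noteq> (\<lambda>u s. 0)"
  proof
    assume "mat_id (fst (sob l e)) = (\<lambda>u s. 0)"
    then have "mat_id (sX l) (Leaf 0 l) (Leaf 0 l) = 0"
      by simp
    then show False
      by (simp add: mat_id_def sX_def)
  qed
next
  fix f assume f: "f \<in> ehom (sob l e) (sob l e)"
  define c where "c = f (Leaf 0 l) (Leaf 0 l)"
  have eq: "f (g_tree (Leaf 0 l)) (g_tree (Leaf 0 l)) = c"
    using ehom_sob[OF f assms, of "Leaf 0 l" "g_tree (Leaf 0 l)"] assms by (auto simp: sX_def c_def)
  have "f = (\<lambda>u s. c * mat_id (sX l) u s)"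
  proof (rule mat_hom_eqI[OF ehom_in[OF f]])
    show "(\<lambda>u s. c * mat_id (sX l) u s) \<in> mat_hom (fst (sob l e)) (fst (sob l e))"
      by (simp add: mat_hom_smult mat_id_in)
    fix u s assume "u \<in> fst (sob l e)" "s \<in> fst (sob l e)" "lab u = lab s"
    then have "u = s" "s \<in> sX l"
      using sX_lab_inj[of u l s] by auto
    then show "f u s = c * mat_id (sX l) u s"
      using eq by (auto simp: mat_id_def sX_def c_def)
  qed
  then show "f \<in> {(\<lambda>u s. k * mat_id (fst (sob l e)) u s) | k. True}"
    by auto
next
  fix f assume "f \<in> {(\<lambda>u s. k * mat_id (fst (sob l e)) u s) | k. True}"
  then show "f \<in> ehom (sob l e) (sob l e)"
    using ehom_smult[OF eob_sob[OF assms] ehom_id[OF eob_sob[OF assms, of l]]] by auto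
qed

text \<open>A non-zero entry forces l and l' into one g-orbit, hence equal basis sets. The objects
  then differ only in the sign e, so l is fixed by g, and equivariance makes the entry equal to its
  own negative.\<close>

lemma ehom_simples_zero:
  assumes "A \<in> simples" "B \<in> simples" "A \<noteq> B" "f \<in> ehom A B"
  shows "f = (\<lambda>u s. 0)"
proof (rule ccontr)
  assume "f \<noteq> (\<lambda>u s. 0)"
  then obtain u s where nz: "f u s \<noteq> 0"
    by (auto simp: fun_eq_iff)
  obtain l e where A: "A = sob l e" "e = 1 \<or> (e = -1 \<and> g_simple l = l)"
    using assms(1) by (auto simp: simples_def)
  obtain l' e' where B: "B = sob l' e'" "e' = 1 \<or> (e' = -1 \<and> g_simple l' = l')"
    using assms(2) by (auto simp: simples_def)
  have us: "u \<in> sX l'" "s \<in> sX l" "lab u = lab s"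
    using mat_homD[OF ehom_in[OF assms(4)] nz] by (simp_all add: A B)
  then have l: "l' = l \<or> l' = g_simple l"
    by (auto simp: sX_def)
  then have X: "sX l' = sX l"
    by (auto simp: sX_def)
  have "e \<noteq> e'"
    using assms(3) X by (auto simp: A B sob_def)
  then have g: "g_simple l = l" "e' = - e" "e' * e' = 1"
    using A(2) B(2) l by auto
  then have "u = Leaf 0 l" "s = Leaf 0 l"
    using us X by (auto simp: sX_def)
  then have "f u s * e = e' * f u s"
    using ehom_sob[OF assms(4)[unfolded A B] g(3) us(2,1)] g by simp
  then show False
    using nz g by (auto simp: add_eq_0_iff2)
qed

end

section \<open>Splitting simple summands off an idempotent\<close>

definition rows :: "'a mat \<Rightarrow> 'a tree set" where
  "rows M = {u. \<exists>s. M u s \<noteq> 0}"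

text \<open>For an equivariant idempotent p and e = 1 or -1 this is twice the projection onto the
  e-eigenspace of g in the image of p; for e = 0 it is p.\<close>

definition epr :: "'a::ab_group_add tree set \<times> 'a mat \<Rightarrow> 'a mat \<Rightarrow> complex \<Rightarrow> 'a mat" where
  "epr A p e = (\<lambda>u s. p u s + e * mat_mult (gact A) p u s)"

text \<open>The termination measure. Splitting off a two-element orbit clears a row of p, while a
  fixed label only clears a row of p + G p or p - G p; counting all three makes either kind of step
  a decrease.\<close>

definition erank :: "'a::ab_group_add tree set \<times> 'a mat \<Rightarrow> 'a mat \<Rightarrow> nat" where
  "erank A p = (\<Sum>e\<in>{0, 1, -1}. card (rows (epr A p e)))"

lemma epr_colfin: "eob A \<Longrightarrow> colfin p \<Longrightarrow> colfin (epr A p e)"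
  unfolding epr_def by (intro colfin_add colfin_smult colfin_mult gact_colfin)

lemma epr_mult:
  assumes "eob A" "colfin p" "colfin N"
  shows "mat_mult (epr A p e) N = epr A (mat_mult p N) e"
  unfolding epr_def by (simp add: mat_mult_add_left mat_mult_smult_left mat_mult_assoc assms gact_colfin)

lemma epr_minus:
  assumes "eob A" "colfin p" "colfin p'"
  shows "epr A (\<lambda>u s. p u s - p' u s) e = (\<lambda>u s. epr A p e u s - epr A p' e u s)"
proof -
  have "mat_mult (gact A) (\<lambda>u s. p u s - p' u s) = (\<lambda>u s. mat_mult (gact A) p u s - mat_mult (gact A) p' u s)"
    using mat_mult_add_right[OF assms(2) colfin_smult[OF assms(3), of "-1"], of "gact A"]
      mat_mult_smult_right[OF assms(3), of "gact A" "-1"] by simp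
  then show ?thesis
    by (simp add: epr_def algebra_simps)
qed

lemma rows_epr: "eob A \<Longrightarrow> p \<in> mat_hom (fst A) (fst A) \<Longrightarrow> rows (epr A p e) \<subseteq> fst A"
proof
  fix u assume *: "eob A" "p \<in> mat_hom (fst A) (fst A)" "u \<in> rows (epr A p e)"
  then obtain s where "epr A p e u s \<noteq> 0"
    by (auto simp: rows_def)
  then have "p u s \<noteq> 0 \<or> mat_mult (gact A) p u s \<noteq> 0"
    by (auto simp: epr_def)
  then show "u \<in> fst A"
    using mat_homD[OF *(2)] mat_hhomD[OF gact_in[OF *(1)]] by (auto elim!: mat_mult_nonzeroE)
qed

text \<open>As p N = N, subtracting N changes \<open>epr A p e'\<close> by its own product with N,
  so zero rows stay zero for each of the three values of e'. The row u, on which both agree for e,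
  becomes zero.\<close>

lemma erank_less:
  assumes A: "eob A" and p: "p \<in> ehom A A" and N: "N \<in> mat_hom (fst A) (fst A)" and pN: "mat_mult p N = N"
    and e: "e \<in> {0, 1, -1}" and u: "u \<in> rows (epr A p e)" "\<And>s. epr A p e u s = mat_mult (epr A p e) N u s"
  shows "erank A (\<lambda>u s. p u s - N u s) < erank A p"
proof -
  have cp: "colfin p" and cN: "colfin N"
    using mat_hom_colfin[OF ehom_in[OF p]] mat_hom_colfin[OF N] eob_finite[OF A] by auto
  have eq: "epr A (\<lambda>u s. p u s - N u s) e' = (\<lambda>u s. epr A p e' u s - mat_mult (epr A p e') N u s)" for e'
    by (simp add: epr_minus[OF A cp cN] epr_mult[OF A cp cN] pN)
  have sub: "rows (epr A (\<lambda>u s. p u s - N u s) e') \<subseteq> rows (epr A p e')" for e'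
  proof
    fix u assume "u \<in> rows (epr A (\<lambda>u s. p u s - N u s) e')"
    then obtain s where "epr A p e' u s - mat_mult (epr A p e') N u s \<noteq> 0"
      by (auto simp: rows_def eq)
    then have "epr A p e' u s \<noteq> 0 \<or> mat_mult (epr A p e') N u s \<noteq> 0"
      by auto
    then show "u \<in> rows (epr A p e')"
      by (auto simp: rows_def elim!: mat_mult_nonzeroE)
  qed
  have fin: "finite (rows (epr A p e'))" for e'
    using rows_epr[OF A ehom_in[OF p]] eob_finite[OF A] finite_subset by blast
  have "u \<notin> rows (epr A (\<lambda>u s. p u s - N u s) e)"
    using u(2) by (auto simp: rows_def eq)
  then have "rows (epr A (\<lambda>u s. p u s - N u s) e) \<subset> rows (epr A p e)"
    using sub u(1) by blast
  then have "card (rows (epr A (\<lambda>u s. p u s - N u s) e)) < card (rows (epr A p e))"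
    by (rule psubset_card_mono[OF fin])
  then show ?thesis
    unfolding erank_def using e by (intro sum_strict_mono_ex1) (auto intro: card_mono[OF fin sub])
qed

text \<open>Elimination with pivot p u0 s0. The summand is spanned by column s0 of p and its
  g-image, and its coordinates are row u0 of p and of p G divided by the pivot. The label of s0 is
  not fixed by g, so the two vectors do not interfere.\<close>

lemma split_simple_free:
  assumes A: "eob A" and p: "p \<in> ehom A A" and pp: "mat_mult p p = p"
    and nz: "p u0 s0 \<noteq> 0" and l: "g_simple (lab s0) \<noteq> lab s0"
  obtains S i r where "S \<in> simples" "i \<in> ehom S A" "r \<in> ehom A S" "mat_mult r i = mat_id (fst S)"
    "mat_mult p i = i" "mat_mult r p = r" "erank A (\<lambda>u s. p u s - mat_mult i r u s) < erank A p"
proof -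
  let ?G = "gact A" and ?X = "fst A" and ?l = "lab s0"
  let ?L = "Leaf 0 ?l" and ?L' = "Leaf 0 (g_simple ?l)" and ?c = "p u0 s0"
  define i where "i = (\<lambda>u t. if t = ?L then p u s0 else if t = ?L' then mat_mult ?G p u s0 else 0)"
  define r where "r = (\<lambda>t s. if t = ?L then p u0 s / ?c else if t = ?L' then mat_mult p ?G u0 s / ?c else 0)"
  have fin: "finite ?X"
    by (rule eob_finite[OF A])
  have p1: "p \<in> mat_hhom Z2_1 ?X ?X"
    using ehom_in[OF p] by (simp add: mat_hhom_1)
  have Gp: "mat_mult ?G p \<in> mat_hhom Z2_g ?X ?X" and pG: "mat_mult p ?G = mat_mult ?G p"
    using mat_hhom_mult[OF p1 gact_in[OF A]] ehom_eq[OF p] by simp_all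
  have cp: "colfin p" and cG: "colfin ?G"
    using ehom_colfin[OF p A] gact_colfin[OF A] by auto
  have lu: "lab u0 = ?l" "u0 \<in> ?X" "s0 \<in> ?X"
    using mat_hhomD[OF p1 nz] by auto
  have ll: "?L \<noteq> ?L'"
    using l by simp
  have X: "sX ?l = {?L, ?L'}"
    by (simp add: sX_def)
  have GG: "mat_mult ?G (mat_mult ?G p) = p" and pGG: "mat_mult (mat_mult p ?G) ?G = p"
  proof -
    show "mat_mult ?G (mat_mult ?G p) = p"
      using mat_hhomD[OF p1] by (simp add: mat_mult_assoc[symmetric] cG cp gact_gact[OF A] mat_id_left)
    show "mat_mult (mat_mult p ?G) ?G = p"
      using mat_hhomD[OF p1] by (simp add: mat_mult_assoc cG cp gact_gact[OF A] mat_id_right)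
  qed
  have i_in: "i \<in> mat_hom (sX ?l) ?X"
    using mat_hhomD[OF p1, of _ s0] mat_hhomD[OF Gp, of _ s0]
    by (intro mat_homI) (auto simp: i_def X split: if_splits)
  have r_in: "r \<in> mat_hom ?X (sX ?l)"
  proof (rule mat_homI)
    fix t s assume "r t s \<noteq> 0"
    then have "(t = ?L \<and> p u0 s \<noteq> 0) \<or> (t = ?L' \<and> mat_mult ?G p u0 s \<noteq> 0)"
      using pG by (auto simp: r_def split: if_splits)
    then show "t \<in> sX ?l \<and> s \<in> ?X \<and> lab t = lab s"
      using mat_hhomD[OF p1, of u0 s] mat_hhomD[OF Gp, of u0 s] lu by (auto simp: X)
  qed
  have ci: "colfin i" and cr: "colfin r"
    using mat_hom_colfin[OF i_in fin] mat_hom_colfin[OF r_in finite_sX] by auto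
  have Ni: "mat_mult N i u ?L = mat_mult N p u s0" "mat_mult N i u ?L' = mat_mult N (mat_mult ?G p) u s0" for N u
    using ll by (simp_all add: mat_mult_def i_def)
  have rN: "mat_mult r N ?L s = mat_mult p N u0 s / ?c" "mat_mult r N ?L' s = mat_mult (mat_mult p ?G) N u0 s / ?c" for N s
    unfolding mat_mult_def[of r] mat_mult_def[of p N] mat_mult_def[of "mat_mult p ?G" N]
    using ll by (simp_all add: r_def sum_divide_distrib)
  \<comment> \<open>G p changes labels by g, whereas u0 and s0 have the same label and g moves it.
    This makes the off-diagonal entries of r i vanish.\<close>
  have zero: "mat_mult ?G p u0 s0 = 0"
    using mat_hhomD[OF Gp, of u0 s0] lu l by auto
  have S: "sob ?l 1 \<in> simples"
    by (auto simp: simples_def)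
  have ei: "i \<in> ehom (sob ?l 1) A"
  proof -
    have "mat_mult i (gact (sob ?l 1)) = mat_mult ?G i"
    proof (rule mat_hhom_eqI)
      show "mat_mult i (gact (sob ?l 1)) \<in> mat_hhom Z2_g (sX ?l) ?X"
        using mat_hhom_mult[OF gact_sob_in i_in[folded mat_hhom_1]] by simp
      show "mat_mult ?G i \<in> mat_hhom Z2_g (sX ?l) ?X"
        using mat_hhom_mult[OF i_in[folded mat_hhom_1] gact_in[OF A]] by simp
      show "mat_mult i (gact (sob ?l 1)) u s = mat_mult ?G i u s" if "s \<in> sX ?l" for u s
        using that ll by (auto simp: gact_sob_row X Ni GG) (auto simp: i_def)
    qed
    then show ?thesis
      using i_in by (simp add: ehom_def)
  qed
  have er: "r \<in> ehom A (sob ?l 1)"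
  proof -
    have "mat_mult r ?G = mat_mult (gact (sob ?l 1)) r"
    proof (rule mat_hhom_eqI)
      show "mat_mult r ?G \<in> mat_hhom Z2_g ?X (sX ?l)"
        using mat_hhom_mult[OF gact_in[OF A] r_in[folded mat_hhom_1]] by simp
      show "mat_mult (gact (sob ?l 1)) r \<in> mat_hhom Z2_g ?X (sX ?l)"
        using mat_hhom_mult[OF r_in[folded mat_hhom_1] gact_sob_in] by simp
      show "mat_mult r ?G t s = mat_mult (gact (sob ?l 1)) r t s" if "t \<in> sX ?l" for t s
        using that ll by (auto simp: gact_sob_col[OF _ cr] X rN pGG) (auto simp: r_def)
    qed
    then show ?thesis
      using r_in by (simp add: ehom_def)
  qed
  have ri: "mat_mult r i = mat_id (sX ?l)"
  proof (rule mat_hom_eqI[OF mat_mult_in[OF i_in r_in] mat_id_in])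
    fix t s assume "t \<in> sX ?l" "s \<in> sX ?l"
    moreover have "mat_mult (mat_mult p ?G) (mat_mult ?G p) = p"
      by (simp add: mat_mult_assoc cp cG colfin_mult GG pp)
    moreover have "mat_mult p (mat_mult ?G p) = mat_mult ?G p" "mat_mult (mat_mult p ?G) p = mat_mult ?G p"
      by (simp_all add: mat_mult_assoc[symmetric] cp cG pG) (simp_all add: mat_mult_assoc cp cG pp)
    ultimately show "mat_mult r i t s = mat_id (sX ?l) t s"
      using ll l nz zero by (auto simp: X rN Ni pp mat_id_def)
  qed
  have pi: "mat_mult p i = i"
  proof (rule mat_hom_eqI[OF mat_mult_in[OF i_in ehom_in[OF p]] i_in])
    fix u s assume "s \<in> sX ?l"
    moreover have "mat_mult p (mat_mult ?G p) = mat_mult ?G p"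
      by (simp add: mat_mult_assoc[symmetric] cp cG pG) (simp add: mat_mult_assoc cp cG pp)
    ultimately show "mat_mult p i u s = i u s"
      using ll by (auto simp: X Ni pp) (auto simp: i_def)
  qed
  have rp: "mat_mult r p = r"
  proof (rule mat_hom_eqI[OF mat_mult_in[OF ehom_in[OF p] r_in] r_in])
    fix t s assume "t \<in> sX ?l"
    moreover have "mat_mult (mat_mult p ?G) p = mat_mult ?G p"
      by (simp add: pG) (simp add: mat_mult_assoc cp cG pp)
    ultimately show "mat_mult r p t s = r t s"
      using ll by (auto simp: X rN pp pG) (auto simp: r_def pG)
  qed
  have "erank A (\<lambda>u s. p u s - mat_mult i r u s) < erank A p"
  proof (rule erank_less[OF A p mat_mult_in[OF r_in i_in], of 0 u0])
    show "mat_mult p (mat_mult i r) = mat_mult i r"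
      by (simp add: mat_mult_assoc[symmetric] cr ci pi)
    show "u0 \<in> rows (epr A p 0)"
      using nz by (auto simp: rows_def epr_def)
    fix s
    have "mat_mult p (mat_mult i r) u0 s = mat_mult i r u0 s"
      by (simp add: mat_mult_assoc[symmetric] cr ci pi)
    also have "\<dots> = (\<Sum>t\<in>sX ?l. i u0 t * r t s)"
      by (rule mat_hhom_mult_sum[OF r_in[folded mat_hhom_1] finite_sX])
    also have "\<dots> = p u0 s"
      using ll nz zero by (simp add: X i_def r_def)
    finally show "epr A p 0 u0 s = mat_mult (epr A p 0) (mat_mult i r) u0 s"
      by (simp add: epr_def)
  qed simp
  with S ei er ri pi rp show thesis
    by (intro that[of "sob ?l 1" i r]) simp_all
qed

text \<open>On a label fixed by g, the image of p may contain both eigenvalues of g, so p is first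
  cut down to Q = p + e G p. The two choices of e add up to 2 p, so at least one of them has a
  non-zero pivot.\<close>

lemma split_simple_fixed:
  assumes A: "eob A" and p: "p \<in> ehom A A" and pp: "mat_mult p p = p"
    and nz: "p u0 s0 \<noteq> 0" and l: "g_simple (lab s0) = lab s0"
  obtains S i r where "S \<in> simples" "i \<in> ehom S A" "r \<in> ehom A S" "mat_mult r i = mat_id (fst S)"
    "mat_mult p i = i" "mat_mult r p = r" "erank A (\<lambda>u s. p u s - mat_mult i r u s) < erank A p"
proof -
  let ?G = "gact A" and ?X = "fst A" and ?l = "lab s0"
  let ?L = "Leaf 0 ?l"
  have "epr A p 1 u0 s0 + epr A p (-1) u0 s0 = 2 * p u0 s0"
    by (simp add: epr_def)
  then have "epr A p 1 u0 s0 \<noteq> 0 \<or> epr A p (-1) u0 s0 \<noteq> 0"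
    using nz by auto
  then obtain e where e: "e = 1 \<or> e = -1" and Qnz: "epr A p e u0 s0 \<noteq> 0"
    by blast
  have ee: "e * e = 1"
    using e by auto
  define Q where "Q = epr A p e"
  let ?c = "Q u0 s0"
  have cnz: "?c \<noteq> 0"
    using Qnz by (simp add: Q_def)
  define i where "i = (\<lambda>u t. if t = ?L then Q u s0 else 0)"
  \<comment> \<open>The factor 2 compensates Q Q = 2 Q.\<close>
  define r where "r = (\<lambda>t s. if t = ?L then Q u0 s / (2 * ?c) else 0)"
  have fin: "finite ?X"
    by (rule eob_finite[OF A])
  have p1: "p \<in> mat_hhom Z2_1 ?X ?X"
    using ehom_in[OF p] by (simp add: mat_hhom_1)
  have Gp: "mat_mult ?G p \<in> mat_hhom Z2_g ?X ?X" and pG: "mat_mult p ?G = mat_mult ?G p"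
    using mat_hhom_mult[OF p1 gact_in[OF A]] ehom_eq[OF p] by simp_all
  have cp: "colfin p" and cG: "colfin ?G"
    using ehom_colfin[OF p A] gact_colfin[OF A] by auto
  have cQ: "colfin Q"
    unfolding Q_def by (rule epr_colfin[OF A cp])
  have lu: "lab u0 = ?l" "u0 \<in> ?X" "s0 \<in> ?X"
    using mat_hhomD[OF p1 nz] by auto
  have GG: "mat_mult ?G (mat_mult ?G p) = p"
    using mat_hhomD[OF p1] by (simp add: mat_mult_assoc[symmetric] cG cp gact_gact[OF A] mat_id_left)
  have GQ: "mat_mult ?G Q = (\<lambda>u s. e * Q u s)"
    unfolding Q_def epr_def
    using e by (auto simp: mat_mult_add_right[OF cp colfin_smult[OF colfin_mult[OF cp cG]], of _ e]
        mat_mult_smult_right[OF colfin_mult[OF cp cG]] GG fun_eq_iff)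
  have pQ: "mat_mult p Q = Q"
    unfolding Q_def epr_def
    by (simp add: mat_mult_add_right[OF cp colfin_smult[OF colfin_mult[OF cp cG]]]
        mat_mult_smult_right[OF colfin_mult[OF cp cG]] pp)
      (simp add: mat_mult_assoc[symmetric] cp cG pG, simp add: mat_mult_assoc cp cG pp)
  have Qp: "mat_mult Q p = Q"
    unfolding Q_def epr_mult[OF A cp cp] pp ..
  have QG: "mat_mult Q ?G = (\<lambda>u s. e * Q u s)"
  proof -
    have "mat_mult Q ?G = epr A (mat_mult ?G p) e"
      unfolding Q_def epr_mult[OF A cp cG] pG ..
    then show ?thesis
      using e by (auto simp: epr_def GG Q_def fun_eq_iff)
  qed
  have QQ: "mat_mult Q Q = (\<lambda>u s. 2 * Q u s)"
  proof -
    have "mat_mult Q Q = epr A Q e"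
      unfolding Q_def epr_mult[OF A cp epr_colfin[OF A cp]] pQ[unfolded Q_def] ..
    then show ?thesis
      using ee by (simp add: epr_def GQ mult.assoc[symmetric])
  qed
  have X: "sX ?l = {?L}"
    using l by (simp add: sX_def)
  have Qlab: "u \<in> ?X \<and> s \<in> ?X \<and> (lab u = lab s \<or> lab u = g_simple (lab s))" if "Q u s \<noteq> 0" for u s
  proof -
    have "p u s \<noteq> 0 \<or> mat_mult ?G p u s \<noteq> 0"
      using that by (auto simp: Q_def epr_def)
    then show ?thesis
      using mat_hhomD[OF p1] mat_hhomD[OF Gp] by auto
  qed
  have i_in: "i \<in> mat_hom (sX ?l) ?X"
    using Qlab[of _ s0] l by (intro mat_homI) (auto simp: i_def X split: if_splits)
  have r_in: "r \<in> mat_hom ?X (sX ?l)"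
  proof (rule mat_homI)
    fix t s assume "r t s \<noteq> 0"
    then have t: "t = ?L" and "Q u0 s \<noteq> 0"
      by (auto simp: r_def split: if_splits)
    then have "s \<in> ?X" "lab u0 = lab s \<or> lab u0 = g_simple (lab s)"
      using Qlab by auto
    moreover from this(2) have "lab s = ?l"
      using lu(1) l by (metis g_simple_g_simple)
    ultimately show "t \<in> sX ?l \<and> s \<in> ?X \<and> lab t = lab s"
      by (simp add: X t)
  qed
  have ci: "colfin i" and cr: "colfin r"
    using mat_hom_colfin[OF i_in fin] mat_hom_colfin[OF r_in finite_sX] by auto
  have Ni: "mat_mult N i u ?L = mat_mult N Q u s0" for N u
    by (simp add: mat_mult_def i_def)
  have rN: "mat_mult r N ?L s = mat_mult Q N u0 s / (2 * ?c)" for N s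
    unfolding mat_mult_def[of r] mat_mult_def[of Q N] by (simp add: r_def sum_divide_distrib)
  have gL: "g_tree ?L = ?L"
    by (simp add: l)
  have S: "sob ?l e \<in> simples"
    using e l by (auto simp: simples_def)
  have ei: "i \<in> ehom (sob ?l e) A"
  proof -
    have "mat_mult i (gact (sob ?l e)) = mat_mult ?G i"
    proof (rule mat_hhom_eqI)
      show "mat_mult i (gact (sob ?l e)) \<in> mat_hhom Z2_g (sX ?l) ?X"
        using mat_hhom_mult[OF gact_sob_in i_in[folded mat_hhom_1]] by simp
      show "mat_mult ?G i \<in> mat_hhom Z2_g (sX ?l) ?X"
        using mat_hhom_mult[OF i_in[folded mat_hhom_1] gact_in[OF A]] by simp
      show "mat_mult i (gact (sob ?l e)) u s = mat_mult ?G i u s" if "s \<in> sX ?l" for u s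
        using that gL by (simp add: gact_sob_row X Ni GQ) (simp add: i_def)
    qed
    then show ?thesis
      using i_in by (simp add: ehom_def)
  qed
  have er: "r \<in> ehom A (sob ?l e)"
  proof -
    have "mat_mult r ?G = mat_mult (gact (sob ?l e)) r"
    proof (rule mat_hhom_eqI)
      show "mat_mult r ?G \<in> mat_hhom Z2_g ?X (sX ?l)"
        using mat_hhom_mult[OF gact_in[OF A] r_in[folded mat_hhom_1]] by simp
      show "mat_mult (gact (sob ?l e)) r \<in> mat_hhom Z2_g ?X (sX ?l)"
        using mat_hhom_mult[OF r_in[folded mat_hhom_1] gact_sob_in] by simp
      show "mat_mult r ?G t s = mat_mult (gact (sob ?l e)) r t s" if "t \<in> sX ?l" for t s
        using that gL by (simp add: gact_sob_col[OF _ cr] X rN QG) (simp add: r_def)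
    qed
    then show ?thesis
      using r_in by (simp add: ehom_def)
  qed
  have ri: "mat_mult r i = mat_id (sX ?l)"
    by (rule mat_hom_eqI[OF mat_mult_in[OF i_in r_in] mat_id_in])
      (use cnz in \<open>simp add: X rN Ni QQ mat_id_def\<close>)
  have pi: "mat_mult p i = i"
    by (rule mat_hom_eqI[OF mat_mult_in[OF i_in ehom_in[OF p]] i_in])
      (simp add: X Ni pQ, simp add: i_def)
  have rp: "mat_mult r p = r"
  proof (rule mat_hom_eqI[OF mat_mult_in[OF ehom_in[OF p] r_in] r_in])
    fix t s assume "t \<in> sX ?l"
    then have t: "t = ?L"
      by (simp add: X)
    show "mat_mult r p t s = r t s"
      unfolding t rN Qp by (simp add: r_def)
  qed
  have "erank A (\<lambda>u s. p u s - mat_mult i r u s) < erank A p"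
  proof (rule erank_less[OF A p mat_mult_in[OF r_in i_in], of e u0])
    show "mat_mult p (mat_mult i r) = mat_mult i r"
      by (simp add: mat_mult_assoc[symmetric] cr ci pi)
    show "u0 \<in> rows (epr A p e)"
      using Qnz by (auto simp: rows_def)
    fix s
    have "mat_mult (epr A p e) (mat_mult i r) u0 s = mat_mult (mat_mult Q i) r u0 s"
      by (simp add: mat_mult_assoc cr ci Q_def)
    also have "\<dots> = (\<Sum>t\<in>sX ?l. mat_mult Q i u0 t * r t s)"
      by (rule mat_hhom_mult_sum[OF r_in[folded mat_hhom_1] finite_sX])
    also have "\<dots> = Q u0 s"
      using cnz by (simp add: X Ni QQ) (simp add: r_def)
    finally show "epr A p e u0 s = mat_mult (epr A p e) (mat_mult i r) u0 s"
      by (simp add: Q_def)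
  qed (use e in simp)
  with S ei er ri pi rp show thesis
    by (intro that[of "sob ?l e" i r]) simp_all
qed

text \<open>Stated for idempotents on a fixed object, so that no image or kernel has to be realised
  as a new object. After splitting off one simple summand, p - i r is again an equivariant
  idempotent, of smaller \<open>erank\<close>, and orthogonal to i and r; so the summands found
  later are orthogonal to the first.\<close>

lemma decompose:
  assumes A: "eob A"
  shows "p \<in> ehom A A \<Longrightarrow> mat_mult p p = p \<Longrightarrow>
    \<exists>Ss is rs. length is = length Ss \<and> length rs = length Ss \<and>
      (\<forall>j<length Ss. Ss ! j \<in> simples \<and> is ! j \<in> ehom (Ss ! j) A \<and> rs ! j \<in> ehom A (Ss ! j) \<and>
        mat_mult p (is ! j) = is ! j \<and> mat_mult (rs ! j) p = rs ! j) \<and>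
      (\<forall>j<length Ss. \<forall>k<length Ss. mat_mult (rs ! j) (is ! k) = (if j = k then mat_id (fst (Ss ! j)) else (\<lambda>u s. 0))) \<and>
      (\<forall>u s. (\<Sum>j<length Ss. mat_mult (is ! j) (rs ! j) u s) = p u s)"
proof (induction "erank A p" arbitrary: p rule: less_induct)
  case less
  show ?case
  proof (cases "p = (\<lambda>u s. 0)")
    case True
    then show ?thesis
      by (intro exI[of _ "[]"]) simp
  next
    case False
    then obtain u0 s0 where nz: "p u0 s0 \<noteq> 0"
      by (auto simp: fun_eq_iff)
    obtain S i r where S: "S \<in> simples" "i \<in> ehom S A" "r \<in> ehom A S" "mat_mult r i = mat_id (fst S)"
      "mat_mult p i = i" "mat_mult r p = r" "erank A (\<lambda>u s. p u s - mat_mult i r u s) < erank A p"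
    proof (cases "g_simple (lab s0) = lab s0")
      case True
      show thesis
        by (rule split_simple_fixed[OF A less.prems nz True]) (rule that)
    next
      case False
      show thesis
        by (rule split_simple_free[OF A less.prems nz False]) (rule that)
    qed
    define p' where "p' = (\<lambda>u s. p u s - mat_mult i r u s)"
    have eS: "eob S"
      by (rule simples_ob[OF S(1)])
    have ir: "mat_mult i r \<in> ehom A A"
      by (rule ehom_mult[OF A eS A S(3,2)])
    note cf = ehom_colfin[OF less.prems(1) A] ehom_colfin[OF S(2) A] ehom_colfin[OF S(3) eS] ehom_colfin[OF ir A]
    have p'_alt: "p' = (\<lambda>u s. p u s + (- 1) * mat_mult i r u s)"
      by (simp add: p'_def)
    have p'_in: "p' \<in> ehom A A"
      unfolding p'_alt by (rule ehom_add[OF A A less.prems(1) ehom_smult[OF A ir]])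
    have p'N: "mat_mult p' N = (\<lambda>u s. mat_mult p N u s - mat_mult (mat_mult i r) N u s)" for N
      unfolding p'_alt mat_mult_add_left mat_mult_smult_left by simp
    have Np': "mat_mult N p' = (\<lambda>u s. mat_mult N p u s - mat_mult N (mat_mult i r) u s)" for N
      unfolding p'_alt mat_mult_add_right[OF cf(1) colfin_smult[OF cf(4)]] mat_mult_smult_right[OF cf(4)] by simp
    have mult_id: "mat_mult (mat_id (fst S)) r = r" "mat_mult i (mat_id (fst S)) = i"
      using mat_homD[OF ehom_in[OF S(3)]] mat_homD[OF ehom_in[OF S(2)]]
      by (auto intro: mat_id_left[OF cf(3)] mat_id_right)
    have rp': "mat_mult r p' = (\<lambda>u s. 0)" and p'i: "mat_mult p' i = (\<lambda>u s. 0)"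
    proof -
      have "mat_mult r (mat_mult i r) = r" "mat_mult (mat_mult i r) i = i"
        by (simp add: mat_mult_assoc[symmetric] cf S mult_id) (simp add: mat_mult_assoc cf S mult_id)
      then show "mat_mult r p' = (\<lambda>u s. 0)" "mat_mult p' i = (\<lambda>u s. 0)"
        by (simp_all add: Np' p'N S)
    qed
    have pp': "mat_mult p p' = p'"
      by (simp add: Np' less.prems mat_mult_assoc[symmetric] cf S) (simp add: p'_def)
    have p'p: "mat_mult p' p = p'"
      by (simp add: p'N less.prems mat_mult_assoc cf S) (simp add: p'_def)
    have "mat_mult p' p' = p'"
    proof -
      have "mat_mult (mat_mult i r) p' = (\<lambda>u s. 0)"
        by (simp add: mat_mult_assoc cf rp' mat_mult_0 ehom_colfin[OF p'_in A])
      then show ?thesis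
        by (simp add: p'N[of p'] pp')
    qed
    from less.hyps[OF S(7)[folded p'_def] p'_in this]
    obtain Ss "is" rs where len: "length is = length Ss" "length rs = length Ss"
      and IH: "\<And>j. j < length Ss \<Longrightarrow> Ss ! j \<in> simples \<and> is ! j \<in> ehom (Ss ! j) A \<and> rs ! j \<in> ehom A (Ss ! j) \<and>
        mat_mult p' (is ! j) = is ! j \<and> mat_mult (rs ! j) p' = rs ! j"
      and orth: "\<And>j k. j < length Ss \<Longrightarrow> k < length Ss \<Longrightarrow>
        mat_mult (rs ! j) (is ! k) = (if j = k then mat_id (fst (Ss ! j)) else (\<lambda>u s. 0))"
      and sum: "\<And>u s. (\<Sum>j<length Ss. mat_mult (is ! j) (rs ! j) u s) = p' u s"
      by blast
    have IH2: "mat_mult p (is ! j) = is ! j" "mat_mult (rs ! j) p = rs ! j"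
      "mat_mult r (is ! j) = (\<lambda>u s. 0)" "mat_mult (rs ! j) i = (\<lambda>u s. 0)" if j: "j < length Ss" for j
    proof -
      have Sj: "Ss ! j \<in> simples" "is ! j \<in> ehom (Ss ! j) A" "rs ! j \<in> ehom A (Ss ! j)"
        using IH[OF j] by auto
      note c = ehom_colfin[OF Sj(2) A] ehom_colfin[OF Sj(3) simples_ob[OF Sj(1)]] ehom_colfin[OF p'_in A]
      have "mat_mult p (mat_mult p' (is ! j)) = mat_mult p' (is ! j)"
        by (simp add: mat_mult_assoc[symmetric] c pp')
      then show "mat_mult p (is ! j) = is ! j"
        using IH[OF j] by simp
      have "mat_mult (mat_mult (rs ! j) p') p = mat_mult (rs ! j) p'"
        by (simp add: mat_mult_assoc c cf p'p)
      then show "mat_mult (rs ! j) p = rs ! j"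
        using IH[OF j] by simp
      have "mat_mult r (mat_mult p' (is ! j)) = (\<lambda>u s. 0)"
        by (simp add: mat_mult_assoc[symmetric] c rp' mat_mult_0)
      then show "mat_mult r (is ! j) = (\<lambda>u s. 0)"
        using IH[OF j] by simp
      have "mat_mult (mat_mult (rs ! j) p') i = (\<lambda>u s. 0)"
        by (simp add: mat_mult_assoc c cf p'i mat_mult_0)
      then show "mat_mult (rs ! j) i = (\<lambda>u s. 0)"
        using IH[OF j] by simp
    qed
    show ?thesis
    proof (rule exI[of _ "S # Ss"], rule exI[of _ "i # is"], rule exI[of _ "r # rs"], intro conjI allI impI)
      show "(\<Sum>j<length (S # Ss). mat_mult ((i # is) ! j) ((r # rs) ! j) u s) = p u s" for u s
        unfolding length_Cons sum.lessThan_Suc_shift using sum[of u s] by (simp add: p'_def)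
    next
      fix j k assume "j < length (S # Ss)" "k < length (S # Ss)"
      then show "mat_mult ((r # rs) ! j) ((i # is) ! k) = (if j = k then mat_id (fst ((S # Ss) ! j)) else (\<lambda>u s. 0))"
        using orth IH2 S(4) by (cases j; cases k) auto
    qed (use len IH IH2 S in \<open>auto simp: nth_Cons split: nat.splits\<close>)
  qed
qed

context crossed_data
begin

lemma semisimple_E:
  assumes A: "eob A"
  shows "\<exists>As. set As \<subseteq> simples \<and> is_direct_sum E A As"
proof -
  have "mat_mult (mat_id (fst A)) (mat_id (fst A)) = mat_id (fst A)"
    by (rule mat_id_right) (auto simp: mat_id_def split: if_splits)
  from decompose[OF A ehom_id[OF A] this]
  obtain Ss "is" rs where len: "length is = length Ss" "length rs = length Ss"
    and IH: "\<And>j. j < length Ss \<Longrightarrow> Ss ! j \<in> simples \<and> is ! j \<in> ehom (Ss ! j) A \<and> rs ! j \<in> ehom A (Ss ! j) \<and>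
      mat_mult (mat_id (fst A)) (is ! j) = is ! j \<and> mat_mult (rs ! j) (mat_id (fst A)) = rs ! j"
    and orth: "\<And>j k. j < length Ss \<Longrightarrow> k < length Ss \<Longrightarrow>
      mat_mult (rs ! j) (is ! k) = (if j = k then mat_id (fst (Ss ! j)) else (\<lambda>u s. 0))"
    and sum: "\<And>u s. (\<Sum>j<length Ss. mat_mult (is ! j) (rs ! j) u s) = mat_id (fst A) u s"
    by blast
  have "is_direct_sum E A Ss"
    by (rule direct_sum_E[OF A, where inc = "(!) is" and pr = "(!) rs"]) (use IH orth sum in auto)
  moreover have "set Ss \<subseteq> simples"
    using IH by (metis in_set_conv_nth subsetI)
  ultimately show ?thesis by blast
qed

section \<open>Non-degeneracy of the braiding\<close>

lemma double_braid:
  assumes A: "eob A" and B: "eob B" and a: "a \<in> fst A" and b: "b' \<in> fst B" and d: "d \<in> fus \<delta> (lab a) (lab b)"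
  shows "mat_mult (brd B A) (brd A B) (Node a' b' d) (Node a b d) =
    R (lab a) (lab b) d * R (lab b') (lab a) d * pd (degree (lab b')) A a' a * pd (degree (lab a)) B b' b"
proof -
  have "mat_mult (brd B A) (brd A B) (Node a' b' d) (Node a b d) = R (lab a) (lab b) d *
      mat_mult (\<lambda>x y. brd B A (Node a' b' d) (Node y a d)) (pd (degree (lab a)) B) (Node a' b' d) b"
    by (rule brd_col[OF B a d])
  also have "mat_mult (\<lambda>x y. brd B A (Node a' b' d) (Node y a d)) (pd (degree (lab a)) B) (Node a' b' d) b =
      brd B A (Node a' b' d) (Node b' a d) * pd (degree (lab a)) B b' b"
    by (rule mat_mult_single[OF _ pd_colfin[OF B]]) (auto split: if_splits)
  also have "\<dots> = R (lab b') (lab a) d * pd (degree (lab b')) A a' a * pd (degree (lab a)) B b' b"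
    using mat_hhomD[OF pd_in[OF B], of "degree (lab a)" b' b] d b fus_h_simple[of \<delta> "lab a" "lab b"]
    by (cases "pd (degree (lab a)) B b' b = 0") auto
  finally show ?thesis
    by (simp add: mult_ac)
qed

lemma nondegenerate: "nondegenerate_braiding E"
  unfolding nondegenerate_braiding_def
proof (intro ballI impI)
  fix A assume "A \<in> Obj E" and tr: "is_transparent E A"
  then have A: "eob A"
    by (simp add: Obj_E)
  have tr: "R (lab a) (lab b) d * R (lab b') (lab a) d * pd (degree (lab b')) A a' a * pd (degree (lab a)) B b' b =
      (if a' = a \<and> b' = b then 1 else 0)"
    if B: "eob B" and ab: "a \<in> fst A" "a' \<in> fst A" "b \<in> fst B" "b' \<in> fst B" "d \<in> fus \<delta> (lab a) (lab b)" for B a a' b b' d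
  proof -
    have "mat_mult (brd B A) (brd A B) = mat_id (tens \<delta> (fst A) (fst B))"
      using tr B A by (simp add: is_transparent_def Obj_E E_simps(1,2) braid_E fst_tobj)
    then show ?thesis
      using double_braid[OF A B ab(1,4,5), of a'] ab by (simp add: mat_id_def)
  qed
  have L: "Leaf 0 l \<in> fst (sob l e)" for l :: "'a simple" and e
    by (simp add: sX_def)
  have Vec: "\<exists>c. lab a = Vec c" if a: "a \<in> fst A" for a
  proof (rule ccontr)
    assume "\<nexists>c. lab a = Vec c"
    then obtain x where x: "lab a = Tw x"
      by (cases "lab a") auto
    \<comment> \<open>All symbols are 1 here. The double braiding is the action of g on the test
      object, which is -1, while transparency demands 1.\<close>
    show False
      using tr[OF eob_sob[of "-1" "Vec 0"] a a L L, of "lab a"] a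
      by (simp add: x pd_simps gact_sob mat_id_def sX_def q_0 W_simps)
  qed
  have zero: "lab a = Vec 0" if a: "a \<in> fst A" for a
  proof -
    obtain c where c: "lab a = Vec c"
      using Vec[OF a] by blast
    \<comment> \<open>The diagonal entry of the double braiding at the basis vector
      \<open>Vec b\<close> is \<sigma> c b squared, that is, the bicharacter.\<close>
    have "bilin Q c b = 1" for b
      using tr[OF eob_sob[of 1 "Vec b"] a a L L, of "Vec (c + b)"] a
      by (simp add: c pd_simps mat_id_def sX_def bilin_\<sigma> \<sigma>_sym)
    then show ?thesis
      using B_nondegenerate c by blast
  qed
  have triv: "gact A a' a = mat_id (fst A) a' a" for a a'
  proof (cases "a \<in> fst A \<and> a' \<in> fst A")
    case True
    then show ?thesis
      \<comment> \<open>With label 0 in A all symbols are again 1, so the entry of the double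
        braiding is the entry of the action of g on A.\<close>
      using tr[OF eob_sob[of 1 "Tw 0"], of a a' "Leaf 0 (Tw 0)" "Leaf 0 (Tw 0)" "Tw 0"]
      by (simp add: zero L pd_simps mat_id_def sX_def q_0 W_simps)
  next
    case False
    then show ?thesis
      using mat_hhomD[OF gact_in[OF A], of a' a] by (auto simp: mat_id_def)
  qed
  then have G: "gact A = mat_id (fst A)"
    by (intro ext)
  \<comment> \<open>All labels being 0 and the action trivial, every basis vector spans a copy of
    the unit; the enumeration indexes these copies.\<close>
  obtain xs where xs: "set xs = fst A" "distinct xs"
    using finite_distinct_list[OF eob_finite[OF A]] by blast
  let ?L = "Leaf 0 (Vec 0) :: 'a tree"
  define inc where "inc i = (\<lambda>u s. if u = xs ! i \<and> s = ?L then 1 else 0 :: complex)" for i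
  define pr where "pr i = (\<lambda>u s. if s = xs ! i \<and> u = ?L then 1 else 0 :: complex)" for i
  have xsi: "xs ! i \<in> fst A" "lab (xs ! i) = Vec 0" if "i < length xs" for i
    using that xs(1) zero by (auto intro: nth_mem)
  have inc_in: "inc i \<in> mat_hom unit_obj (fst A)" and pr_in: "pr i \<in> mat_hom (fst A) unit_obj" if "i < length xs" for i
    using xsi[OF that] by (auto simp: inc_def pr_def mat_hom_def unit_obj_iff split: if_splits)
  have cf: "colfin (inc i)" "colfin (pr i)" for i
    by (simp_all add: inc_def pr_def colfin_def)
  have "is_direct_sum E A (replicate (length xs) (unit E))"
  proof (rule direct_sum_E[OF A, where inc = inc and pr = pr])
    fix i assume i: "i < length (replicate (length xs) (unit E))"
    have "mat_mult (inc i) (mat_id unit_obj) = inc i" "mat_mult (mat_id (fst A)) (inc i) = inc i"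
      "mat_mult (pr i) (mat_id (fst A)) = pr i" "mat_mult (mat_id unit_obj) (pr i) = pr i"
      using i mat_homD[OF inc_in] mat_homD[OF pr_in] by (auto intro!: mat_id_left mat_id_right cf)
    then show "inc i \<in> ehom (replicate (length xs) (unit E) ! i) A \<and> pr i \<in> ehom A (replicate (length xs) (unit E) ! i)"
      using i by (simp add: ehom_def unit_ob G inc_in pr_in)
  next
    fix i j assume ij: "i < length (replicate (length xs) (unit E))" "j < length (replicate (length xs) (unit E))"
    show "mat_mult (pr i) (inc j) = (if i = j then mat_id (fst (replicate (length xs) (unit E) ! i)) else (\<lambda>u s. 0))"
    proof (intro ext)
      fix u s
      have "mat_mult (pr i) (inc j) u s = pr i u (xs ! i) * inc j (xs ! i) s"
        by (rule mat_mult_single[OF _ cf(1)]) (auto simp: pr_def split: if_splits)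
      then show "mat_mult (pr i) (inc j) u s = (if i = j then mat_id (fst (replicate (length xs) (unit E) ! i)) else (\<lambda>u s. 0)) u s"
        using ij xs(2) by (auto simp: pr_def inc_def mat_id_def unit_ob unit_obj_iff nth_eq_iff_index_eq)
    qed
  next
    fix u s
    have e: "mat_mult (inc i) (pr i) u s = (if u = xs ! i \<and> s = xs ! i then 1 else 0)" for i u s
    proof -
      have "mat_mult (inc i) (pr i) u s = inc i u ?L * pr i ?L s"
        by (rule mat_mult_single[OF _ cf(2)]) (auto simp: inc_def split: if_splits)
      then show ?thesis
        by (simp add: inc_def pr_def)
    qed
    show "(\<Sum>i<length (replicate (length xs) (unit E)). mat_mult (inc i) (pr i) u s) = mat_id (fst A) u s"
    proof (cases "u = s \<and> s \<in> fst A")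
      case True
      then obtain k where k: "k < length xs" "s = xs ! k"
        using xs(1) by (metis in_set_conv_nth)
      have "(\<Sum>i<length xs. mat_mult (inc i) (pr i) u s) = (\<Sum>i<length xs. if i = k then 1 else 0)"
        using True k xs(2) by (intro sum.cong refl) (auto simp: e nth_eq_iff_index_eq)
      then show ?thesis
        using True k by (simp add: mat_id_def)
    next
      case False
      then have "mat_mult (inc i) (pr i) u s = 0" if "i < length xs" for i
        using that xsi by (auto simp: e)
      then show ?thesis
        using False by (auto simp: mat_id_def)
    qed
  qed
  then show "\<exists>n. is_direct_sum E A (replicate n (unit E))"
    by blast
qed

end

section \<open>Duality\<close>

text \<open>The shift by \<delta> is forced: the product of two twisted labels contains
  \<open>Vec 0\<close> only if their classes sum to \<delta>, see
  \<open>Vec_0_in_fus\<close>.\<close>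

fun dual_label :: "'a::ab_group_add mod2 \<Rightarrow> 'a simple \<Rightarrow> 'a simple" where
  "dual_label \<delta> (Vec a) = Vec (- a)"
| "dual_label \<delta> (Tw x) = Tw (x + \<delta>)"

lemma dual_label_dual_label [simp]: "dual_label \<delta> (dual_label \<delta> l) = l"
  by (cases l) (simp_all add: add.assoc)

lemma g_simple_dual_label: "g_simple (dual_label \<delta> l) = dual_label \<delta> (g_simple l)"
  by (cases l) simp_all

lemma Vec_0_in_fus: "Vec 0 \<in> fus \<delta> l m \<longleftrightarrow> m = dual_label \<delta> l"
proof -
  have "0 = \<delta> + x + y \<longleftrightarrow> y = x + \<delta>" for x y
  proof
    assume *: "0 = \<delta> + x + y"
    have "y = (\<delta> + x) + ((\<delta> + x) + y)"
      by (rule mod2_add_self_left[symmetric])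
    then show "y = x + \<delta>"
      unfolding *[symmetric] by (simp add: add.commute)
  qed (simp add: add_ac)
  moreover have "0 = a + b \<longleftrightarrow> b = - a" for a b :: 'a
    by (metis add.inverse_unique add.right_inverse)
  ultimately show ?thesis
    by (cases l; cases m) (auto simp: cls_zero)
qed

lemma g_simple_eq_Vec_0 [simp]: "g_simple m = Vec 0 \<longleftrightarrow> m = Vec 0"
  by (cases m) auto

context crossed_data
begin

text \<open>The sign that the tensor structure contributes when g acts on the pairing of a basis
  vector with its dual.\<close>

definition dsign where "dsign l = \<tau> (dual_label \<delta> l) l (Vec 0)"

lemma dsign_simps [simp]:
  "\<tau> (dual_label \<delta> l) l (Vec 0) = dsign l" "\<tau> l (dual_label \<delta> l) (Vec 0) = dsign l"
  "dsign l * dsign l = 1" "dsign l * (dsign l * x) = x" "dsign (g_simple l) = dsign l"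
  by (cases l; simp add: dsign_def W_simps W_neg_self)+

text \<open>The coefficient of the coevaluation, chosen so that the first zigzag identity holds when
  ev has coefficient 1. It also serves the second, because the corresponding entry of
  \<open>Fi\<close> at the dual label has the same value.\<close>

definition dcoeff where "dcoeff l = inverse (F l (dual_label \<delta> l) l (Vec 0) (Vec 0) l)"

lemma dcoeff_simps:
  "F l (dual_label \<delta> l) l (Vec 0) (Vec 0) l * dcoeff l = 1"
  "Fi (dual_label \<delta> l) l (dual_label \<delta> l) (Vec 0) (Vec 0) (dual_label \<delta> l) * dcoeff l = 1"
  "dcoeff (g_simple l) = dcoeff l"
proof -
  have fus: "Vec 0 \<in> fus \<delta> l (dual_label \<delta> l)" "Vec 0 \<in> fus \<delta> (dual_label \<delta> l) l"
    by (simp_all add: Vec_0_in_fus)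
  have "F l (dual_label \<delta> l) l (Vec 0) (Vec 0) l = (case l of Vec a \<Rightarrow> W (cls a) a (- a) | Tw x \<Rightarrow> \<epsilon> * inv_sqrt_double TYPE('a))"
    "Fi (dual_label \<delta> l) l (dual_label \<delta> l) (Vec 0) (Vec 0) (dual_label \<delta> l) = (case l of Vec a \<Rightarrow> W (cls a) a (- a) | Tw x \<Rightarrow> \<epsilon> * inv_sqrt_double TYPE('a))"
    for l
    by (cases l; simp add: F_def Fi_def W_simps W_neg_self \<sigma>_zero add_ac)+
  note FW = this
  have nz: "(case l of Vec a \<Rightarrow> W (cls a) a (- a) | Tw x \<Rightarrow> \<epsilon> * inv_sqrt_double TYPE('a)) \<noteq> 0"
    using \<epsilon>_sign by (cases l) (auto simp: W_nonzero inv_sqrt_double_nonzero)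
  show "F l (dual_label \<delta> l) l (Vec 0) (Vec 0) l * dcoeff l = 1"
    "Fi (dual_label \<delta> l) l (dual_label \<delta> l) (Vec 0) (Vec 0) (dual_label \<delta> l) * dcoeff l = 1"
    unfolding dcoeff_def FW by (rule right_inverse[OF nz])+
  show "dcoeff (g_simple l) = dcoeff l"
    unfolding dcoeff_def FW by (cases l) (simp_all add: W_simps W_neg_self)
qed

definition dual_pair where
  "dual_pair A A' d \<longleftrightarrow> eob A \<and> eob A' \<and> bij_betw d (fst A) (fst A') \<and>
     (\<forall>a\<in>fst A. lab (d a) = dual_label \<delta> (lab a)) \<and>
     (\<forall>a\<in>fst A. \<forall>b\<in>fst A. gact A' (d b) (d a) = dsign (lab a) * gact A a b)"

lemma dual_pair_sym:
  assumes "dual_pair A A' d"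
  shows "dual_pair A' A (inv_into (fst A) d)"
  unfolding dual_pair_def
proof (intro conjI ballI)
  have bij: "bij_betw d (fst A) (fst A')"
    using assms by (simp add: dual_pair_def)
  then show "bij_betw (inv_into (fst A) d) (fst A') (fst A)"
    by (rule bij_betw_inv_into)
  show "eob A'" "eob A"
    using assms by (simp_all add: dual_pair_def)
  fix a' assume a': "a' \<in> fst A'"
  then obtain a where a: "a \<in> fst A" "a' = d a"
    using bij by (auto simp: bij_betw_def)
  have ia: "inv_into (fst A) d (d a) = a"
    using bij a by (simp add: bij_betw_def)
  show "lab (inv_into (fst A) d a') = dual_label \<delta> (lab a')"
    using assms a ia by (simp add: dual_pair_def)
  fix b' assume b': "b' \<in> fst A'"
  then obtain b where b: "b \<in> fst A" "b' = d b"
    using bij by (auto simp: bij_betw_def)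
  have ib: "inv_into (fst A) d (d b) = b"
    using bij b by (simp add: bij_betw_def)
  have ds: "dsign (dual_label \<delta> l) = dsign l" for l
    by (simp add: dsign_def[of "dual_label \<delta> l"])
  have "gact A b a = dsign (lab b) * gact A' (d a) (d b)"
    using assms a b by (simp add: dual_pair_def)
  also have "\<dots> = dsign (lab (d a)) * gact A' (d a) (d b)"
  proof (cases "gact A b a = 0")
    case False
    then show ?thesis
      using mat_hhomD[OF gact_in, of A b a] assms a by (simp add: dual_pair_def ds)
  qed (use assms a b in \<open>simp add: dual_pair_def\<close>)
  finally show "gact A (inv_into (fst A) d b') (inv_into (fst A) d a') = dsign (lab a') * gact A' a' b'"
    by (simp add: a b ia[unfolded a(2)] ib)
qed

definition evm :: "('a tree \<Rightarrow> 'a tree) \<Rightarrow> 'a tree set \<Rightarrow> 'a mat" where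
  "evm d X = (\<lambda>u s. case s of Node x a m \<Rightarrow>
     if u = Leaf 0 (Vec 0) \<and> a \<in> X \<and> x = d a \<and> m = Vec 0 then 1 else 0 | _ \<Rightarrow> 0)"

definition coevm :: "('a tree \<Rightarrow> 'a tree) \<Rightarrow> 'a tree set \<Rightarrow> 'a mat" where
  "coevm d X = (\<lambda>u s. case u of Node a x m \<Rightarrow>
     if s = Leaf 0 (Vec 0) \<and> a \<in> X \<and> x = d a \<and> m = Vec 0 then dcoeff (lab a) else 0 | _ \<Rightarrow> 0)"

lemma evm_row:
  assumes "finite X" "colfin N"
  shows "mat_mult (evm d X) N (Leaf 0 (Vec 0)) s = (\<Sum>c\<in>X. N (Node (d c) c (Vec 0)) s)"
proof -
  have "mat_mult (evm d X) N (Leaf 0 (Vec 0)) s =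
      (\<Sum>t\<in>(\<lambda>c. Node (d c) c (Vec 0)) ` X. evm d X (Leaf 0 (Vec 0)) t * N t s)"
    using assms by (intro mat_mult_sum_row) (auto simp: evm_def split: basis_tree.splits if_splits)
  then show ?thesis
    by (simp add: sum.reindex inj_on_def evm_def)
qed

lemma coevm_col:
  assumes "finite X"
  shows "mat_mult N (coevm d X) u (Leaf 0 (Vec 0)) = (\<Sum>c\<in>X. N u (Node c (d c) (Vec 0)) * dcoeff (lab c))"
proof -
  have "mat_mult N (coevm d X) u (Leaf 0 (Vec 0)) =
      (\<Sum>t\<in>(\<lambda>c. Node c (d c) (Vec 0)) ` X. N u t * coevm d X t (Leaf 0 (Vec 0)))"
    using assms by (intro mat_mult_sum) (auto simp: coevm_def split: basis_tree.splits if_splits)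
  then show ?thesis
    by (simp add: sum.reindex inj_on_def coevm_def)
qed

text \<open>In the equivariance of ev and coev the sign of the tensor structure cancels the
  \<open>dsign\<close> of the dual action, and the two action matrices multiply to the identity. In
  the zigzags only the channel \<open>Vec 0\<close> survives, with value 1 by the choice of
  \<open>dcoeff\<close>.\<close>

lemma dual_pair_is_dual:
  assumes dp: "dual_pair A A' d"
  shows "is_dual E A A' (evm d (fst A)) (coevm d (fst A))"
proof -
  let ?L = "Leaf 0 (Vec 0) :: 'a tree" and ?X = "fst A" and ?X' = "fst A'"
  let ?ev = "evm d ?X" and ?co = "coevm d ?X"
  have A: "eob A" and A': "eob A'" and bij: "bij_betw d ?X ?X'"
    and lab: "\<And>a. a \<in> ?X \<Longrightarrow> lab (d a) = dual_label \<delta> (lab a)"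
    and act: "\<And>a b. a \<in> ?X \<Longrightarrow> b \<in> ?X \<Longrightarrow> gact A' (d b) (d a) = dsign (lab a) * gact A a b"
    using dp by (auto simp: dual_pair_def)
  note fin = eob_finite[OF A] eob_finite[OF A'] finite_tens
  have dX: "a \<in> ?X \<Longrightarrow> d a \<in> ?X'" for a
    using bij by (auto simp: bij_betw_def)
  have dE: "\<exists>a\<in>?X. x = d a" if "x \<in> ?X'" for x
    using bij that by (auto simp: bij_betw_def)
  have dinj: "a \<in> ?X \<Longrightarrow> b \<in> ?X \<Longrightarrow> d a = d b \<longleftrightarrow> a = b" for a b
    using bij by (auto simp: bij_betw_def inj_on_def)
  have fus0: "Vec 0 \<in> fus \<delta> l (dual_label \<delta> l)" "Vec 0 \<in> fus \<delta> (dual_label \<delta> l) l" for l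
    by (simp_all add: Vec_0_in_fus)
  have GG: "(\<Sum>c\<in>?X. gact A a c * gact A c b) = mat_id ?X a b" for a b
    by (simp add: mat_hhom_mult_sum[OF gact_in[OF A] fin(1), symmetric] gact_gact[OF A])
  have ev_in: "?ev \<in> mat_hom (tens \<delta> ?X' ?X) unit_obj"
    by (rule mat_homI) (auto simp: evm_def unit_obj_iff lab dX fus0 split: basis_tree.splits if_splits)
  have co_in: "?co \<in> mat_hom unit_obj (tens \<delta> ?X ?X')"
    by (rule mat_homI) (auto simp: coevm_def unit_obj_iff lab dX fus0 split: basis_tree.splits if_splits)
  have cco: "colfin ?co" and cev: "colfin ?ev"
    using mat_hom_colfin[OF co_in] mat_hom_colfin[OF ev_in] by (simp_all add: fin unit_obj_def)
  have "mat_mult ?ev (gact (tobj E A' A)) = ?ev"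
  proof (rule mat_hhom_eqI)
    show "mat_mult ?ev (gact (tobj E A' A)) \<in> mat_hhom Z2_g (tens \<delta> ?X' ?X) unit_obj"
      using mat_hhom_mult[OF gact_in[OF eob_tobj[OF A' A], unfolded fst_tobj] ev_in[folded mat_hhom_1]] by simp
    show "?ev \<in> mat_hhom Z2_g (tens \<delta> ?X' ?X) unit_obj"
      by (rule mat_hhomI) (auto simp: evm_def unit_obj_iff lab dX fus0 split: basis_tree.splits if_splits)
    fix u s :: "'a tree" assume "u \<in> unit_obj" "s \<in> tens \<delta> ?X' ?X"
    then obtain x b m where *: "u = ?L" "s = Node x b m" "x \<in> ?X'" "b \<in> ?X" "m \<in> fus \<delta> (lab x) (lab b)"
      by (elim tensE) (auto simp: unit_obj_iff)
    obtain a where a: "a \<in> ?X" "x = d a"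
      using dE[OF *(3)] by blast
    have m: "m \<in> fus \<delta> (lab (d a)) (lab b)"
      using * a by simp
    have "mat_mult ?ev (gact (tobj E A' A)) u s = \<tau> (lab (d a)) (lab b) m *
        (\<Sum>x\<in>?X'. \<Sum>y\<in>?X. ?ev u (Node x y (g_simple m)) * gact A' x (d a) * gact A y b)"
      unfolding gact_tens[OF A' A] *(2) a(2)
      by (subst gtens_col[OF gact_in[OF A'] gact_in[OF A] fin(2,1) m]) simp
    also have "(\<Sum>x\<in>?X'. \<Sum>y\<in>?X. ?ev u (Node x y (g_simple m)) * gact A' x (d a) * gact A y b) =
        (\<Sum>y\<in>?X. \<Sum>x\<in>?X'. ?ev u (Node x y (g_simple m)) * gact A' x (d a) * gact A y b)"
      by (rule sum.swap)
    also have "\<dots> = (\<Sum>y\<in>?X. \<Sum>x\<in>?X'. if x = d y then (if m = Vec 0 then gact A' (d y) (d a) * gact A y b else 0) else 0)"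
      using * by (intro sum.cong refl) (auto simp: evm_def)
    also have "\<dots> = (\<Sum>y\<in>?X. if m = Vec 0 then dsign (lab a) * (gact A a y * gact A y b) else 0)"
      using a fin by (intro sum.cong refl) (simp add: sum.delta dX act)
    also have "\<dots> = (if m = Vec 0 then dsign (lab a) * mat_id ?X a b else 0)"
      by (simp add: sum_distrib_left[symmetric] GG)
    also have "\<tau> (lab (d a)) (lab b) m * \<dots> = ?ev u s"
      using * a by (auto simp: evm_def mat_id_def dinj lab)
    finally show "mat_mult ?ev (gact (tobj E A' A)) u s = ?ev u s" .
  qed
  moreover have "mat_mult (mat_id unit_obj) ?ev = ?ev"
    using mat_homD[OF ev_in] by (intro mat_id_left[OF cev]) auto
  ultimately have ev: "?ev \<in> ehom (tobj E A' A) (unit E)"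
    using ev_in by (simp add: ehom_def fst_tobj unit_ob)
  have "mat_mult (gact (tobj E A A')) ?co = ?co"
  proof (rule mat_hhom_eqI)
    show "mat_mult (gact (tobj E A A')) ?co \<in> mat_hhom Z2_g unit_obj (tens \<delta> ?X ?X')"
      using mat_hhom_mult[OF co_in[folded mat_hhom_1] gact_in[OF eob_tobj[OF A A'], unfolded fst_tobj]] by simp
    show "?co \<in> mat_hhom Z2_g unit_obj (tens \<delta> ?X ?X')"
      by (rule mat_hhomI) (auto simp: coevm_def unit_obj_iff lab dX fus0 split: basis_tree.splits if_splits)
    fix u s :: "'a tree" assume "s \<in> unit_obj" "u \<in> tens \<delta> ?X ?X'"
    then obtain x a m where *: "s = ?L" "u = Node a x m" "a \<in> ?X" "x \<in> ?X'" "m \<in> fus \<delta> (lab a) (lab x)"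
      by (elim tensE) (auto simp: unit_obj_iff)
    obtain b where b: "b \<in> ?X" "x = d b"
      using dE[OF *(4)] by blast
    have "mat_mult (gact (tobj E A A')) ?co u s =
        (\<Sum>c\<in>?X. gact (tobj E A A') u (Node c (d c) (Vec 0)) * dcoeff (lab c))"
      unfolding *(1) by (rule coevm_col[OF fin(1)])
    also have "\<dots> = (\<Sum>c\<in>?X. (if m = Vec 0 then dcoeff (lab a) else 0) * (gact A a c * gact A c b))"
    proof (rule sum.cong[OF refl])
      fix c assume c: "c \<in> ?X"
      show "gact (tobj E A A') u (Node c (d c) (Vec 0)) * dcoeff (lab c) =
        (if m = Vec 0 then dcoeff (lab a) else 0) * (gact A a c * gact A c b)"
        using mat_hhomD[OF gact_in[OF A], of a c] * b c
        by (cases "gact A a c = 0") (auto simp: gact_tens[OF A A'] fus0 lab act dcoeff_simps(3))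
    qed
    also have "\<dots> = (if m = Vec 0 then dcoeff (lab a) else 0) * mat_id ?X a b"
      by (simp add: sum_distrib_left[symmetric] GG)
    also have "\<dots> = ?co u s"
      using * b by (auto simp: coevm_def mat_id_def dinj)
    finally show "mat_mult (gact (tobj E A A')) ?co u s = ?co u s" .
  qed
  moreover have "mat_mult ?co (mat_id unit_obj) = ?co"
    using mat_homD[OF co_in] by (intro mat_id_right) auto
  ultimately have co: "?co \<in> ehom (unit E) (tobj E A A')"
    using co_in by (simp add: ehom_def fst_tobj unit_ob)
  have zig1: "mat_mult (mat_runit ?X) (mat_mult (mat_tens \<delta> (mat_id ?X) ?ev)
      (mat_mult (amat F ?X ?X' ?X) (mat_tens \<delta> ?co (mat_id ?X)))) = mat_lunit ?X"
  proof -
    let ?N2 = "mat_tens \<delta> ?co (mat_id ?X)"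
    let ?N1 = "mat_mult (amat F ?X ?X' ?X) ?N2"
    let ?N0 = "mat_mult (mat_tens \<delta> (mat_id ?X) ?ev) ?N1"
    have N2: "?N2 \<in> mat_hom (tens \<delta> unit_obj ?X) (tens \<delta> (tens \<delta> ?X ?X') ?X)"
      unfolding mat_tens_eq_gtens mat_hhom_1[symmetric]
      by (intro gtens_in mat_id_hhom co_in[folded mat_hhom_1])
    have N1: "?N1 \<in> mat_hom (tens \<delta> unit_obj ?X) (tens \<delta> ?X (tens \<delta> ?X' ?X))"
      by (rule mat_mult_in[OF N2 amat_F_in])
    have "mat_tens \<delta> (mat_id ?X) ?ev \<in> mat_hom (tens \<delta> ?X (tens \<delta> ?X' ?X)) (tens \<delta> ?X unit_obj)"
      unfolding mat_tens_eq_gtens mat_hhom_1[symmetric]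
      by (intro gtens_in mat_id_hhom ev_in[folded mat_hhom_1])
    then have N0: "?N0 \<in> mat_hom (tens \<delta> unit_obj ?X) (tens \<delta> ?X unit_obj)"
      by (rule mat_mult_in[OF N1])
    have c: "colfin ?N2" "colfin ?N1" "colfin ?N0"
      using N2 N1 N0 by (auto elim!: mat_hom_colfin simp: fin unit_obj_def)
    show ?thesis
    proof (rule mat_hom_eqI[OF mat_mult_in[OF N0 lunit_in(2)] lunit_in(1)])
      fix a s assume a: "a \<in> ?X" and "s \<in> tens \<delta> unit_obj ?X"
      then obtain b where s: "s = Node ?L b (lab b)" "b \<in> ?X"
        by (auto elim!: tensE simp: unit_obj_iff)
      have "mat_mult (mat_runit ?X) ?N0 a s = ?N0 (Node a ?L (lab a)) s"
        by (rule lunit_row(2)[OF a c(3)])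
      also have "\<dots> = mat_mult ?ev (\<lambda>y s'. ?N1 (Node a y (lab a)) s) ?L s"
        by (rule tens_id_row_left[OF ev_in a _ c(2)]) simp
      also have "\<dots> = (\<Sum>k\<in>?X. ?N1 (Node a (Node (d k) k (Vec 0)) (lab a)) s)"
        by (rule evm_row[OF fin(1) colfin_slice[OF _ c(2)]]) (auto intro: injI)
      also have "\<dots> = (\<Sum>k\<in>?X. if k = b then (if a = b then 1 else 0) else 0)"
      proof (rule sum.cong[OF refl])
        fix k assume k: "k \<in> ?X"
        have "?N1 (Node a (Node (d k) k (Vec 0)) (lab a)) s =
            (\<Sum>e\<in>UNIV. F (lab a) (lab (d k)) (lab k) e (Vec 0) (lab a) * ?N2 (Node (Node a (d k) e) k (lab a)) s)"
          by (rule amat_row[OF a dX[OF k] k c(1)])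
        also have "\<dots> = F (lab a) (lab (d k)) (lab k) (Vec 0) (Vec 0) (lab a) * ?N2 (Node (Node a (d k) (Vec 0)) k (lab a)) s"
          by (rule sum_unique) (simp add: s coevm_def)
        also have "\<dots> = (if k = b then (if a = b then 1 else 0) else 0)"
          using a k s(2) dcoeff_simps(1)[of "lab a"] by (auto simp: s(1) coevm_def mat_id_def dinj lab)
        finally show "?N1 (Node a (Node (d k) k (Vec 0)) (lab a)) s = (if k = b then (if a = b then 1 else 0) else 0)" .
      qed
      also have "\<dots> = mat_lunit ?X a s"
        using a s(2) fin(1) unfolding s(1) by (auto simp: lunit_Node sum.delta)
      finally show "mat_mult (mat_runit ?X) ?N0 a s = mat_lunit ?X a s" .
    qed
  qed
  have zig2: "mat_mult (mat_lunit ?X') (mat_mult (mat_tens \<delta> ?ev (mat_id ?X'))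
      (mat_mult (aimat Fi ?X' ?X ?X') (mat_tens \<delta> (mat_id ?X') ?co))) = mat_runit ?X'"
  proof -
    let ?N2 = "mat_tens \<delta> (mat_id ?X') ?co"
    let ?N1 = "mat_mult (aimat Fi ?X' ?X ?X') ?N2"
    let ?N0 = "mat_mult (mat_tens \<delta> ?ev (mat_id ?X')) ?N1"
    have N2: "?N2 \<in> mat_hom (tens \<delta> ?X' unit_obj) (tens \<delta> ?X' (tens \<delta> ?X ?X'))"
      unfolding mat_tens_eq_gtens mat_hhom_1[symmetric]
      by (intro gtens_in mat_id_hhom co_in[folded mat_hhom_1])
    have N1: "?N1 \<in> mat_hom (tens \<delta> ?X' unit_obj) (tens \<delta> (tens \<delta> ?X' ?X) ?X')"
      by (rule mat_mult_in[OF N2 aimat_Fi_in])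
    have "mat_tens \<delta> ?ev (mat_id ?X') \<in> mat_hom (tens \<delta> (tens \<delta> ?X' ?X) ?X') (tens \<delta> unit_obj ?X')"
      unfolding mat_tens_eq_gtens mat_hhom_1[symmetric]
      by (intro gtens_in mat_id_hhom ev_in[folded mat_hhom_1])
    then have N0: "?N0 \<in> mat_hom (tens \<delta> ?X' unit_obj) (tens \<delta> unit_obj ?X')"
      by (rule mat_mult_in[OF N1])
    have c: "colfin ?N2" "colfin ?N1" "colfin ?N0"
      using N2 N1 N0 by (auto elim!: mat_hom_colfin simp: fin unit_obj_def)
    show ?thesis
    proof (rule mat_hom_eqI[OF mat_mult_in[OF N0 lunit_in(1)] lunit_in(2)])
      fix a' s assume a': "a' \<in> ?X'" and "s \<in> tens \<delta> ?X' unit_obj"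
      then obtain b' where s: "s = Node b' ?L (lab b')" "b' \<in> ?X'"
        by (auto elim!: tensE simp: unit_obj_iff)
      obtain a b where ab: "a \<in> ?X" "a' = d a" "b \<in> ?X" "b' = d b"
        using dE[OF a'] dE[OF s(2)] by blast
      have "mat_mult (mat_lunit ?X') ?N0 a' s = ?N0 (Node ?L a' (lab a')) s"
        by (rule lunit_row(1)[OF a' c(3)])
      also have "\<dots> = mat_mult ?ev (\<lambda>y s'. ?N1 (Node y a' (lab a')) s) ?L s"
        by (rule tens_id_row_right[OF ev_in a' _ c(2)]) simp
      also have "\<dots> = (\<Sum>k\<in>?X. ?N1 (Node (Node (d k) k (Vec 0)) a' (lab a')) s)"
        by (rule evm_row[OF fin(1) colfin_slice[OF _ c(2)]]) (auto intro: injI)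
      also have "\<dots> = (\<Sum>k\<in>?X. if k = b then (if a = b then 1 else 0) else 0)"
      proof (rule sum.cong[OF refl])
        fix k assume k: "k \<in> ?X"
        have "?N1 (Node (Node (d k) k (Vec 0)) a' (lab a')) s =
            (\<Sum>f\<in>UNIV. Fi (lab (d k)) (lab k) (lab a') (Vec 0) f (lab a') * ?N2 (Node (d k) (Node k a' f) (lab a')) s)"
          by (rule aimat_row[OF dX[OF k] k a' c(1)])
        also have "\<dots> = Fi (lab (d k)) (lab k) (lab a') (Vec 0) (Vec 0) (lab a') * ?N2 (Node (d k) (Node k a' (Vec 0)) (lab a')) s"
          by (rule sum_unique) (simp add: s coevm_def)
        also have "\<dots> = (if k = b then (if a = b then 1 else 0) else 0)"
          using k dX[OF k] dcoeff_simps(2)[of "lab a"] ab by (auto simp: s(1) coevm_def mat_id_def dinj lab)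
        finally show "?N1 (Node (Node (d k) k (Vec 0)) a' (lab a')) s = (if k = b then (if a = b then 1 else 0) else 0)" .
      qed
      also have "\<dots> = mat_runit ?X' a' s"
        using a' s ab fin by (auto simp: lunit_Node dinj)
      finally show "mat_mult (mat_lunit ?X') ?N0 a' s = mat_runit ?X' a' s" .
    qed
  qed
  show ?thesis
    unfolding is_dual_def Hom_E assoc_inv_E[OF A' A A']
    using ev co zig1 zig2 by (simp add: E_simps(1,2,7,9,10,11) mat_assoc_F)
qed

text \<open>Any injective renaming of trees that dualises labels would serve; the repeated child is
  only a name for the dual basis vector.\<close>

definition dt :: "'a tree \<Rightarrow> 'a tree" where
  "dt t = Node t t (dual_label \<delta> (lab t))"

definition undt :: "'a tree \<Rightarrow> 'a tree" where
  "undt t = (case t of Node a b m \<Rightarrow> a | _ \<Rightarrow> t)"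

lemma dt_simps [simp]: "undt (dt t) = t" "lab (dt t) = dual_label \<delta> (lab t)" "dt s = dt t \<longleftrightarrow> s = t"
  by (auto simp: dt_def undt_def)

lemma dual_exists:
  assumes A: "eob A"
  obtains A' where "dual_pair A A' dt"
proof -
  let ?X = "fst A" and ?X' = "dt ` fst A"
  \<comment> \<open>G squares to the identity because the two signs in each term belong to labels in
    one g-orbit, on which \<open>dsign\<close> is constant.\<close>
  define G where "G = (\<lambda>u s. if u \<in> ?X' \<and> s \<in> ?X' then dsign (lab (undt s)) * gact A (undt s) (undt u) else 0)"
  note fin = eob_finite[OF A]
  have G_dt: "G (dt b) (dt a) = dsign (lab a) * gact A a b" if "a \<in> ?X" "b \<in> ?X" for a b
    using that by (simp add: G_def)
  have G_in: "G \<in> mat_hhom Z2_g ?X' ?X'"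
  proof (rule mat_hhomI)
    fix u s assume nz: "G u s \<noteq> 0"
    then obtain a b where ab: "a \<in> ?X" "b \<in> ?X" "u = dt b" "s = dt a"
      by (auto simp: G_def split: if_splits)
    then have "lab a = g_simple (lab b)"
      using nz mat_hhomD[OF gact_in[OF A], of a b] by (simp add: G_dt)
    then show "u \<in> ?X' \<and> s \<in> ?X' \<and> lab u = h_simple Z2_g (lab s)"
      using ab by (simp add: g_simple_dual_label)
  qed
  have "mat_mult G G = mat_id ?X'"
  proof (rule mat_hom_eqI[OF _ mat_id_in])
    show "mat_mult G G \<in> mat_hom ?X' ?X'"
      using mat_hhom_mult[OF G_in G_in] by (simp add: mat_hhom_1)
    fix u s assume "u \<in> ?X'" "s \<in> ?X'"
    then obtain a b where ab: "a \<in> ?X" "b \<in> ?X" "u = dt b" "s = dt a"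
      by auto
    have "mat_mult G G u s = (\<Sum>t\<in>?X'. G u t * G t s)"
      using mat_hhom_mult_sum[OF G_in] fin by simp
    also have "\<dots> = (\<Sum>c\<in>?X. G u (dt c) * G (dt c) s)"
      by (simp add: sum.reindex inj_on_def)
    also have "\<dots> = (\<Sum>c\<in>?X. gact A a c * gact A c b)"
    proof (rule sum.cong[OF refl])
      fix c assume "c \<in> ?X"
      then show "G u (dt c) * G (dt c) s = gact A a c * gact A c b"
        using mat_hhomD[OF gact_in[OF A], of a c] ab by (cases "gact A a c = 0") (simp_all add: G_dt mult_ac)
    qed
    also have "\<dots> = mat_id ?X a b"
      by (simp add: mat_hhom_mult_sum[OF gact_in[OF A] fin, symmetric] gact_gact[OF A])
    finally show "mat_mult G G u s = mat_id ?X' u s"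
      using ab by (auto simp: mat_id_def)
  qed
  from eobI[OF _ G_in this] have "eob (?X', pm G)" "gact (?X', pm G) = G"
    using fin by simp_all
  then have "dual_pair A (?X', pm G) dt"
    using A by (simp add: dual_pair_def bij_betw_def inj_on_def G_dt)
  then show thesis
    by (rule that)
qed

lemma rigid_E: "is_rigid E"
  unfolding is_rigid_def
proof (intro ballI conjI)
  fix A assume "A \<in> Obj E"
  then have "eob A"
    by (simp add: Obj_E)
  then obtain A' where A': "dual_pair A A' dt"
    by (rule dual_exists)
  then have "A' \<in> Obj E"
    by (simp add: dual_pair_def Obj_E)
  then show "\<exists>A'\<in>Obj E. \<exists>ev coev. is_dual E A A' ev coev" "\<exists>A'\<in>Obj E. \<exists>ev coev. is_dual E A' A ev coev"
    using dual_pair_is_dual[OF A'] dual_pair_is_dual[OF dual_pair_sym[OF A']] by blast+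
qed

lemma fusion: "fusion_category E"
proof -
  interpret monoidal_category E
    by (rule monoidal)
  show ?thesis
  proof
    show "\<exists>S. finite S \<and> unit E \<in> S \<and> (\<forall>A\<in>S. is_simple E A) \<and>
        (\<forall>A\<in>S. \<forall>B\<in>S. A \<noteq> B \<longrightarrow> Hom E A B = {zero E}) \<and>
        (\<forall>X\<in>Obj E. \<exists>As. set As \<subseteq> S \<and> is_direct_sum E X As)"
    proof (intro exI[of _ simples] conjI ballI impI)
      show "is_simple E A" if "A \<in> simples" for A
        using that by (auto simp: simples_def is_simple_sob)
      show "Hom E A B = {zero E}" if "A \<in> simples" "B \<in> simples" "A \<noteq> B" for A B
        using ehom_simples_zero[OF that] ehom_zero[of A B] unfolding Hom_E E_simps by blast
    qed (auto simp: finite_simples unit_simple semisimple_E Obj_E)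
  qed (auto simp: direct_sums_E rigid_E)
qed

lemma ribbon: "ribbon_fusion_category E"
proof -
  interpret fusion_category E
    by (rule fusion)
  show ?thesis
  proof
    fix A B D A' B' f g ev coev
    show "is_iso E (tobj E A B) (tobj E B A) (braid E A B)" if "A \<in> Obj E" "B \<in> Obj E"
      using that by (simp add: Obj_E braid_E braid_iso_E)
    show "comp E (braid E A' B') (tmor E f g) = comp E (tmor E g f) (braid E A B)"
      if "A \<in> Obj E" "A' \<in> Obj E" "B \<in> Obj E" "B' \<in> Obj E" "f \<in> Hom E A A'" "g \<in> Hom E B B'"
      using that braid_natural_E by (simp add: Obj_E Hom_E braid_E E_simps(2,7))
    show "comp E (assoc E B D A) (comp E (braid E A (tobj E B D)) (assoc E A B D)) =
        comp E (tmor E (idm E B) (braid E A D)) (comp E (assoc E B A D) (tmor E (braid E A B) (idm E D)))"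
      if "A \<in> Obj E" "B \<in> Obj E" "D \<in> Obj E"
      using that hexagon1_E[of A B D]
      by (simp add: Obj_E braid_E eob_tobj E_simps(1,2,7,9) mat_assoc_F)
    show "comp E (assoc_inv E D A B) (comp E (braid E (tobj E A B) D) (assoc_inv E A B D)) =
        comp E (tmor E (braid E A D) (idm E B)) (comp E (assoc_inv E A D B) (tmor E (idm E A) (braid E B D)))"
      if "A \<in> Obj E" "B \<in> Obj E" "D \<in> Obj E"
      using that hexagon2_E[of A B D]
      by (simp add: Obj_E braid_E eob_tobj assoc_inv_E E_simps(1,2,7))
    show "is_iso E A A (twist E A)" if "A \<in> Obj E"
      using that by (simp add: Obj_E twist_E twist_iso_E)
    show "comp E (twist E A') f = comp E f (twist E A)" if "A \<in> Obj E" "A' \<in> Obj E" "f \<in> Hom E A A'"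
      using that tw_natural[of A A' f Z2_1] by (simp add: Obj_E Hom_E twist_E E_simps(2) mat_hhom_1 ehom_in ehom_eq)
    show "twist E (tobj E A B) = comp E (braid E B A) (comp E (braid E A B) (tmor E (twist E A) (twist E B)))"
      if "A \<in> Obj E" "B \<in> Obj E"
      using that twist_tensor_E by (simp add: Obj_E braid_E twist_E eob_tobj E_simps(2,7))
    show "comp E ev (tmor E (twist E A') (idm E A)) = comp E ev (tmor E (idm E A') (twist E A))"
      if "A \<in> Obj E" "A' \<in> Obj E" "is_dual E A A' ev coev"
      using that twist_dual_E[of A A' ev] by (simp add: Obj_E Hom_E twist_E is_dual_def E_simps(1,2,7))
  qed
qed

end

theorem proposition5p14:
  fixes Q q :: "'a::{finite, ab_group_add} \<Rightarrow> complex"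
    and \<sigma> :: "'a \<Rightarrow> 'a \<Rightarrow> complex"
    and \<omega> :: "'a \<Rightarrow> 'a \<Rightarrow> 'a \<Rightarrow> complex"
    and \<delta> :: "'a mod2"
    and \<epsilon> \<alpha> \<beta> :: complex
  assumes "crossed_data Q \<sigma> \<omega> \<delta> \<epsilon> q \<alpha> \<beta>"
  shows "nondegenerate_braiding (equivariantisation (crossed_category \<sigma> \<omega> \<delta> \<epsilon> q \<alpha> \<beta>)) \<and>
         modular_tensor_category (equivariantisation (crossed_category \<sigma> \<omega> \<delta> \<epsilon> q \<alpha> \<beta>))"
proof -
  interpret crossed_data Q \<sigma> \<omega> \<delta> \<epsilon> q \<alpha> \<beta>
    by (fact assms)
  show ?thesis
    by (simp add: modular_tensor_category_def nondegenerate ribbon)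
qed

end
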